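(* Let $\mathbb{K}$ be a field, $S=\mathbb{K}[x_1,\ldots,x_\ell]$, and let $\mathcal{B}$ be an NT-free-2 arrangement in $\mathbb{K}^\ell$. Then the projective dimension of the logarithmic derivation module satisfies $\mathrm{pd}_S(D(\mathcal{B}))\le 1$ if and only if $|\mathrm{DS}(\mathcal{B})|\le \ell+2$.
   Context: Let $V=\mathbb{K}^\ell$ and $S=\mathrm{Sym}(V^* )\cong\mathbb{K}[x_1,\ldots,x_\ell]$ with the usual grading. A (central) hyperplane arrangement $\mathcal{A}$ is a finite set of linear hyperplanes in $V$; for $H\in\mathcal{A}$, $\alpha_H\in S_1$ denotes a linear form with $H=\ker\alpha_H$. The logarithmic derivation module is $D(\mathcal{A})=\{\theta\in\mathrm{Der}\,S \mid \theta(\alpha_H)\in S\alpha_H \text{ for all } H\in\mathcal{A}\}$, where $\mathrm{Der}\,S=\bigoplus_{i=1}^{\ell} S\,\partial_{x_i}$. A derivation $\sum f_i\partial_{x_i}$ is homogeneous of degree $d$ if all $f_i\in S_d$; this makes $D(\mathcal{A})$ a graded $S$-module. $\mathcal{A}$ is free if $D(\mathcal{A})$ is a free $S$-module. An arrangement $\mathcal{B}$ is NT-free-2 (next-to-free-minus-two) if there exist a free arrangement $\mathcal{A}$ and two (distinct) hyperplanes $H_1,H_2\in\mathcal{A}$ with $\mathcal{B}=\mathcal{A}\setminus\{H_1,H_2\}$. The derivation degree sequence $\mathrm{DS}(\mathcal{B})$ is the unordered sequence of degrees of a minimal set of homogeneous generators of $D(\mathcal{B})$, and $|\mathrm{DS}(\mathcal{B})|$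 is the number of minimal homogeneous generators of $D(\mathcal{B})$. *)

theory Defs
  imports "HOL-Analysis.Finite_Cartesian_Product" "HOL-Library.Poly_Mapping"
    "HOL-Library.Multiset" "HOL-Library.Extended_Nat"
begin

section \<open>Projective dimension\<close>

text \<open>Modules are submodules (\<open>module.subspace\<close>) of an ambient module given by a type and a
  scalar multiplication, as in \<open>HOL.Modules\<close>.\<close>

definition mod_hom_on ::
  "('r::comm_ring_1 \<Rightarrow> 'a::ab_group_add \<Rightarrow> 'a) \<Rightarrow> ('r \<Rightarrow> 'b::ab_group_add \<Rightarrow> 'b) \<Rightarrow>
    'a set \<Rightarrow> 'b set \<Rightarrow> ('a \<Rightarrow> 'b) \<Rightarrow> bool" where
  "mod_hom_on s1 s2 M N f \<longleftrightarrow>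
    f ` M \<subseteq> N \<and>
    (\<forall>x\<in>M. \<forall>y\<in>M. f (x + y) = f x + f y) \<and>
    (\<forall>c. \<forall>x\<in>M. f (s1 c x) = s2 c (f x))"

definition free_mod :: "('r::comm_ring_1 \<Rightarrow> 'b::ab_group_add \<Rightarrow> 'b) \<Rightarrow> 'b set \<Rightarrow> bool" where
  "free_mod sM M \<longleftrightarrow> (\<exists>B. \<not> module.dependent sM B \<and> module.span sM B = M)"

text \<open>Scalar multiplication of the free module \<open>'i \<Rightarrow>\<^sub>0 'r\<close> with basis indexed by \<open>'i\<close>.\<close>

definition fscale :: "'r::comm_ring_1 \<Rightarrow> ('i \<Rightarrow>\<^sub>0 'r) \<Rightarrow> ('i \<Rightarrow>\<^sub>0 'r)" where
  "fscale c f = Poly_Mapping.map ((*) c) f"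

lemma lookup_fscale: "Poly_Mapping.lookup (fscale c f) i = c * Poly_Mapping.lookup f i"
  by (simp add: fscale_def Poly_Mapping.map.rep_eq when_def)

lemma module_fscale: "module fscale"
  by unfold_locales
    (auto intro!: poly_mapping_eqI simp: lookup_fscale lookup_add algebra_simps)

lemma module_vector_scalar_mult:
  "module ((*s) :: 'r::comm_ring_1 \<Rightarrow> 'r ^ 'n \<Rightarrow> 'r ^ 'n)"
  by unfold_locales (auto simp: vec_eq_iff algebra_simps)

text \<open>A module is projective if it is a direct summand (retract) of a free module. A module
  \<open>P\<close> that is a retract of some free module is a retract of the free module on the set \<open>P\<close>,
  so taking the free module on the ambient type of \<open>P\<close> loses nothing.\<close>

definition projective_mod ::
  "('r::comm_ring_1 \<Rightarrow> 'b::ab_group_add \<Rightarrow> 'b) \<Rightarrow> 'b set \<Rightarrow> bool" where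
  "projective_mod sM P \<longleftrightarrow>
    module.subspace sM P \<and>
    (\<exists>(i :: 'b \<Rightarrow> ('b \<Rightarrow>\<^sub>0 'r)) r.
      mod_hom_on sM fscale P UNIV i \<and>
      mod_hom_on fscale sM UNIV P r \<and>
      (\<forall>p\<in>P. r (i p) = p))"

text \<open>\<open>\<dots> \<rightarrow> P 1 \<rightarrow> P 0 \<rightarrow> M \<rightarrow> 0\<close> is exact, with maps \<open>d i : P (i + 1) \<rightarrow> P i\<close> and augmentation
  \<open>e : P 0 \<rightarrow> M\<close>, every \<open>P i\<close> is projective, and \<open>P i = 0\<close> for \<open>i > n\<close>.\<close>

definition projective_resolution ::
  "('r::comm_ring_1 \<Rightarrow> 'b::ab_group_add \<Rightarrow> 'b) \<Rightarrow> 'b set \<Rightarrow>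
    ('r \<Rightarrow> 'f::ab_group_add \<Rightarrow> 'f) \<Rightarrow> nat \<Rightarrow>
    (nat \<Rightarrow> 'f set) \<Rightarrow> (nat \<Rightarrow> 'f \<Rightarrow> 'f) \<Rightarrow> ('f \<Rightarrow> 'b) \<Rightarrow> bool" where
  "projective_resolution sM M sP n P d e \<longleftrightarrow>
    (\<forall>i. projective_mod sP (P i)) \<and>
    (\<forall>i>n. P i = {0}) \<and>
    mod_hom_on sP sM (P 0) M e \<and>
    (\<forall>i. mod_hom_on sP sP (P (Suc i)) (P i) (d i)) \<and>
    e ` P 0 = M \<and>
    {x \<in> P 0. e x = 0} = d 0 ` P 1 \<and>
    (\<forall>i. {x \<in> P (Suc i). d i x = 0} = d (Suc i) ` P (Suc (Suc i)))"

text \<open>The terms of the resolutions range over submodules of the free module with basis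
  \<open>nat \<times> 'b \<times> 'r\<close>. This is no restriction: \<open>M\<close> has a free resolution whose terms have rank at
  most the cardinality of that basis, and if \<open>M\<close> has projective dimension at most \<open>n\<close> then the
  \<open>n\<close>-th syzygy of that free resolution is projective (Schanuel), so truncating it gives a
  resolution of length \<open>n\<close> inside this free module. The infimum of the empty set is \<open>\<infinity>\<close>.\<close>

definition proj_dim ::
  "('r::comm_ring_1 \<Rightarrow> 'b::ab_group_add \<Rightarrow> 'b) \<Rightarrow> 'b set \<Rightarrow> enat" where
  "proj_dim sM M =
    Inf {enat n | n.
      \<exists>(P :: nat \<Rightarrow> ((nat \<times> 'b \<times> 'r) \<Rightarrow>\<^sub>0 'r) set) d e.
        projective_resolution sM M fscale n P d e}"


section \<open>Polynomials and derivations\<close>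

text \<open>The polynomial ring over \<open>'k\<close> in variables indexed by the finite type \<open>'n\<close>, so that the
  number of variables is \<open>CARD('n)\<close>: finitely supported coefficient functions on exponent
  vectors, with the convolution product of \<open>HOL-Library.Poly_Mapping\<close>.\<close>

type_synonym ('k, 'n) mpoly = "('n \<Rightarrow>\<^sub>0 nat) \<Rightarrow>\<^sub>0 'k"

text \<open>The graded piece \<open>S\<^sub>d\<close>; it contains 0.\<close>

definition homog :: "nat \<Rightarrow> ('k::comm_ring_1, 'n::finite) mpoly set" where
  "homog d = {f. \<forall>m\<in>Poly_Mapping.keys f. (\<Sum>i\<in>UNIV. Poly_Mapping.lookup m i) = d}"

definition mpoly_eval :: "('k::comm_ring_1, 'n::finite) mpoly \<Rightarrow> 'k ^ 'n \<Rightarrow> 'k" where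
  "mpoly_eval f v =
    (\<Sum>m\<in>Poly_Mapping.keys f.
      Poly_Mapping.lookup f m * (\<Prod>i\<in>UNIV. v $ i ^ Poly_Mapping.lookup m i))"

definition partial_deriv ::
  "'n::finite \<Rightarrow> ('k::comm_ring_1, 'n) mpoly \<Rightarrow> ('k, 'n) mpoly" where
  "partial_deriv i f =
    (\<Sum>m\<in>Poly_Mapping.keys f.
      Poly_Mapping.single (m - Poly_Mapping.single i 1)
        (of_nat (Poly_Mapping.lookup m i) * Poly_Mapping.lookup f m))"

text \<open>The derivation \<open>\<Sum>i. \<theta>\<^sub>i \<partial>\<^sub>i\<close> is represented by the vector of its coefficients; the
  module structure on derivations is \<open>(*s)\<close>.\<close>

type_synonym ('k, 'n) der = "(('k, 'n) mpoly) ^ 'n"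

definition der_apply ::
  "('k::comm_ring_1, 'n::finite) der \<Rightarrow> ('k, 'n) mpoly \<Rightarrow> ('k, 'n) mpoly" where
  "der_apply \<theta> f = (\<Sum>i\<in>UNIV. \<theta> $ i * partial_deriv i f)"

definition der_homog :: "nat \<Rightarrow> ('k::comm_ring_1, 'n::finite) der \<Rightarrow> bool" where
  "der_homog d \<theta> \<longleftrightarrow> (\<forall>i. \<theta> $ i \<in> homog d)"


section \<open>Arrangements\<close>

definition defines_hyperplane ::
  "('k::field, 'n::finite) mpoly \<Rightarrow> ('k ^ 'n) set \<Rightarrow> bool" where
  "defines_hyperplane \<alpha> H \<longleftrightarrow> \<alpha> \<in> homog 1 \<and> \<alpha> \<noteq> 0 \<and> H = {v. mpoly_eval \<alpha> v = 0}"

definition arrangement :: "('k::field ^ 'n::finite) set set \<Rightarrow> bool" where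
  "arrangement A \<longleftrightarrow> finite A \<and> (\<forall>H\<in>A. \<exists>\<alpha>. defines_hyperplane \<alpha> H)"

text \<open>The form defining a hyperplane is unique up to a nonzero scalar, so quantifying over all
  of them agrees with fixing one for each hyperplane.\<close>

definition log_der :: "('k::field ^ 'n::finite) set set \<Rightarrow> ('k, 'n) der set" where
  "log_der A = {\<theta>. \<forall>H\<in>A. \<forall>\<alpha>. defines_hyperplane \<alpha> H \<longrightarrow> \<alpha> dvd der_apply \<theta> \<alpha>}"

definition free_arrangement :: "('k::field ^ 'n::finite) set set \<Rightarrow> bool" where
  "free_arrangement A \<longleftrightarrow> arrangement A \<and> free_mod (*s) (log_der A)"

definition NT_free_2 :: "('k::field ^ 'n::finite) set set \<Rightarrow> bool" where
  "NT_free_2 B \<longleftrightarrow>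
    (\<exists>A H1 H2. free_arrangement A \<and> H1 \<in> A \<and> H2 \<in> A \<and> H1 \<noteq> H2 \<and> B = A - {H1, H2})"

text \<open>Minimality is with respect to inclusion. Finiteness is automatic for the finitely
  generated modules considered here.\<close>

definition min_homog_gens ::
  "('k::field, 'n::finite) der set \<Rightarrow> ('k, 'n) der set \<Rightarrow> bool" where
  "min_homog_gens M G \<longleftrightarrow>
    finite G \<and> (\<forall>\<theta>\<in>G. \<exists>d. der_homog d \<theta>) \<and> module.span (*s) G = M \<and>
    (\<forall>G'. G' \<subset> G \<longrightarrow> module.span (*s) G' \<noteq> M)"

text \<open>The degree is meaningful for nonzero homogeneous derivations; a minimal generating set
  never contains 0.\<close>

definition der_degree :: "('k::field, 'n::finite) der \<Rightarrow> nat" where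
  "der_degree \<theta> = (THE d. der_homog d \<theta>)"

text \<open>By graded Nakayama the multiset of degrees does not depend on the chosen minimal set of
  homogeneous generators.\<close>

definition deriv_degree_seq :: "('k::field ^ 'n::finite) set set \<Rightarrow> nat multiset" where
  "deriv_degree_seq B =
    image_mset der_degree (mset_set (SOME G. min_homog_gens (log_der B) G))"

end

theory Submission
  imports Defs
begin

text \<open>Let \<open>\<A>\<close> be free with \<open>\<B> = \<A> - {H1, H2}\<close>, let \<open>x\<close> and \<open>y\<close> be linear forms defining \<open>H1\<close> and \<open>H2\<close>, and
let \<open>I = (x, y)\<close>. A basis \<open>\<theta>\<close> of \<open>D(\<A>)\<close> identifies \<open>D(\<A>)\<close> with \<open>S\<^sup>n\<close>, where \<open>n\<close> is the number of
variables. Multiplication by \<open>x y\<close> embeds \<open>D(\<B>)\<close> into \<open>D(\<A>)\<close>, hence as a submodule \<open>N\<close> of \<open>S\<^sup>n\<close>.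

Deleting one hyperplane adds one generator: \<open>D(\<A> - {H1})\<close> is generated by \<open>D(\<A>)\<close> and one derivation
\<open>\<phi>\<close> (lemma \<open>single_deletion_generator\<close>). If \<open>x \<phi>\<close> has coordinate vector \<open>u\<close>, and \<open>v\<close> is obtained from
\<open>H2\<close> in the same way, then \<open>N\<close> is the intersection of \<open>x S\<^sup>n + S u\<close> and \<open>y S\<^sup>n + S v\<close>. Its shape is
decided by the relations \<open>f u = g v\<close> modulo \<open>I\<close> (lemma \<open>double_deletion_dichotomy\<close>).

  \<^item> If there are only the relations with \<open>f\<close> and \<open>g\<close> in \<open>I\<close>, or if one of the residues of \<open>u\<close> and
    \<open>v\<close> is a multiple of the other, then \<open>N\<close> is generated by \<open>x y S\<^sup>n\<close> and two more elements, and the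
    module of relations between these \<open>n + 2\<close> generators is free of rank two. So the projective
    dimension is at most one (lemma \<open>deletion_two_extra_generators\<close>).

  \<^item> Otherwise the relations modulo \<open>I\<close> are the multiples of a single pair \<open>(q, p)\<close> of polynomials without
    constant term. Then \<open>x y S\<^sup>n\<close> and the three elements \<open>y u\<close>, \<open>x v\<close> and \<open>w\<close> generate \<open>N\<close>, where
    \<open>w\<close> is congruent to \<open>q u\<close> modulo \<open>x\<close> and to \<open>p v\<close> modulo \<open>y\<close>. The minimal free resolution is
    \<open>0 \<rightarrow> S \<rightarrow> S\<^sup>4 \<rightarrow> S\<^sup>n\<^sup>+\<^sup>3 \<rightarrow> N \<rightarrow> 0\<close> with first map \<open>(x, -y, q, -p)\<close>. Its entries lie in the maximal ideal of the
    origin, so the first map does not split, and the projective dimension is two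
    (lemma \<open>deletion_three_extra_generators\<close>).

Hence \<open>D(\<B>)\<close> has projective dimension at most one and at most \<open>n + 2\<close> minimal generators in the
first case, and neither in the second, since by graded Nakayama (lemma \<open>generator_count\<close>) the
number of minimal homogeneous generators is the number of elements of every generating family
all of whose relations have coefficients without constant term, and at most that of any
generating family.

Both the existence of \<open>\<phi>\<close> and that of \<open>(q, p)\<close> could be derived from unique factorization in
\<open>S / (x)\<close> and \<open>S / I\<close>. The only elements that have to be factored divide products of linear forms, so it
suffices that ideals generated by linear forms are prime (lemma \<open>prime_ideal_lin\<close>): a
product with the fewest factors shares no factor with the element it is compared to, and can
be cancelled (lemma \<open>cancel_prime_product\<close>). For the pair \<open>(q, p)\<close> the linear forms come from the
derivation \<open>(Q / l) \<partial>\<close>, where \<open>Q\<close> is the product of the forms of \<open>\<B>\<close>, \<open>l\<close> is a form of \<open>\<B>\<close> in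
\<open>I\<close>, and \<open>\<partial>\<close> is a constant derivation with \<open>\<partial> l = 0\<close>
(lemma \<open>syzygy_dividing_linear_forms\<close>).\<close>

abbreviation (input) "lookup \<equiv> Poly_Mapping.lookup"
abbreviation (input) "single \<equiv> Poly_Mapping.single"
abbreviation (input) "keys \<equiv> Poly_Mapping.keys"

section \<open>Polynomials over a field and their constant and linear parts\<close>

lemma mpoly_induct [case_names single add]:
  fixes f :: "'a \<Rightarrow>\<^sub>0 'b::comm_monoid_add"
  assumes "\<And>m c. P (single m c)" "\<And>f g. P f \<Longrightarrow> P g \<Longrightarrow> P (f + g)"
  shows "P f"
proof -
  have *: "f = (\<Sum>m\<in>keys f. single m (lookup f m))"
    by (rule poly_mapping_eqI)
      (auto simp: lookup_sum lookup_single when_def if_distrib sum.delta in_keys_iff cong: if_cong)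
  have "finite K \<Longrightarrow> P (\<Sum>m\<in>K. single m (lookup f m))" for K
  proof (induction K rule: finite_induct)
    case empty
    show ?case using assms(1)[of undefined 0] by simp
  next
    case (insert x F)
    then show ?case using assms by simp
  qed
  then show ?thesis using * by (metis finite_keys)
qed

text \<open>The map that is \<open>\<kappa>\<close> on coefficients and \<open>\<mu>\<close> on monomials. Evaluation at a point, substitution of
polynomials and renaming of variables are the instances used below.\<close>

definition ext_hom :: "('k::comm_ring_1 \<Rightarrow> 'r::comm_ring_1) \<Rightarrow> ('m \<Rightarrow> 'r) \<Rightarrow> ('m::comm_monoid_add \<Rightarrow>\<^sub>0 'k) \<Rightarrow> 'r" where
  "ext_hom \<kappa> \<mu> f = (\<Sum>m\<in>keys f. \<kappa> (lookup f m) * \<mu> m)"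

lemma ext_hom_superset:
  assumes "finite K" "keys f \<subseteq> K" "\<kappa> 0 = 0"
  shows "ext_hom \<kappa> \<mu> f = (\<Sum>m\<in>K. \<kappa> (lookup f m) * \<mu> m)"
  unfolding ext_hom_def
  by (rule sum.mono_neutral_left) (use assms in \<open>auto simp: in_keys_iff\<close>)

lemma ext_hom_add:
  assumes "\<kappa> 0 = 0" "\<And>a b. \<kappa> (a + b) = \<kappa> a + \<kappa> b"
  shows "ext_hom \<kappa> \<mu> (f + g) = ext_hom \<kappa> \<mu> f + ext_hom \<kappa> \<mu> g"
proof -
  let ?K = "keys f \<union> keys g"
  have "keys (f + g) \<subseteq> ?K" by (rule keys_add)
  then show ?thesis
    by (subst (1 2 3) ext_hom_superset[where K = ?K])
      (auto simp: assms lookup_add algebra_simps sum.distrib)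
qed

lemma ext_hom_single:
  assumes "\<kappa> 0 = 0"
  shows "ext_hom \<kappa> \<mu> (single m c) = \<kappa> c * \<mu> m"
  by (cases "c = 0") (auto simp: ext_hom_def assms)

lemma ext_hom_mult:
  assumes "\<kappa> 0 = 0" "\<And>a b. \<kappa> (a + b) = \<kappa> a + \<kappa> b" "\<And>a b. \<kappa> (a * b) = \<kappa> a * \<kappa> b"
    "\<And>a b. \<mu> (a + b) = \<mu> a * \<mu> b"
  shows "ext_hom \<kappa> \<mu> (f * g) = ext_hom \<kappa> \<mu> f * ext_hom \<kappa> \<mu> g"
proof (induction f rule: mpoly_induct)
  case (single m c)
  show ?case
    by (induction g rule: mpoly_induct)
      (auto simp: mult_single ext_hom_single ext_hom_add assms algebra_simps)
qed (auto simp: ext_hom_add assms algebra_simps)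

text \<open>Without an order on the variables there is no leading monomial to argue with. Numbering the
variables embeds the ring in the polynomials with variables indexed by \<^typ>\<open>nat\<close>, which form an
integral domain.\<close>

lemma mpoly_no_zero_divisors:
  fixes f g :: "('k::field, 'n::finite) mpoly"
  assumes "f * g = 0"
  shows "f = 0 \<or> g = 0"
proof -
  obtain idx :: "'n \<Rightarrow> nat" where idx: "inj idx"
    using finite_imp_inj_to_nat_seg[of "UNIV :: 'n set"] by auto
  define \<rho> :: "('n \<Rightarrow>\<^sub>0 nat) \<Rightarrow> (nat \<Rightarrow>\<^sub>0 nat)"
    where "\<rho> m = (\<Sum>i\<in>UNIV. single (idx i) (lookup m i))" for m
  have lk: "lookup (\<rho> m) (idx i) = lookup m i" for m i
    using idx by (auto simp: \<rho>_def lookup_sum lookup_single when_def inj_eq if_distrib sum.delta cong: if_cong)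
  have \<rho>inj: "\<rho> m = \<rho> m' \<Longrightarrow> m = m'" for m m'
    by (rule poly_mapping_eqI) (metis lk)
  have \<rho>add: "\<rho> (a + b) = \<rho> a + \<rho> b" for a b
    by (simp add: \<rho>_def lookup_add single_add sum.distrib)
  define emb where "emb = ext_hom (single 0 :: 'k \<Rightarrow> _) (\<lambda>m. single (\<rho> m) (1::'k))"
  have emb_mult: "emb (f * g) = emb f * emb g" for f g
    unfolding emb_def
    by (rule ext_hom_mult) (auto simp: single_add mult_single \<rho>add)
  have emb_add: "emb (f + g) = emb f + emb g" for f g
    unfolding emb_def
    by (rule ext_hom_add) (auto simp: single_add)
  have "lookup (emb f) (\<rho> m) = lookup f m" for f m
    by (induction f rule: mpoly_induct)
      (auto simp: emb_add lookup_add, auto simp: emb_def ext_hom_single mult_single lookup_single when_def dest: \<rho>inj)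
  then have emb_inj: "emb f = 0 \<Longrightarrow> f = 0" for f
    by (metis lookup_zero poly_mapping_eqI)
  have "emb f * emb g = 0" using assms emb_mult[of f g] by (simp add: emb_def ext_hom_def)
  then show ?thesis using emb_inj by auto
qed

lemma mpoly_mult_cancel:
  fixes f g h :: "('k::field, 'n::finite) mpoly"
  assumes "h \<noteq> 0" "h * f = h * g"
  shows "f = g"
  using mpoly_no_zero_divisors[of h "f - g"] assms by (auto simp: algebra_simps)

definition const_poly :: "'k::comm_ring_1 \<Rightarrow> ('k, 'n::finite) mpoly" where
  "const_poly c = single 0 c"

definition var_exp :: "'n \<Rightarrow> ('n \<Rightarrow>\<^sub>0 nat)" where
  "var_exp i = single i 1"

definition lin :: "'k::comm_ring_1 ^ 'n::finite \<Rightarrow> ('k, 'n) mpoly" where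
  "lin a = (\<Sum>i\<in>UNIV. single (var_exp i) (a $ i))"

definition const_term :: "('k::comm_ring_1, 'n::finite) mpoly \<Rightarrow> 'k" where
  "const_term f = lookup f 0"

text \<open>The gradient at the origin. It is a derivation at the origin (\<open>linear_coeffs_mult\<close>), so it
vanishes on products of two polynomials without constant term.\<close>

definition linear_coeffs :: "('k::comm_ring_1, 'n::finite) mpoly \<Rightarrow> 'k ^ 'n" where
  "linear_coeffs f = (\<chi> i. lookup f (var_exp i))"

lemma lookup_var_exp: "lookup (var_exp i) j = (if i = j then 1 else 0)"
  by (simp add: var_exp_def lookup_single when_def)

lemma var_exp_eq_iff [simp]: "var_exp i = var_exp j \<longleftrightarrow> i = j"
  using lookup_var_exp[of i i] lookup_var_exp[of j i] by (metis zero_neq_one)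

lemma var_exp_neq_0 [simp]: "var_exp i \<noteq> 0" "0 \<noteq> var_exp i"
  using lookup_var_exp[of i i] by auto

lemma const_poly_simps [simp]: "const_poly 0 = 0" "const_poly 1 = 1"
  by (simp_all add: const_poly_def)

lemma const_poly_add: "const_poly (a + b) = const_poly a + const_poly b"
  and const_poly_mult: "const_poly (a * b) = const_poly a * const_poly b"
  and const_poly_minus: "const_poly (- a) = - const_poly a"
  by (simp_all add: const_poly_def single_add mult_single single_uminus)

lemma const_term_simps [simp]: "const_term 0 = 0" "const_term 1 = 1" "const_term (f + g) = const_term f + const_term g" "const_term (- f) = - const_term f"
   "const_term (f - g) = const_term f - const_term g" "const_term (const_poly c) = c"
  by (simp_all add: const_term_def const_poly_def lookup_add lookup_one lookup_minus)

lemma linear_coeffs_simps [simp]: "linear_coeffs 0 = 0" "linear_coeffs (f + g) = linear_coeffs f + linear_coeffs g" "linear_coeffs (- f) = - linear_coeffs f"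
   "linear_coeffs (f - g) = linear_coeffs f - linear_coeffs g" "linear_coeffs (const_poly c) = 0"
  by (simp_all add: linear_coeffs_def const_poly_def lookup_add lookup_minus vec_eq_iff lookup_single)

lemma const_term_sum: "const_term (sum f I) = (\<Sum>i\<in>I. const_term (f i))"
  by (simp add: const_term_def lookup_sum)

lemma exponent_sum_eq_0: "(a::'n \<Rightarrow>\<^sub>0 nat) + b = 0 \<longleftrightarrow> a = 0 \<and> b = 0"
  by (auto simp: poly_mapping_eq_iff lookup_add fun_eq_iff)

text \<open>A variable is not a product of two nonconstant monomials; this gives the Leibniz rule for
\<open>linear_coeffs\<close>.\<close>

lemma exponent_sum_eq_var_exp:
  "(a::'n \<Rightarrow>\<^sub>0 nat) + b = var_exp i \<longleftrightarrow> (a = 0 \<and> b = var_exp i) \<or> (b = 0 \<and> a = var_exp i)"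
proof
  assume h: "a + b = var_exp i"
  have s: "lookup a j + lookup b j = (if i = j then 1 else 0)" for j
    using arg_cong[OF h, of "\<lambda>f. lookup f j"] by (simp add: lookup_add lookup_var_exp)
  have j: "lookup a j = 0 \<and> lookup b j = 0" if "i \<noteq> j" for j
    using s[of j] that by simp
  have z: "lookup a i = 0 \<or> lookup b i = 0"
    using s[of i] by (simp, linarith)
  have "a = 0 \<or> b = 0"
  proof (cases "lookup a i = 0")
    case True
    then have "lookup a j' = 0" for j' using j[of j'] by (cases "i = j'") auto
    then show ?thesis by (simp add: poly_mapping_eq_iff fun_eq_iff)
  next
    case False
    then have "lookup b j' = 0" for j' using j[of j'] z by (cases "i = j'") auto
    then show ?thesis by (simp add: poly_mapping_eq_iff fun_eq_iff)
  qed
  then show "(a = 0 \<and> b = var_exp i) \<or> (b = 0 \<and> a = var_exp i)"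
    using h by auto
qed auto

lemma const_term_mult [simp]: "const_term (f * g) = const_term f * const_term g"
proof (induction f rule: mpoly_induct)
  case (single m c)
  show ?case
    by (induction g rule: mpoly_induct)
      (auto simp: mult_single const_term_def lookup_single when_def exponent_sum_eq_0 lookup_add algebra_simps)
qed (auto simp: algebra_simps)

lemma linear_coeffs_mult [simp]: "linear_coeffs (f * g) = const_term f *s linear_coeffs g + const_term g *s linear_coeffs f"
proof (induction f rule: mpoly_induct)
  case (single m c)
  show ?case
  proof (induction g rule: mpoly_induct)
    case (single m' c')
    show ?case
      by (auto simp: mult_single const_term_def linear_coeffs_def vec_eq_iff lookup_single when_def exponent_sum_eq_var_exp)
  qed (auto simp: algebra_simps vec_eq_iff)
qed (auto simp: algebra_simps vec_eq_iff)

lemma lookup_lin: "lookup (lin a) m = (\<Sum>i\<in>UNIV. if m = var_exp i then a $ i else 0)"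
  by (auto simp: lin_def lookup_sum lookup_single when_def intro!: sum.cong)

lemma linear_coeffs_lin [simp]: "linear_coeffs (lin a) = a"
  by (simp add: linear_coeffs_def vec_eq_iff lookup_lin)

lemma const_term_lin [simp]: "const_term (lin a) = 0"
  by (simp add: const_term_def lookup_lin)

lemma lin_add: "lin (a + b) = lin a + lin b"
  and lin_scale: "lin (c *s a) = const_poly c * lin a"
  by (simp_all add: lin_def single_add sum.distrib const_poly_def sum_distrib_left mult_single)

lemma lin_0 [simp]: "lin 0 = 0"
  by (simp add: lin_def)

lemma lin_eq_iff: "lin a = lin b \<longleftrightarrow> a = b"
  by (metis linear_coeffs_lin)

lemma lin_eq_0_iff [simp]: "lin a = 0 \<longleftrightarrow> a = 0"
  using lin_eq_iff[of a 0] by simp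

lemma exponent_degree_1:
  fixes m :: "'n::finite \<Rightarrow>\<^sub>0 nat"
  assumes "(\<Sum>i\<in>UNIV. lookup m i) = 1"
  obtains i where "m = var_exp i"
proof -
  obtain i where i: "lookup m i = 1" "\<And>j. i \<noteq> j \<Longrightarrow> lookup m j = 0"
    using assms sum_eq_1_iff[of UNIV "lookup m"] by (metis UNIV_I finite)
  have "m = var_exp i"
    by (rule poly_mapping_eqI) (auto simp: lookup_var_exp i)
  then show ?thesis by (rule that)
qed

lemma degree_var_exp [simp]: "(\<Sum>i\<in>UNIV. lookup (var_exp (j::'n::finite)) i) = 1"
  by (simp add: lookup_var_exp)

lemma homog_1_iff: "f \<in> homog 1 \<longleftrightarrow> (\<exists>a. f = lin a)"
proof
  assume f: "f \<in> homog 1"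
  have "f = lin (linear_coeffs f)"
  proof (rule poly_mapping_eqI)
    fix m
    show "lookup f m = lookup (lin (linear_coeffs f)) m"
    proof (cases "(\<Sum>i\<in>UNIV. lookup m i) = 1")
      case True
      then obtain i where "m = var_exp i" by (rule exponent_degree_1)
      then show ?thesis by (simp add: lookup_lin linear_coeffs_def)
    next
      case False
      then have "m \<notin> keys f" using f by (auto simp: homog_def)
      moreover have "m \<noteq> var_exp i" for i
        using False by auto
      ultimately show ?thesis by (simp add: lookup_lin in_keys_iff)
    qed
  qed
  then show "\<exists>a. f = lin a" ..
next
  assume "\<exists>a. f = lin a"
  then obtain a where a: "f = lin a" ..
  have "(\<Sum>i\<in>UNIV. lookup m i) = 1" if "m \<in> keys f" for m
  proof -
    have "lookup (lin a) m \<noteq> 0" using a that by (simp add: in_keys_iff)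
    then obtain i where "m = var_exp i"
      by (force simp: lookup_lin intro: sum.neutral)
    then show ?thesis by simp
  qed
  then show "f \<in> homog 1" by (simp add: homog_def)
qed

abbreviation dot :: "'k::comm_ring_1 ^ 'n::finite \<Rightarrow> 'k ^ 'n \<Rightarrow> 'k" where
  "dot a v \<equiv> (\<Sum>i\<in>UNIV. a $ i * v $ i)"

lemma mpoly_eval_ext_hom:
  "mpoly_eval f v = ext_hom (\<lambda>c. c) (\<lambda>m. \<Prod>i\<in>UNIV. v $ i ^ lookup m i) f"
  by (simp add: mpoly_eval_def ext_hom_def)

lemma mpoly_eval_lin: "mpoly_eval (lin a) v = dot a v"
proof -
  have s: "mpoly_eval (sum F I) v = (\<Sum>i\<in>I. mpoly_eval (F i) v)" if "finite I" for F and I :: "'b set"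
    using that
  proof (induction I rule: finite_induct)
    case empty
    then show ?case by (simp add: mpoly_eval_def)
  next
    case (insert x I)
    then show ?case by (simp add: mpoly_eval_ext_hom ext_hom_add)
  qed
  have "mpoly_eval (single (var_exp i) c) v = c * v $ i" for i c
  proof -
    have "(\<Prod>j\<in>UNIV. v $ j ^ lookup (var_exp i) j) = (\<Prod>j\<in>UNIV. if j = i then v $ j else 1)"
      by (rule prod.cong) (auto simp: lookup_var_exp)
    then show ?thesis by (simp add: mpoly_eval_ext_hom ext_hom_single)
  qed
  then show ?thesis by (simp add: lin_def s)
qed

lemma partial_deriv_lin: "partial_deriv i (lin a) = const_poly (a $ i)"
proof -
  have K: "keys (lin a) \<subseteq> range var_exp"
  proof
    fix m assume "m \<in> keys (lin a)"
    moreover have "lin a \<in> homog 1" using homog_1_iff by blast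
    ultimately show "m \<in> range var_exp"
      unfolding homog_def by (metis (mono_tags, lifting) exponent_degree_1 mem_Collect_eq rangeI)
  qed
  have inj: "inj var_exp" by (auto simp: inj_def)
  have "partial_deriv i (lin a) = (\<Sum>m\<in>range var_exp. single (m - var_exp i)
        (of_nat (lookup m i) * lookup (lin a) m))"
    unfolding partial_deriv_def var_exp_def[symmetric]
    by (rule sum.mono_neutral_left) (use K in \<open>auto simp: in_keys_iff\<close>)
  also have "\<dots> = (\<Sum>j\<in>UNIV. single (var_exp j - var_exp i)
        (of_nat (lookup (var_exp j) i) * lookup (lin a) (var_exp j)))"
    by (subst sum.reindex[OF inj]) simp
  also have "\<dots> = (\<Sum>j\<in>UNIV. if j = i then const_poly (a $ i) else 0)"
    by (rule sum.cong) (auto simp: lookup_var_exp lookup_lin const_poly_def)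
  finally show ?thesis by simp
qed

lemma der_apply_lin: "der_apply \<theta> (lin a) = (\<Sum>i\<in>UNIV. \<theta> $ i * const_poly (a $ i))"
  by (simp add: der_apply_def partial_deriv_lin)

section \<open>Prime ideals generated by linear forms\<close>

interpretation rmod: module "(*) :: 'r::comm_ring_1 \<Rightarrow> 'r \<Rightarrow> 'r"
  by unfold_locales (auto simp: algebra_simps)

text \<open>As a rewrite rule for multiplication it would undo the normal form of \<open>mult.assoc\<close>.\<close>

declare rmod.scale_scale [simp del]

interpretation vmod: module "(*s) :: 'r::comm_ring_1 \<Rightarrow> 'r ^ 'n \<Rightarrow> 'r ^ 'n"
  by (rule module_vector_scalar_mult)

abbreviation ideal :: "'r::comm_ring_1 set \<Rightarrow> 'r set" where
  "ideal \<equiv> rmod.span"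

definition prime_ideal :: "'r::comm_ring_1 set \<Rightarrow> bool" where
  "prime_ideal P \<longleftrightarrow> rmod.subspace P \<and> 1 \<notin> P \<and> (\<forall>f g. f * g \<in> P \<longrightarrow> f \<in> P \<or> g \<in> P)"

lemma in_ideal_1: "f \<in> ideal {x} \<longleftrightarrow> x dvd f"
  by (auto simp: rmod.span_singleton dvd_def mult.commute)

lemma in_ideal_2: "f \<in> ideal {x, y} \<longleftrightarrow> (\<exists>a b. f = x * a + y * b)"
proof
  assume "f \<in> ideal {x, y}"
  then obtain k where "y dvd f - k * x"
    by (auto simp: rmod.span_breakdown_eq[of f x] in_ideal_1)
  then obtain b where "f - k * x = y * b" by (auto simp: dvd_def)
  then have "f = x * k + y * b" by (simp add: algebra_simps)
  then show "\<exists>a b. f = x * a + y * b" by blast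
next
  assume "\<exists>a b. f = x * a + y * b"
  then obtain a b where "f = a * x + b * y" by (metis mult.commute)
  then show "f \<in> ideal {x, y}"
    by (simp add: rmod.span_add rmod.span_scale rmod.span_base)
qed

lemma ideal_mult_right: "f \<in> ideal T \<Longrightarrow> f * g \<in> ideal T"
  using rmod.span_scale[of f T g] by (simp add: mult.commute)

lemma dvd_mult_diff:
  fixes l :: "'r::comm_ring_1"
  assumes "l dvd a - b" "l dvd c - d"
  shows "l dvd a * c - b * d"
proof -
  have "a * c - b * d = (a - b) * c + b * (c - d)" by (simp add: algebra_simps)
  then show ?thesis using assms by (metis dvd_add dvd_mult dvd_mult2)
qed

lemma dvd_prod_power_diff:
  fixes l :: "'r::comm_ring_1"
  assumes "\<And>i. l dvd h i - x i"
  shows "l dvd (\<Prod>i\<in>I. h i ^ m i) - (\<Prod>i\<in>I. x i ^ m i)"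
proof -
  have p: "l dvd h i ^ k - x i ^ k" for i k
    by (induction k) (auto intro: dvd_mult_diff assms)
  show ?thesis
    by (induction I rule: infinite_finite_induct) (auto intro: dvd_mult_diff p)
qed

lemma prod_var_powers:
  fixes m :: "'n::finite \<Rightarrow>\<^sub>0 nat"
  shows "(\<Prod>i\<in>UNIV. single (var_exp i) (1::'k::comm_ring_1) ^ lookup m i)
    = single m 1"
proof -
  have pw: "single (var_exp i) (1::'k) ^ k = single (single i k) 1" for i :: 'n and k
    by (induction k) (auto simp: mult_single var_exp_def single_add[symmetric] simp del: single_one simp flip: single_one)
  have pr: "(\<Prod>i\<in>I. single (e i) (1::'k)) = single (\<Sum>i\<in>I. e i) 1"
    if "finite I" for e :: "'n \<Rightarrow> ('n \<Rightarrow>\<^sub>0 nat)" and I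
    using that by (induction I rule: finite_induct) (auto simp: mult_single)
  have "(\<Sum>i\<in>UNIV. single i (lookup m i)) = m"
    by (rule poly_mapping_eqI) (simp add: lookup_sum lookup_single when_def)
  then show ?thesis by (simp add: pw pr)
qed

text \<open>Solve the equation \<open>b = 0\<close> for a variable that occurs in \<open>b\<close> and substitute: the resulting
endomorphism kills \<open>b\<close> and changes nothing modulo \<open>b\<close>.\<close>

lemma lin_elimination:
  fixes b :: "'k::field ^ 'n::finite"
  assumes "b \<noteq> 0"
  obtains \<tau> :: "('k, 'n) mpoly \<Rightarrow> ('k, 'n) mpoly" and s
  where "\<And>f g. \<tau> (f + g) = \<tau> f + \<tau> g" "\<And>f g. \<tau> (f * g) = \<tau> f * \<tau> g" "\<tau> 1 = 1"
    "\<And>a. \<tau> (lin a) = lin (s a)" "s b = 0" "\<And>f. lin b dvd \<tau> f - f"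
proof -
  obtain j where j: "b $ j \<noteq> 0" using assms by (auto simp: vec_eq_iff)
  define h :: "'n \<Rightarrow> ('k, 'n) mpoly" where
    "h i = lin (axis i 1 - (if i = j then (1 / b $ j) *s b else 0))" for i
  define \<tau> where "\<tau> = ext_hom const_poly (\<lambda>m. \<Prod>i\<in>UNIV. h i ^ lookup m i)"
  define s where "s a = a - (a $ j / b $ j) *s b" for a :: "'k ^ 'n"
  have add: "\<tau> (f + g) = \<tau> f + \<tau> g" for f g
    unfolding \<tau>_def by (rule ext_hom_add) (auto simp: const_poly_add)
  have mult: "\<tau> (f * g) = \<tau> f * \<tau> g" for f g
    unfolding \<tau>_def
    by (rule ext_hom_mult) (auto simp: const_poly_add const_poly_mult lookup_add power_add prod.distrib)
  have tau_single: "\<tau> (single m c) = const_poly c * (\<Prod>i\<in>UNIV. h i ^ lookup m i)" for m c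
    unfolding \<tau>_def by (rule ext_hom_single) simp
  have one: "\<tau> 1 = 1" using tau_single[of 0 1] by simp
  have zero: "\<tau> 0 = 0" by (simp add: \<tau>_def ext_hom_def)
  have sum: "\<tau> (sum F I) = (\<Sum>i\<in>I. \<tau> (F i))" for F and I :: "'n set"
    by (induction I rule: infinite_finite_induct) (auto simp: zero add)
  have linsum: "lin (sum F I) = (\<Sum>i\<in>I. lin (F i))" for F :: "'n \<Rightarrow> 'k ^ 'n" and I
    by (induction I rule: infinite_finite_induct) (auto simp: lin_add)
  have "(\<Prod>i\<in>UNIV. h i ^ lookup (var_exp j) i) = h j" for j
  proof -
    have "(\<Prod>i\<in>UNIV. h i ^ lookup (var_exp j) i) = (\<Prod>i\<in>UNIV. if i = j then h i else 1)"
      by (rule prod.cong) (auto simp: lookup_var_exp)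
    then show ?thesis by simp
  qed
  then have "\<tau> (lin a) = (\<Sum>i\<in>UNIV. lin (a $ i *s (axis i 1 - (if i = j then (1 / b $ j) *s b else 0))))" for a
    unfolding lin_def[of a] by (simp add: sum tau_single lin_scale h_def)
  moreover have "(\<Sum>i\<in>UNIV. a $ i *s (axis i 1 - (if i = j then (1 / b $ j) *s b else 0))) = s a" for a
  proof -
    have "(\<Sum>i\<in>UNIV. a $ i *s (axis i 1 - (if i = j then (1 / b $ j) *s b else 0))) $ c
      = (\<Sum>i\<in>UNIV. (if i = c then a $ i else 0) - (if i = j then a $ i * (1 / b $ j) * b $ c else 0))" for c
      unfolding sum_component by (rule sum.cong) (auto simp: axis_def algebra_simps)
    then show ?thesis by (simp add: vec_eq_iff s_def sum_subtractf)
  qed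
  ultimately have lin: "\<tau> (lin a) = lin (s a)" for a by (simp flip: linsum)
  have sb: "s b = 0" using j by (simp add: s_def)
  have "lin b dvd h i - single (var_exp i) 1" for i
  proof -
    have "lin (axis i (1::'k)) = (\<Sum>c\<in>UNIV. if c = i then single (var_exp i) 1 else 0)"
      unfolding lin_def by (rule sum.cong) (auto simp: axis_def)
    then have "h i - single (var_exp i) 1 = lin (axis i 1 - (if i = j then (1 / b $ j) *s b else 0)) + lin ((-1) *s axis i 1)"
      by (simp only: h_def lin_scale const_poly_minus const_poly_simps) simp
    also have "\<dots> = lin ((if i = j then - (1 / b $ j) else 0) *s b)"
      by (simp only: flip: lin_add) (auto simp: vec_eq_iff intro!: arg_cong[of _ _ lin])
    finally show ?thesis by (simp only: lin_scale dvd_triv_right)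
  qed
  then have d: "lin b dvd (\<Prod>i\<in>UNIV. h i ^ lookup m i) - single m 1" for m
    using dvd_prod_power_diff[of "lin b" h "\<lambda>i. single (var_exp i) 1" "lookup m" UNIV]
    by (simp add: prod_var_powers)
  have "lin b dvd \<tau> f - f" for f
  proof (induction f rule: mpoly_induct)
    case (single m c)
    have "\<tau> (single m c) - single m c
      = const_poly c * ((\<Prod>i\<in>UNIV. h i ^ lookup m i) - single m 1)"
      by (simp only: tau_single right_diff_distrib) (simp add: const_poly_def mult_single)
    then show ?case using d by simp
  next
    case (add f g)
    then show ?case using dvd_add[OF add] by (simp add: \<open>\<And>g f. \<tau> (f + g) = \<tau> f + \<tau> g\<close> algebra_simps)
  qed
  then show ?thesis using that[of \<tau> s] add mult one lin sb by blast
qed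

text \<open>Eliminating the forms one after the other gives an endomorphism of the polynomial ring whose
kernel is the ideal, and the ring is a domain. The eliminations preserve linear forms, so
the image of the next form can be eliminated again.\<close>

lemma prime_ideal_lin:
  fixes T :: "('k::field ^ 'n::finite) set"
  assumes "finite T"
  shows "prime_ideal (ideal (lin ` T))"
proof -
  have "\<exists>(\<sigma> :: ('k, 'n) mpoly \<Rightarrow> ('k, 'n) mpoly) s. (\<forall>f g. \<sigma> (f + g) = \<sigma> f + \<sigma> g) \<and> (\<forall>f g. \<sigma> (f * g) = \<sigma> f * \<sigma> g) \<and>
    \<sigma> 1 = 1 \<and> (\<forall>a. \<sigma> (lin a) = lin (s a)) \<and> (\<forall>t\<in>T. s t = 0) \<and> (\<forall>f. \<sigma> f - f \<in> ideal (lin ` T))"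
    using assms
  proof (induction T rule: finite_induct)
    case empty
    show ?case by (rule exI[of _ "\<lambda>f. f"], rule exI[of _ "\<lambda>a. a"]) simp
  next
    case (insert t T)
    then obtain \<sigma> :: "('k, 'n) mpoly \<Rightarrow> ('k, 'n) mpoly" and s where
      \<sigma>: "\<And>f g. \<sigma> (f + g) = \<sigma> f + \<sigma> g" "\<And>f g. \<sigma> (f * g) = \<sigma> f * \<sigma> g" "\<sigma> 1 = 1"
      "\<And>a. \<sigma> (lin a) = lin (s a)" "\<And>t. t \<in> T \<Longrightarrow> s t = 0" "\<And>f. \<sigma> f - f \<in> ideal (lin ` T)"
      by blast
    let ?I = "ideal (lin ` insert t T)"
    have sub: "ideal (lin ` T) \<subseteq> ?I" by (rule rmod.span_mono) auto
    show ?case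
    proof (cases "s t = 0")
      case True
      then show ?thesis using \<sigma> sub by (intro exI[of _ \<sigma>] exI[of _ s]) auto
    next
      case False
      then obtain \<tau> :: "('k, 'n) mpoly \<Rightarrow> ('k, 'n) mpoly" and r where
        \<tau>: "\<And>f g. \<tau> (f + g) = \<tau> f + \<tau> g" "\<And>f g. \<tau> (f * g) = \<tau> f * \<tau> g" "\<tau> 1 = 1"
        "\<And>a. \<tau> (lin a) = lin (r a)" "r (s t) = 0" "\<And>f. lin (s t) dvd \<tau> f - f"
        by (rule lin_elimination) blast
      have "r 0 = 0" using \<tau>(4)[of 0] \<tau>(1)[of 0 0] by simp
      have "lin (s t) = (\<sigma> (lin t) - lin t) + lin t" by (simp add: \<sigma>(4))
      moreover have "\<sigma> (lin t) - lin t \<in> ?I" using \<sigma>(6) sub by blast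
      moreover have "lin t \<in> ?I" by (auto intro: rmod.span_base)
      ultimately have st: "lin (s t) \<in> ?I" using rmod.span_add by metis
      have "\<tau> (\<sigma> f) - f \<in> ?I" for f
      proof -
        have "\<tau> (\<sigma> f) - \<sigma> f \<in> ?I" using \<tau>(6)[of "\<sigma> f"] st by (auto simp: dvd_def intro: ideal_mult_right)
        moreover have "\<sigma> f - f \<in> ?I" using \<sigma>(6) sub by blast
        ultimately show ?thesis using rmod.span_add by fastforce
      qed
      then show ?thesis
        using \<sigma> \<tau> \<open>r 0 = 0\<close> by (intro exI[of _ "\<lambda>f. \<tau> (\<sigma> f)"] exI[of _ "\<lambda>a. r (s a)"]) auto
    qed
  qed
  then obtain \<sigma> :: "('k, 'n) mpoly \<Rightarrow> ('k, 'n) mpoly" and s where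
      \<sigma>: "\<And>f g. \<sigma> (f + g) = \<sigma> f + \<sigma> g" "\<And>f g. \<sigma> (f * g) = \<sigma> f * \<sigma> g" "\<sigma> 1 = 1"
      "\<And>a. \<sigma> (lin a) = lin (s a)" "\<And>t. t \<in> T \<Longrightarrow> s t = 0" "\<And>f. \<sigma> f - f \<in> ideal (lin ` T)"
    by blast
  have "\<sigma> 0 = 0" using \<sigma>(1)[of 0 0] by simp
  have "rmod.subspace {f. \<sigma> f = 0}"
    by (rule rmod.subspaceI) (auto simp: \<sigma>(1,2) \<open>\<sigma> 0 = 0\<close>)
  then have "ideal (lin ` T) \<subseteq> {f. \<sigma> f = 0}"
    by (intro rmod.span_minimal) (auto simp: \<sigma>(4,5))
  moreover have "f \<in> ideal (lin ` T)" if "\<sigma> f = 0" for f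
    using \<sigma>(6)[of f] that rmod.span_neg by fastforce
  ultimately have ker: "f \<in> ideal (lin ` T) \<longleftrightarrow> \<sigma> f = 0" for f by auto
  show ?thesis
    unfolding prime_ideal_def
    by (auto simp: ker \<sigma>(2,3) dest: mpoly_no_zero_divisors)
qed

lemma prime_idealD:
  assumes "prime_ideal P"
  shows "f * g \<in> P \<Longrightarrow> f \<in> P \<or> g \<in> P" "1 \<notin> P" "0 \<in> P" "f \<in> P \<Longrightarrow> g \<in> P \<Longrightarrow> f + g \<in> P"
    "f \<in> P \<Longrightarrow> g \<in> P \<Longrightarrow> f - g \<in> P" "f \<in> P \<Longrightarrow> - f \<in> P" "f \<in> P \<Longrightarrow> g * f \<in> P" "f \<in> P \<Longrightarrow> f * g \<in> P"
  using assms rmod.subspace_0 rmod.subspace_add rmod.subspace_diff rmod.subspace_neg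
    rmod.subspace_scale[of P f g]
  by (auto simp: prime_ideal_def mult.commute)

lemma in_ideal_insert: "f \<in> ideal (insert a T) \<longleftrightarrow> (\<exists>k. f - a * k \<in> ideal T)"
  by (simp add: rmod.span_breakdown_eq mult.commute)

text \<open>The factors are stripped off one at a time: a prime \<open>l\<close> that does not divide \<open>w i\<close> modulo \<open>T\<close> has to
divide \<open>f\<close>. The family \<open>w\<close> is the coordinate vector of a module element in one application;
there, different primes avoid different coordinates.\<close>

lemma cancel_prime_product:
  fixes f :: "'r::comm_ring_1"
  assumes P: "prime_ideal (ideal T)"
    and L: "\<And>l. l \<in> set L \<Longrightarrow> prime_ideal (ideal (insert l T))" "\<And>l. l \<in> set L \<Longrightarrow> l \<notin> ideal T"
    and w: "\<And>l. l \<in> set L \<Longrightarrow> \<exists>i. w i \<notin> ideal (insert l T)"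
    and fw: "\<And>i. f * w i \<in> ideal (insert (prod_list L) T)"
  shows "f \<in> ideal (insert (prod_list L) T)"
  using L w fw
proof (induction L arbitrary: f)
  case Nil
  have "f - 1 * f \<in> ideal T" using rmod.span_zero by simp
  then show ?case unfolding in_ideal_insert by (metis prod_list.Nil)
next
  case (Cons l L)
  obtain i where i: "w i \<notin> ideal (insert l T)" using Cons.prems(3)[of l] by auto
  have sub: "g \<in> ideal (insert l T)" if g: "g \<in> ideal (insert (prod_list (l # L)) T)" for g
  proof -
    obtain k where "g - l * prod_list L * k \<in> ideal T"
      using g unfolding in_ideal_insert prod_list.Cons by blast
    then have "g - l * (prod_list L * k) \<in> ideal T" by (simp only: mult.assoc)
    then show ?thesis unfolding in_ideal_insert by blast
  qed
  have "f * w i \<in> ideal (insert l T)" by (rule sub[OF Cons.prems(4)])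
  then have "f \<in> ideal (insert l T)"
    using prime_idealD(1)[OF Cons.prems(1)] i by auto
  then obtain f' where f': "f - l * f' \<in> ideal T" unfolding in_ideal_insert by blast
  have "f' * w j \<in> ideal (insert (prod_list L) T)" for j
  proof -
    obtain k where "f * w j - l * prod_list L * k \<in> ideal T"
      using Cons.prems(4)[of j] unfolding in_ideal_insert by auto
    then have "(f * w j - l * prod_list L * k) - (f - l * f') * w j \<in> ideal T"
      by (rule rmod.span_diff[OF _ ideal_mult_right[OF f']])
    also have "(f * w j - l * prod_list L * k) - (f - l * f') * w j = l * (f' * w j - prod_list L * k)"
      by (simp add: algebra_simps)
    finally have "l * (f' * w j - prod_list L * k) \<in> ideal T" .
    then have "f' * w j - prod_list L * k \<in> ideal T"
      using prime_idealD(1)[OF P] Cons.prems(2)[of l] by auto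
    then show ?thesis unfolding in_ideal_insert by blast
  qed
  then have "f' \<in> ideal (insert (prod_list L) T)"
    using Cons.IH Cons.prems by (meson list.set_intros(2))
  then obtain k where k: "f' - prod_list L * k \<in> ideal T" unfolding in_ideal_insert by blast
  have "f - prod_list (l # L) * k = (f - l * f') + l * (f' - prod_list L * k)" by (simp add: algebra_simps)
  also have "\<dots> \<in> ideal T"
    using f' k by (intro rmod.span_add rmod.span_scale)
  finally show ?case unfolding in_ideal_insert by blast
qed

text \<open>Each prime factor divides \<open>p\<close> or can be cancelled from the cofactor \<open>r\<close>; when all of them have been
cancelled, \<open>r\<close> has become an inverse of \<open>p\<close>.\<close>

lemma divisor_of_prime_product:
  fixes p r :: "'r::comm_ring_1"
  assumes P: "prime_ideal (ideal T)"
    and L: "\<And>l. l \<in> set L \<Longrightarrow> prime_ideal (ideal (insert l T))" "\<And>l. l \<in> set L \<Longrightarrow> l \<notin> ideal T"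
    and pr: "p * r - prod_list L \<in> ideal T"
  shows "(\<exists>e. p * e - 1 \<in> ideal T) \<or> (\<exists>l\<in>set L. p \<in> ideal (insert l T))"
  using L pr
proof (induction L arbitrary: r)
  case Nil
  then show ?case by auto
next
  case (Cons l L)
  have "p * r - l * prod_list L \<in> ideal T" using Cons.prems(3) by simp
  then have "p * r \<in> ideal (insert l T)" unfolding in_ideal_insert by blast
  then consider "p \<in> ideal (insert l T)" | "r \<in> ideal (insert l T)"
    using prime_idealD(1)[OF Cons.prems(1)[of l]] by auto
  then show ?case
  proof cases
    case 1
    then show ?thesis by auto
  next
    case 2
    then obtain r' where r': "r - l * r' \<in> ideal T" unfolding in_ideal_insert by blast
    have "(p * r - prod_list (l # L)) - p * (r - l * r') \<in> ideal T"
      by (rule rmod.span_diff[OF Cons.prems(3) rmod.span_scale[OF r']])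
    also have "(p * r - prod_list (l # L)) - p * (r - l * r') = l * (p * r' - prod_list L)"
      by (simp add: algebra_simps)
    finally have "l * (p * r' - prod_list L) \<in> ideal T" .
    then have "p * r' - prod_list L \<in> ideal T"
      using prime_idealD(1)[OF P] Cons.prems(2)[of l] by auto
    then show ?thesis using Cons.IH[of r'] Cons.prems by auto
  qed
qed

lemma prod_list_notin_prime:
  assumes "prime_ideal P" "\<And>l. l \<in> set L \<Longrightarrow> l \<notin> P"
  shows "prod_list L \<notin> P"
  using assms(2)
proof (induction L)
  case Nil
  then show ?case using prime_idealD(2)[OF assms(1)] by simp
next
  case (Cons a L)
  then show ?case using prime_idealD(1)[OF assms(1), of a "prod_list L"] by auto
qed

section \<open>Projective dimension at most one\<close>

lemma mod_hom_onD:
  assumes "mod_hom_on s1 s2 M N f"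
  shows "x \<in> M \<Longrightarrow> f x \<in> N" "x \<in> M \<Longrightarrow> y \<in> M \<Longrightarrow> f (x + y) = f x + f y"
    "x \<in> M \<Longrightarrow> f (s1 c x) = s2 c (f x)"
  using assms by (auto simp: mod_hom_on_def)

lemma mod_hom_on_0:
  assumes "module s1" "module s2" "module.subspace s1 M" "mod_hom_on s1 s2 M N f"
  shows "f 0 = 0"
  using mod_hom_onD(3)[OF assms(4), of 0 0] module.subspace_0[OF assms(1,3)]
    module.scale_zero_left[OF assms(1)] module.scale_zero_left[OF assms(2)] by metis

lemma mod_hom_on_diff:
  assumes "module s1" "module s2" "module.subspace s1 M" "mod_hom_on s1 s2 M N f" "x \<in> M" "y \<in> M"
  shows "f (x - y) = f x - f y"
proof -
  have "f ((x - y) + y) = f (x - y) + f y"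
    using mod_hom_onD(2)[OF assms(4)] module.subspace_diff[OF assms(1,3)] assms(5,6) by blast
  then show ?thesis by simp
qed

lemma mod_hom_on_compose:
  assumes "mod_hom_on s1 s2 M N f" "mod_hom_on s2 s3 N L g"
  shows "mod_hom_on s1 s3 M L (\<lambda>x. g (f x))"
  using assms unfolding mod_hom_on_def by (auto simp: image_subset_iff)

lemma mod_hom_on_sum:
  assumes "module s1" "module s2" "module.subspace s1 M" "mod_hom_on s1 s2 M N f" "\<And>i. i \<in> I \<Longrightarrow> x i \<in> M"
  shows "f (\<Sum>i\<in>I. s1 (c i) (x i)) = (\<Sum>i\<in>I. s2 (c i) (f (x i)))"
  using assms(5)
proof (induction I rule: infinite_finite_induct)
  case (insert i I)
  have "(\<Sum>i\<in>I. s1 (c i) (x i)) \<in> M"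
    using insert.prems by (intro module.subspace_sum[OF assms(1,3)] module.subspace_scale[OF assms(1,3)]) auto
  then show ?case using insert mod_hom_onD[OF assms(4)] module.subspace_scale[OF assms(1,3)] by simp
qed (simp_all add: mod_hom_on_0[OF assms(1-4)])

text \<open>A projective module is a retract of a free one, on whose basis preimages can be chosen freely.\<close>

lemma projective_lift:
  fixes sP :: "'r::comm_ring_1 \<Rightarrow> 'p::ab_group_add \<Rightarrow> 'p"
    and s1 :: "'r \<Rightarrow> 'a::ab_group_add \<Rightarrow> 'a" and s2 :: "'r \<Rightarrow> 'b::ab_group_add \<Rightarrow> 'b"
  assumes s1: "module s1" and s2: "module s2"
    and P: "projective_mod sP P"
    and A: "module.subspace s1 A" and \<pi>: "mod_hom_on s1 s2 A B \<pi>"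
    and f: "mod_hom_on sP s2 P B f" and im: "\<And>p. p \<in> P \<Longrightarrow> f p \<in> \<pi> ` A"
  obtains g where "mod_hom_on sP s1 P A g" "\<And>p. p \<in> P \<Longrightarrow> \<pi> (g p) = f p"
proof -
  obtain i :: "'p \<Rightarrow> ('p \<Rightarrow>\<^sub>0 'r)" and r where i: "mod_hom_on sP fscale P UNIV i"
    and r: "mod_hom_on fscale sP UNIV P r" and ri: "\<And>p. p \<in> P \<Longrightarrow> r (i p) = p"
    using P unfolding projective_mod_def by blast
  interpret m1: module s1 by fact
  interpret m2: module s2 by fact
  define ch where "ch b = (SOME a. a \<in> A \<and> \<pi> a = f (r (single b 1)))" for b
  have ch: "ch b \<in> A \<and> \<pi> (ch b) = f (r (single b 1))" for b
  proof -
    have "r (single b 1) \<in> P" using mod_hom_onD(1)[OF r] by simp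
    then have "\<exists>a. a \<in> A \<and> \<pi> a = f (r (single b 1))" using im by (metis image_iff)
    then show ?thesis unfolding ch_def by (rule someI_ex)
  qed
  define L where "L F = (\<Sum>b\<in>keys F. s1 (lookup F b) (ch b))" for F
  have L: "L F = (\<Sum>b\<in>K. s1 (lookup F b) (ch b))"
    if "finite K" "keys F \<subseteq> K" for F K
    unfolding L_def by (rule sum.mono_neutral_left) (use that in \<open>auto simp: in_keys_iff\<close>)
  have LA: "L F \<in> A" for F
    unfolding L_def using ch by (intro m1.subspace_sum[OF A] m1.subspace_scale[OF A]) auto
  have Ladd: "L (F + G) = L F + L G" for F G
    using keys_add[of F G]
    by (subst (1 2 3) L[where K = "keys F \<union> keys G"])
      (auto simp: lookup_add m1.scale_left_distrib sum.distrib)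
  have Lscale: "L (fscale c F) = s1 c (L F)" for c F
    by (subst (1 2) L[where K = "keys F"])
      (auto simp: in_keys_iff lookup_fscale m1.scale_sum_right)
  have fr: "mod_hom_on fscale s2 UNIV B (\<lambda>F. f (r F))"
    by (rule mod_hom_on_compose[OF r f])
  have \<pi>L: "\<pi> (L F) = f (r F)" for F
  proof (induction F rule: mpoly_induct)
    case (single b c)
    have "L (single b c) = s1 c (ch b)"
      by (subst L[where K = "{b}"]) auto
    moreover have "single b c = fscale c (single b 1)"
      by (rule poly_mapping_eqI) (auto simp: lookup_fscale lookup_single when_def)
    ultimately show ?case
      using ch mod_hom_onD(3)[OF \<pi>] mod_hom_onD(3)[OF fr] by simp
  next
    case (add F G)
    then show ?case
      by (simp add: Ladd mod_hom_onD(2)[OF \<pi> LA LA] mod_hom_onD(2)[OF fr])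
  qed
  have "mod_hom_on fscale s1 UNIV A L"
    using LA Ladd Lscale by (auto simp: mod_hom_on_def)
  then show ?thesis
    using that[OF mod_hom_on_compose[OF i]] \<pi>L ri by simp
qed

lemma proj_dim_le_1D:
  fixes s :: "'r::comm_ring_1 \<Rightarrow> 'b::ab_group_add \<Rightarrow> 'b"
  assumes "proj_dim s M \<le> 1"
  obtains P0 P1 :: "((nat \<times> 'b \<times> 'r) \<Rightarrow>\<^sub>0 'r) set" and d e
  where "projective_mod fscale P0" "projective_mod fscale P1"
    "mod_hom_on fscale s P0 M e" "mod_hom_on fscale fscale P1 P0 d"
    "e ` P0 = M" "{x \<in> P0. e x = 0} = d ` P1" "{x \<in> P1. d x = 0} = {0}"
proof -
  let ?R = "\<lambda>n. \<exists>(P :: nat \<Rightarrow> ((nat \<times> 'b \<times> 'r) \<Rightarrow>\<^sub>0 'r) set) d e. projective_resolution s M fscale n P d e"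
  have "Inf {enat n | n. ?R n} \<le> 1" using assms by (simp add: proj_dim_def)
  moreover from this have "{enat n | n. ?R n} \<noteq> {}"
    by (metis Inf_enat_def infinity_ileE one_enat_def)
  ultimately have "\<exists>n. ?R n \<and> enat n \<le> 1"
    using wellorder_InfI[of _ "{enat n | n. ?R n}"] by fastforce
  then obtain n and P :: "nat \<Rightarrow> ((nat \<times> 'b \<times> 'r) \<Rightarrow>\<^sub>0 'r) set" and d e
    where R: "projective_resolution s M fscale n P d e" and n: "n \<le> 1"
    by (auto simp: one_enat_def)
  have P2: "P 2 = {0}" using R n by (auto simp: projective_resolution_def)
  have d: "mod_hom_on fscale fscale (P (Suc i)) (P i) (d i)" for i
    using R by (auto simp: projective_resolution_def)
  have "{x \<in> P 1. d 0 x = 0} = d 1 ` P 2"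
    using R by (auto simp: projective_resolution_def numeral_2_eq_2)
  moreover have "d 1 0 = 0"
    using mod_hom_on_0[OF module_fscale module_fscale _ d[of 1]] R
    by (auto simp: projective_resolution_def projective_mod_def)
  ultimately show ?thesis
    using that[of "P 0" "P 1" e "d 0"] R P2 d[of 0]
    by (auto simp: projective_resolution_def)
qed

definition comb :: "('r::comm_ring_1 \<Rightarrow> 'b::ab_group_add \<Rightarrow> 'b) \<Rightarrow> ('i::finite \<Rightarrow> 'b) \<Rightarrow> 'r ^ 'i \<Rightarrow> 'b" where
  "comb s g a = (\<Sum>i\<in>UNIV. s (a $ i) (g i))"

abbreviation lincomb :: "('i::finite \<Rightarrow> 'r::comm_ring_1 ^ 'm) \<Rightarrow> 'r ^ 'i \<Rightarrow> 'r ^ 'm" where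
  "lincomb \<equiv> comb (*s)"

context module begin

lemma comb_add: "comb scale g (a + b) = comb scale g a + comb scale g b"
  and comb_scale: "comb scale g (c *s a) = scale c (comb scale g a)"
  and comb_0: "comb scale g 0 = 0"
  by (simp_all add: comb_def scale_left_distrib sum.distrib scale_sum_right)

lemma comb_diff: "comb scale g (a - b) = comb scale g a - comb scale g b"
  by (simp add: comb_def scale_left_diff_distrib sum_subtractf)

lemma comb_axis: "comb scale g (axis i 1) = g i"
proof -
  have "comb scale g (axis i 1) = (\<Sum>j\<in>UNIV. if j = i then g j else 0)"
    unfolding comb_def by (rule sum.cong) (auto simp: axis_def)
  then show ?thesis by simp
qed

lemma comb_in: "subspace M \<Longrightarrow> (\<And>i. g i \<in> M) \<Longrightarrow> comb scale g a \<in> M"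
  unfolding comb_def by (intro subspace_sum subspace_scale) auto

lemma comb_hom: "subspace M \<Longrightarrow> (\<And>i. g i \<in> M) \<Longrightarrow> mod_hom_on (*s) scale UNIV M (comb scale g)"
  by (auto simp: mod_hom_on_def comb_add comb_scale comb_in)

end

lemma vec_expand: "a = lincomb (\<lambda>i. axis i 1) (a :: 'r::comm_ring_1 ^ 'i::finite)"
proof -
  have "lincomb (\<lambda>i. axis i 1) a $ c = (\<Sum>i\<in>UNIV. if i = c then a $ i else 0)" for c
    unfolding comb_def sum_component by (rule sum.cong) (auto simp: axis_def)
  then show ?thesis by (simp add: vec_eq_iff)
qed

lemma mod_hom_on_comb:
  assumes "module s1" "module s2" "module.subspace s1 M" "mod_hom_on s1 s2 M N f" "\<And>i. x i \<in> M"
  shows "f (comb s1 x c) = comb s2 (\<lambda>i. f (x i)) c"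
  unfolding comb_def by (rule mod_hom_on_sum[OF assms])

text \<open>Let \<open>F\<^sub>1 \<rightarrow> F\<^sub>0 \<rightarrow> M\<close> be the presentation given by \<open>K\<close> and \<open>g\<close>, and let \<open>z\<close> generate the kernel of
\<open>F\<^sub>1 \<rightarrow> F\<^sub>0\<close>. If \<open>M\<close> has a projective resolution of length one, then the image of \<open>F\<^sub>1\<close> in \<open>F\<^sub>0\<close> is projective
by Schanuel's argument, so \<open>F\<^sub>1\<close> maps onto its direct summand generated by \<open>z\<close>. This projection sends
\<open>z\<close> to \<open>z\<close> and each basis vector to a multiple of \<open>z\<close>; these multiples are the coefficients \<open>h\<close>.\<close>

lemma proj_dim_le_1_imp_second_syzygy_unimodular:
  fixes s :: "'r::comm_ring_1 \<Rightarrow> 'b::ab_group_add \<Rightarrow> 'b" and g :: "'i::finite \<Rightarrow> 'b"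
    and K :: "'j::finite \<Rightarrow> 'r ^ 'i" and z :: "'r ^ 'j"
  assumes s: "module s" and M: "module.subspace s M" and pd: "proj_dim s M \<le> 1"
    and gM: "\<And>i. g i \<in> M" and span: "\<And>m. m \<in> M \<Longrightarrow> \<exists>a. m = comb s g a"
    and rel: "\<And>a. comb s g a = 0 \<longleftrightarrow> (\<exists>t. a = lincomb K t)"
    and rel2: "\<And>t. lincomb K t = 0 \<longleftrightarrow> (\<exists>r. t = r *s z)"
    and z: "\<And>r. r *s z = 0 \<Longrightarrow> r = 0"
  shows "\<exists>h. (\<Sum>j\<in>UNIV. h j * z $ j) = 1"
proof -
  interpret m: module s by fact
  note F = module_fscale
  obtain P0 P1 :: "((nat \<times> 'b \<times> 'r) \<Rightarrow>\<^sub>0 'r) set" and d e where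
    P0: "projective_mod fscale P0" and P1: "projective_mod fscale P1" and
    e: "mod_hom_on fscale s P0 M e" and d: "mod_hom_on fscale fscale P1 P0 d" and
    surj: "e ` P0 = M" and ker: "{x \<in> P0. e x = 0} = d ` P1" and inj: "{x \<in> P1. d x = 0} = {0}"
    by (rule proj_dim_le_1D[OF pd])
  have subP0: "module.subspace fscale P0" and subP1: "module.subspace fscale P1"
    using P0 P1 by (auto simp: projective_mod_def)
  define Ker where "Ker = {a. comb s g a = 0}"
  have subKer: "vmod.subspace Ker"
    by (rule vmod.subspaceI) (auto simp: Ker_def m.comb_add m.comb_scale m.comb_0)
  have KerK: "Ker = range (lincomb K)" using rel by (auto simp: Ker_def)
  have \<gamma>: "mod_hom_on (*s) s UNIV M (comb s g)" by (rule m.comb_hom[OF M gM])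
  have "K j \<in> Ker" for j using KerK vmod.comb_axis[of K j] by (metis rangeI)
  then have \<kappa>: "mod_hom_on (*s) (*s) UNIV Ker (lincomb K)"
    by (rule vmod.comb_hom[OF subKer])
  \<comment> \<open>Comparison maps between the resolution \<open>P1 \<rightarrow> P0\<close> and the presentation: \<open>g0\<close> and \<open>g1\<close> lead to
    the presentation, \<open>f0\<close> leads back in degree zero.\<close>
  obtain g0 where g0: "mod_hom_on fscale (*s) P0 UNIV g0" "\<And>p. p \<in> P0 \<Longrightarrow> comb s g (g0 p) = e p"
  proof (rule projective_lift[OF module_vector_scalar_mult s P0 vmod.subspace_UNIV \<gamma> e])
    show "e p \<in> range (comb s g)" if "p \<in> P0" for p
      using span[OF mod_hom_onD(1)[OF e that]] by auto
  qed blast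
  have g0d: "mod_hom_on fscale (*s) P1 Ker (\<lambda>p. g0 (d p))"
  proof -
    have "g0 (d p) \<in> Ker" if "p \<in> P1" for p
    proof -
      have "d p \<in> {x \<in> P0. e x = 0}" using ker that by blast
      then show ?thesis using g0(2)[of "d p"] by (simp add: Ker_def)
    qed
    then show ?thesis using mod_hom_on_compose[OF d g0(1)] by (auto simp: mod_hom_on_def)
  qed
  obtain g1 where g1: "mod_hom_on fscale (*s) P1 UNIV g1" "\<And>p. p \<in> P1 \<Longrightarrow> lincomb K (g1 p) = g0 (d p)"
  proof (rule projective_lift[OF module_vector_scalar_mult module_vector_scalar_mult P1
          vmod.subspace_UNIV \<kappa> g0d])
    show "g0 (d p) \<in> range (lincomb K)" if "p \<in> P1" for p
      using mod_hom_onD(1)[OF g0d that] KerK by simp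
  qed blast
  have "\<exists>p. p \<in> P0 \<and> e p = g i" for i using surj gM by (metis image_iff)
  then obtain pp where pp: "\<And>i. pp i \<in> P0" "\<And>i. e (pp i) = g i" by metis
  define f0 where "f0 = comb fscale pp"
  have f0: "mod_hom_on (*s) fscale UNIV P0 f0"
    unfolding f0_def by (rule module.comb_hom[OF F subP0 pp(1)])
  have ef0: "e (f0 a) = comb s g a" for a
    unfolding f0_def using mod_hom_on_comb[OF F s subP0 e pp(1)] by (simp add: pp(2))
  \<comment> \<open>Since \<open>g0 \<circ> f0\<close> and the identity induce the same map on \<open>M\<close>, their difference factors through \<open>comb K\<close>.\<close>
  have "\<exists>t. lincomb K t = g0 (f0 (axis i 1)) - axis i 1" for i
  proof -
    have "comb s g (g0 (f0 (axis i 1)) - axis i 1) = 0"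
      using g0(2)[OF mod_hom_onD(1)[OF f0]] by (simp add: m.comb_diff ef0)
    then show ?thesis using rel by metis
  qed
  then obtain H where H: "\<And>i. lincomb K (H i) = g0 (f0 (axis i 1)) - axis i 1" by metis
  define h0 where "h0 = lincomb H"
  have h0: "lincomb K (h0 a) = g0 (f0 a) - a" for a
  proof -
    have "lincomb K (h0 a) = lincomb (\<lambda>i. g0 (f0 (axis i 1)) - axis i 1) a"
      unfolding h0_def
      using mod_hom_on_comb[OF module_vector_scalar_mult module_vector_scalar_mult vmod.subspace_UNIV \<kappa>,
          of H a] by (simp add: H)
    also have "\<dots> = lincomb (\<lambda>i. g0 (f0 (axis i 1))) a - lincomb (\<lambda>i. axis i 1) a"
      by (simp add: comb_def vmod.scale_right_diff_distrib sum_subtractf)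
    also have "lincomb (\<lambda>i. g0 (f0 (axis i 1))) a = g0 (f0 (lincomb (\<lambda>i. axis i 1) a))"
      by (rule mod_hom_on_comb[OF module_vector_scalar_mult module_vector_scalar_mult vmod.subspace_UNIV
            mod_hom_on_compose[OF f0 g0(1)], symmetric]) simp
    finally show ?thesis by (simp flip: vec_expand)
  qed
  \<comment> \<open>On the kernel of \<open>F\<^sub>0 \<rightarrow> M\<close> the map \<open>f0\<close> lifts through the injective \<open>d\<close>; the lift \<open>q\<close> gives the section
    \<open>g1 \<circ> q - h0\<close> of \<open>comb K\<close>.\<close>
  have "\<exists>p. p \<in> P1 \<and> d p = f0 k" if "k \<in> Ker" for k
  proof -
    have "f0 k \<in> {x \<in> P0. e x = 0}" using that mod_hom_onD(1)[OF f0] by (simp add: ef0 Ker_def)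
    then show ?thesis unfolding ker by auto
  qed
  then obtain q where q: "\<And>k. k \<in> Ker \<Longrightarrow> q k \<in> P1" "\<And>k. k \<in> Ker \<Longrightarrow> d (q k) = f0 k" by metis
  have quniq: "p = p'" if "p \<in> P1" "p' \<in> P1" "d p = d p'" for p p'
  proof -
    have "d (p - p') = 0" using mod_hom_on_diff[OF F F subP1 d that(1,2)] that(3) by simp
    moreover have "p - p' \<in> P1" using module.subspace_diff[OF F subP1] that by blast
    ultimately have "p - p' \<in> {0}" unfolding inj[symmetric] by simp
    then show ?thesis by simp
  qed
  have qscale: "q (c *s k) = fscale c (q k)" if "k \<in> Ker" for c k
  proof (rule quniq)
    have ck: "c *s k \<in> Ker" using vmod.subspace_scale[OF subKer] that by blast
    then show "q (c *s k) \<in> P1" using q by blast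
    show "fscale c (q k) \<in> P1" using q that module.subspace_scale[OF F subP1] by blast
    show "d (q (c *s k)) = d (fscale c (q k))"
      using q that ck mod_hom_onD(3)[OF d] mod_hom_onD(3)[OF f0] by simp
  qed
  have qadd: "q (k + k') = q k + q k'" if "k \<in> Ker" "k' \<in> Ker" for k k'
  proof (rule quniq)
    have kk: "k + k' \<in> Ker" using vmod.subspace_add[OF subKer] that by blast
    then show "q (k + k') \<in> P1" using q by blast
    show "q k + q k' \<in> P1" using q that module.subspace_add[OF F subP1] by blast
    show "d (q (k + k')) = d (q k + q k')"
      using q that kk mod_hom_onD(2)[OF d] mod_hom_onD(2)[OF f0] by simp
  qed
  have qhom: "mod_hom_on (*s) fscale Ker P1 q"
    using q qadd qscale by (auto simp: mod_hom_on_def)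
  define \<tau> where "\<tau> t = t - (g1 (q (lincomb K t)) - h0 (lincomb K t))" for t
  have q\<kappa>: "mod_hom_on (*s) (*s) UNIV UNIV (\<lambda>t. g1 (q (lincomb K t)))"
    using mod_hom_on_compose[OF mod_hom_on_compose[OF \<kappa> qhom] g1(1)] .
  have \<tau>hom: "mod_hom_on (*s) (*s) UNIV UNIV \<tau>"
    using q\<kappa> by (auto simp: mod_hom_on_def \<tau>_def h0_def vmod.comb_add vmod.comb_scale vmod.scale_right_diff_distrib)
  have "lincomb K (\<tau> t) = 0" for t
  proof -
    have k: "lincomb K t \<in> Ker" using KerK by blast
    have "lincomb K (g1 (q (lincomb K t))) = g0 (f0 (lincomb K t))"
      using g1(2)[OF q(1)[OF k]] q(2)[OF k] by simp
    then show ?thesis by (simp add: \<tau>_def vmod.comb_diff h0)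
  qed
  then have "\<exists>r. \<tau> t = r *s z" for t using rel2 by blast
  then obtain \<rho> where \<rho>: "\<And>t. \<tau> t = \<rho> t *s z" by metis
  have "lincomb K z = 0" using rel2[of z] by (metis vmod.scale_one)
  moreover have "q 0 = 0"
    using qscale[of 0 0] vmod.subspace_0[OF subKer] module.scale_zero_left[OF F]
    by (metis vmod.scale_zero_left)
  ultimately have "\<tau> z = z"
    using mod_hom_on_0[OF F module_vector_scalar_mult subP1 g1(1)]
    by (simp add: \<tau>_def h0_def vmod.comb_0)
  moreover have "\<tau> z = lincomb (\<lambda>j. \<tau> (axis j 1)) z"
    using mod_hom_on_comb[OF module_vector_scalar_mult module_vector_scalar_mult vmod.subspace_UNIV \<tau>hom,
        of "\<lambda>j. axis j 1" z] by (simp flip: vec_expand)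
  moreover have "\<dots> = (\<Sum>j\<in>UNIV. \<rho> (axis j 1) * z $ j) *s z"
    by (simp add: comb_def \<rho> vmod.scale_sum_left mult.commute)
  ultimately have "((\<Sum>j\<in>UNIV. \<rho> (axis j 1) * z $ j) - 1) *s z = 0"
    by (simp add: vmod.scale_left_diff_distrib)
  then have "(\<Sum>j\<in>UNIV. \<rho> (axis j 1) * z $ j) = 1" using z by fastforce
  then show ?thesis by (rule exI[of _ "\<lambda>j. \<rho> (axis j 1)"])
qed

text \<open>The free module of finite rank with index type \<open>'i\<close>, placed along \<open>x\<close> inside the free module
with basis \<open>'x\<close>. It moves finite free resolutions to the ambient module over which \<^const>\<open>proj_dim\<close>
ranges.\<close>

definition coord_emb :: "('i::finite \<Rightarrow> 'x) \<Rightarrow> 'r::comm_ring_1 ^ 'i \<Rightarrow> ('x \<Rightarrow>\<^sub>0 'r)" where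
  "coord_emb x a = (\<Sum>i\<in>UNIV. single (x i) (a $ i))"

lemma lookup_coord_emb: "inj x \<Longrightarrow> lookup (coord_emb x a) (x i) = a $ i"
  by (simp add: coord_emb_def lookup_sum lookup_single when_def inj_eq)

lemma fscale_single: "fscale c (single y b) = single y (c * b)"
  by (rule poly_mapping_eqI) (auto simp: lookup_fscale lookup_single when_def)

lemma coord_emb_add: "coord_emb x (a + b) = coord_emb x a + coord_emb x b"
  and coord_emb_scale: "coord_emb x (c *s a) = fscale c (coord_emb x a)"
  and coord_emb_0: "coord_emb x 0 = 0"
  by (simp_all add: coord_emb_def single_add sum.distrib fscale_single module.scale_sum_right[OF module_fscale])

lemma projective_range_coord_emb:
  fixes x :: "'i::finite \<Rightarrow> 'x"
  assumes x: "inj x"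
  shows "projective_mod fscale (range (coord_emb x :: 'r::comm_ring_1 ^ 'i \<Rightarrow> _))"
proof -
  interpret f: module "fscale :: 'r \<Rightarrow> ('x \<Rightarrow>\<^sub>0 'r) \<Rightarrow> _" by (rule module_fscale)
  interpret f2: module "fscale :: 'r \<Rightarrow> (('x \<Rightarrow>\<^sub>0 'r) \<Rightarrow>\<^sub>0 'r) \<Rightarrow> _" by (rule module_fscale)
  let ?P = "range (coord_emb x :: 'r ^ 'i \<Rightarrow> _)"
  have sub: "f.subspace ?P"
  proof (rule f.subspaceI)
    show "0 \<in> ?P" using coord_emb_0[of x] by (metis rangeI)
  qed (auto simp flip: coord_emb_add coord_emb_scale)
  define b where "b i = (single (x i) 1 :: 'x \<Rightarrow>\<^sub>0 'r)" for i
  have b: "inj b"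
  proof (rule injI)
    fix i j assume "b i = b j"
    then have "lookup (b j) (x i) = 1" by (metis b_def lookup_single_eq)
    then show "i = j" using x by (auto simp: b_def lookup_single when_def inj_eq split: if_splits)
  qed
  have bP: "b i \<in> ?P" for i
  proof -
    have "coord_emb x (axis i (1::'r)) = (\<Sum>j\<in>UNIV. if j = i then b j else 0)"
      unfolding coord_emb_def b_def by (rule sum.cong) (auto simp: axis_def)
    then show ?thesis by simp (metis rangeI)
  qed
  define i where "i f = coord_emb b (\<chi> j. lookup f (x j))" for f :: "'x \<Rightarrow>\<^sub>0 'r"
  define r where "r F = (\<Sum>j\<in>UNIV. fscale (lookup F (b j)) (b j))" for F :: "('x \<Rightarrow>\<^sub>0 'r) \<Rightarrow>\<^sub>0 'r"
  have "i (p + p') = i p + i p'" "i (fscale c p) = fscale c (i p)" for p p' c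
    unfolding i_def coord_emb_add[symmetric] coord_emb_scale[symmetric]
    by (auto intro!: arg_cong[of _ _ "coord_emb b"] simp: vec_eq_iff lookup_add lookup_fscale)
  then have "mod_hom_on fscale fscale ?P UNIV i" by (simp add: mod_hom_on_def)
  moreover have "mod_hom_on fscale fscale UNIV ?P r"
    unfolding mod_hom_on_def
    by (auto simp: r_def lookup_add lookup_fscale f.scale_left_distrib sum.distrib f.scale_sum_right
        intro!: f.subspace_sum[OF sub] f.subspace_scale[OF sub] bP)
  moreover have "r (i p) = p" if pP: "p \<in> ?P" for p
  proof -
    obtain a where a: "p = coord_emb x a" using pP by auto
    have "fscale c (b j) = single (x j) c" for c j
      by (rule poly_mapping_eqI) (auto simp: b_def lookup_fscale lookup_single when_def)
    then show ?thesis
      by (simp add: r_def i_def lookup_coord_emb[OF b] a lookup_coord_emb[OF x]) (simp add: coord_emb_def)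
  qed
  ultimately show ?thesis using sub unfolding projective_mod_def by blast
qed

lemma projective_zero: "projective_mod (fscale :: 'r::comm_ring_1 \<Rightarrow> ('x \<Rightarrow>\<^sub>0 'r) \<Rightarrow> _) {0}"
proof -
  interpret f: module "fscale :: 'r \<Rightarrow> ('x \<Rightarrow>\<^sub>0 'r) \<Rightarrow> _" by (rule module_fscale)
  interpret f2: module "fscale :: 'r \<Rightarrow> (('x \<Rightarrow>\<^sub>0 'r) \<Rightarrow>\<^sub>0 'r) \<Rightarrow> _" by (rule module_fscale)
  show ?thesis
    unfolding projective_mod_def mod_hom_on_def
    by (auto intro!: exI[of _ "\<lambda>_. 0"])
qed

text \<open>The hypotheses are a free resolution \<open>0 \<rightarrow> R\<^sup>j \<rightarrow> R\<^sup>i \<rightarrow> M \<rightarrow> 0\<close>.\<close>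

lemma proj_dim_le_1I:
  fixes s :: "'r::comm_ring_1 \<Rightarrow> 'b::ab_group_add \<Rightarrow> 'b" and g :: "'i::finite \<Rightarrow> 'b"
    and K :: "'j::finite \<Rightarrow> 'r ^ 'i"
  assumes s: "module s"
    and M: "M = range (comb s g)"
    and rel: "\<And>a. comb s g a = 0 \<longleftrightarrow> (\<exists>t. a = lincomb K t)"
    and free: "\<And>t. lincomb K t = 0 \<Longrightarrow> t = 0"
  shows "proj_dim s M \<le> 1"
proof -
  interpret m: module s by fact
  interpret f: module "fscale :: 'r \<Rightarrow> ((nat \<times> 'b \<times> 'r) \<Rightarrow>\<^sub>0 'r) \<Rightarrow> _" by (rule module_fscale)
  obtain ni :: "'i \<Rightarrow> nat" and nj :: "'j \<Rightarrow> nat" where "inj ni" "inj nj"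
    using finite_imp_inj_to_nat_seg[of "UNIV :: 'i set"] finite_imp_inj_to_nat_seg[of "UNIV :: 'j set"] by auto
  define xi where "xi i = (ni i, 0::'b, 0::'r)" for i
  define xj where "xj j = (nj j, 0::'b, 0::'r)" for j
  have xi: "inj xi" and xj: "inj xj" using \<open>inj ni\<close> \<open>inj nj\<close> by (auto simp: inj_def xi_def xj_def)
  define P :: "nat \<Rightarrow> ((nat \<times> 'b \<times> 'r) \<Rightarrow>\<^sub>0 'r) set" where
    "P n = (if n = 0 then range (coord_emb xi) else if n = 1 then range (coord_emb xj) else {0})" for n
  define d where "d n f = (if n = 0 then coord_emb xi (lincomb K (\<chi> j. lookup f (xj j))) else 0)"
    for n :: nat and f
  define e where "e f = comb s g (\<chi> i. lookup f (xi i))" for f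
  have vl: "(\<chi> i. lookup (p + p') (x i)) = (\<chi> i. lookup p (x i)) + (\<chi> i. lookup p' (x i))"
    "(\<chi> i. lookup (fscale c p) (x i)) = c *s (\<chi> i. lookup p (x i))"
    for p p' :: "(nat \<times> 'b \<times> 'r) \<Rightarrow>\<^sub>0 'r" and c and x :: "'z::finite \<Rightarrow> _"
    by (auto simp: vec_eq_iff lookup_add lookup_fscale)
  have ei: "e (coord_emb xi a) = comb s g a" for a
    by (simp add: e_def lookup_coord_emb[OF xi])
  have dj: "d 0 (coord_emb xj t) = coord_emb xi (lincomb K t)" for t
    by (simp add: d_def lookup_coord_emb[OF xj])
  have inj_xi: "coord_emb xi a = 0 \<longleftrightarrow> a = 0" for a :: "'r ^ 'i"
    using lookup_coord_emb[OF xi, of a] by (metis coord_emb_0 lookup_zero vec_eq_iff zero_index)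
  have proj: "projective_mod fscale (P n)" for n
    using projective_range_coord_emb[where 'r = 'r, OF xi] projective_range_coord_emb[where 'r = 'r, OF xj]
      projective_zero[where 'r = 'r and 'x = "nat \<times> 'b \<times> 'r"] by (simp add: P_def)
  have ehom: "mod_hom_on fscale s (P 0) M e"
    unfolding mod_hom_on_def e_def M vl m.comb_add m.comb_scale by auto
  have dhom: "mod_hom_on fscale fscale (P (Suc n)) (P n) (d n)" for n
  proof (cases "n = 0")
    case True
    then show ?thesis
      unfolding mod_hom_on_def by (auto simp: d_def P_def vl vmod.comb_add vmod.comb_scale coord_emb_add coord_emb_scale)
  next
    case False
    have "0 \<in> P n" using module.subspace_0[OF module_fscale] proj unfolding projective_mod_def by blast
    then show ?thesis using False unfolding mod_hom_on_def by (auto simp: d_def)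
  qed
  have esurj: "e ` P 0 = M" by (auto simp: P_def M ei image_image)
  have ex0: "{x \<in> P 0. e x = 0} = d 0 ` P 1"
    by (auto simp: P_def ei dj rel image_image image_iff)
  have ex1: "{x \<in> P (Suc n). d n x = 0} = d (Suc n) ` P (Suc (Suc n))" for n
  proof (cases "n = 0")
    case True
    have "0 \<in> range (coord_emb xj :: 'r ^ 'j \<Rightarrow> _)" by (metis coord_emb_0 rangeI)
    moreover have "d 0 0 = 0" using dj[of 0] by (simp add: coord_emb_0 vmod.comb_0)
    moreover have "lincomb K t = 0 \<Longrightarrow> coord_emb xj t = 0" for t
      using free[of t] by (simp add: coord_emb_0)
    ultimately show ?thesis
      using True by (auto simp: P_def d_def[of "Suc 0"] dj inj_xi)
  next
    case False
    then show ?thesis by (auto simp: P_def d_def)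
  qed
  have "projective_resolution s M fscale 1 P d e"
    unfolding projective_resolution_def using proj ehom dhom esurj ex0 ex1 by (auto simp: P_def)
  then have "proj_dim s M \<le> enat 1"
    unfolding proj_dim_def by (intro Inf_lower) blast
  then show ?thesis by (simp add: one_enat_def)
qed

section \<open>Counting generators\<close>

text \<open>Gaussian elimination without division, so that it applies to polynomials as well as to
constants.\<close>

lemma underdetermined_system:
  fixes A :: "'i \<Rightarrow> 'j \<Rightarrow> 'r::comm_ring_1"
  assumes dom: "\<And>a b :: 'r. a * b = 0 \<Longrightarrow> a = 0 \<or> b = 0"
    and "finite J" "finite I" "card J < card I"
  shows "\<exists>c. (\<exists>i\<in>I. c i \<noteq> 0) \<and> (\<forall>j\<in>J. (\<Sum>i\<in>I. c i * A i j) = 0)"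
  using assms(2-)
proof (induction J arbitrary: I A rule: finite_induct)
  case empty
  then obtain i where "i \<in> I" by fastforce
  then show ?case by (intro exI[of _ "\<lambda>_. 1"]) auto
next
  case (insert j J)
  show ?case
  proof (cases "\<forall>i\<in>I. A i j = 0")
    case True
    have "card J < card I" using insert by simp
    then obtain c where "\<exists>i\<in>I. c i \<noteq> 0" "\<forall>k\<in>J. (\<Sum>i\<in>I. c i * A i k) = 0"
      using insert.IH[OF insert.prems(1)] by blast
    then show ?thesis using True by auto
  next
    case False
    then obtain i0 where i0: "i0 \<in> I" "A i0 j \<noteq> 0" by blast
    let ?p = "A i0 j" and ?I = "I - {i0}"
    have "card J < card ?I" "finite ?I" using insert i0 by auto
    then obtain c where c: "\<exists>i\<in>?I. c i \<noteq> 0"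
      "\<forall>k\<in>J. (\<Sum>i\<in>?I. c i * (?p * A i k - A i j * A i0 k)) = 0"
      using insert.IH[of ?I "\<lambda>i k. ?p * A i k - A i j * A i0 k"] by blast
    \<comment> \<open>Equation \<open>j\<close> is used to eliminate the unknown \<open>i0\<close>, after multiplying the others by its coefficient.\<close>
    define c' where "c' i = (if i = i0 then - (\<Sum>i\<in>?I. c i * A i j) else ?p * c i)" for i
    have sum: "(\<Sum>i\<in>I. c' i * A i k) = (\<Sum>i\<in>?I. c i * (?p * A i k - A i j * A i0 k))" for k
    proof -
      have "(\<Sum>i\<in>I. c' i * A i k) = c' i0 * A i0 k + (\<Sum>i\<in>?I. c' i * A i k)"
        using i0 insert.prems by (simp add: sum.remove)
      also have "(\<Sum>i\<in>?I. c' i * A i k) = (\<Sum>i\<in>?I. ?p * c i * A i k)"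
        by (rule sum.cong) (auto simp: c'_def)
      also have "c' i0 * A i0 k = - (\<Sum>i\<in>?I. c i * A i j * A i0 k)"
        by (simp add: c'_def sum_distrib_right)
      finally show ?thesis by (simp add: sum_subtractf algebra_simps)
    qed
    have "(\<Sum>i\<in>I. c' i * A i j) = 0" unfolding sum by (simp add: mult.commute)
    then have "\<forall>k\<in>insert j J. (\<Sum>i\<in>I. c' i * A i k) = 0" using sum c(2) by simp
    moreover have "\<exists>i\<in>I. c' i \<noteq> 0"
      using c(1) dom i0(2) by (auto simp: c'_def)
    ultimately show ?thesis by blast
  qed
qed

lemma smult_vec_eq_0:
  fixes v :: "('k::field, 'n::finite) mpoly ^ 'i"
  shows "c *s v = 0 \<longleftrightarrow> c = 0 \<or> v = 0"
  using mpoly_no_zero_divisors[of c] by (auto simp: vec_eq_iff)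

lemma smult_vec_cancel:
  fixes v w :: "('k::field, 'n::finite) mpoly ^ 'i"
  assumes "c *s v = c *s w" "c \<noteq> 0"
  shows "v = w"
  using smult_vec_eq_0[of c "v - w"] assms by (simp add: vmod.scale_right_diff_distrib)

lemma independent_card_le:
  fixes B :: "(('k::field, 'n::finite) mpoly ^ 'm::finite) set"
  assumes B: "\<not> vmod.dependent B"
  shows "finite B" "card B \<le> CARD('m)"
proof -
  have *: "card F \<le> CARD('m)" if F: "finite F" "F \<subseteq> B" for F
  proof (rule ccontr)
    assume "\<not> card F \<le> CARD('m)"
    then obtain c where c: "\<exists>v\<in>F. c v \<noteq> 0" "\<forall>i. (\<Sum>v\<in>F. c v * v $ i) = 0"
      using underdetermined_system[of "UNIV :: 'm set" F "\<lambda>v i. v $ i", OF mpoly_no_zero_divisors] F by auto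
    have "(\<Sum>v\<in>F. c v *s v) = 0" using c(2) by (simp add: vec_eq_iff)
    then show False using vmod.independentD[OF B F] c(1) by blast
  qed
  show "finite B"
  proof (rule ccontr)
    assume "infinite B"
    then obtain F where "F \<subseteq> B" "finite F" "card F = Suc CARD('m)"
      using infinite_arbitrarily_large by blast
    then show False using * by fastforce
  qed
  then show "card B \<le> CARD('m)" using * by blast
qed

text \<open>A basis has at most as many elements as the ambient rank by independence, and at least as
many because multiples of all unit vectors lie in the submodule. So it can be indexed by the
same type as the coordinates.\<close>

lemma free_full_rank_basis:
  fixes D :: "(('k::field, 'n::finite) mpoly ^ 'm::finite) set"
  assumes "free_mod (*s) D" and q: "q \<noteq> 0" "\<And>i. q *s axis i 1 \<in> D"
  obtains \<theta> :: "'m \<Rightarrow> ('k, 'n) mpoly ^ 'm"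
  where "D = range (lincomb \<theta>)" "\<And>c. lincomb \<theta> c = 0 \<Longrightarrow> c = 0"
proof -
  obtain B where B: "\<not> vmod.dependent B" "vmod.span B = D"
    using assms(1) by (auto simp: free_mod_def)
  note fin = independent_card_le[OF B(1)]
  have "\<not> card B < CARD('m)"
  proof
    assume less: "card B < CARD('m)"
    have "\<exists>u. q *s axis i 1 = (\<Sum>v\<in>B. u v *s v)" for i
      using q(2)[of i] unfolding B(2)[symmetric] vmod.span_finite[OF fin(1)] by auto
    then have "\<forall>i. \<exists>u. q *s axis i 1 = (\<Sum>v\<in>B. u v *s v)" by blast
    from choice[OF this] obtain u where u: "\<And>i. q *s axis i 1 = (\<Sum>v\<in>B. u i v *s v)" by blast
    obtain c where c: "\<exists>i. c i \<noteq> 0" "\<forall>v\<in>B. (\<Sum>i\<in>UNIV. c i * u i v) = 0"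
      using underdetermined_system[of B "UNIV :: 'm set" u, OF mpoly_no_zero_divisors fin(1) _ less] by auto
    have "(\<Sum>i\<in>UNIV. c i *s (q *s axis i 1)) = (\<Sum>i\<in>UNIV. \<Sum>v\<in>B. (c i * u i v) *s v)"
      by (simp add: u vmod.scale_sum_right)
    also have "\<dots> = (\<Sum>v\<in>B. (\<Sum>i\<in>UNIV. c i * u i v) *s v)"
      by (subst sum.swap) (simp add: vmod.scale_sum_left)
    also have "\<dots> = 0" using c(2) by simp
    finally have "(\<Sum>i\<in>UNIV. c i *s (q *s axis i 1)) = 0" .
    moreover have "(\<Sum>i\<in>UNIV. c i *s (q *s axis i 1)) = q *s lincomb (\<lambda>i. axis i 1) (\<chi> i. c i)"
      unfolding comb_def by (simp add: vmod.scale_sum_right mult.commute)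
    ultimately have "q *s (\<chi> i. c i) = 0" using vec_expand by metis
    then have "(\<chi> i. c i) = 0" using q(1) smult_vec_eq_0 by blast
    then show False using c(1) by (simp add: vec_eq_iff)
  qed
  then have "card B = CARD('m)" using fin(2) by simp
  then obtain \<theta> where \<theta>: "bij_betw \<theta> (UNIV :: 'm set) B"
    using finite_same_card_bij[of "UNIV :: 'm set" B] fin(1) by auto
  have cb: "lincomb \<theta> c = (\<Sum>v\<in>B. c $ inv_into UNIV \<theta> v *s v)" for c
    unfolding comb_def
    using sum.reindex_bij_betw[OF \<theta>, of "\<lambda>v. c $ inv_into UNIV \<theta> v *s v"] \<theta>
    by (simp add: bij_betw_def)
  have cb': "(\<Sum>v\<in>B. u v *s v) = lincomb \<theta> (\<chi> i. u (\<theta> i))" for u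
    unfolding comb_def using sum.reindex_bij_betw[OF \<theta>, of "\<lambda>v. u v *s v"] by simp
  have "D = range (lincomb \<theta>)"
  proof -
    have "range (\<lambda>u. \<Sum>v\<in>B. u v *s v) \<subseteq> range (lincomb \<theta>)" using cb' by blast
    moreover have "range (lincomb \<theta>) \<subseteq> range (\<lambda>u. \<Sum>v\<in>B. u v *s v)"
      by (rule image_subsetI) (rule image_eqI, rule cb, rule UNIV_I)
    ultimately show ?thesis
      unfolding B(2)[symmetric] vmod.span_finite[OF fin(1)] by blast
  qed
  moreover have "c = 0" if "lincomb \<theta> c = 0" for c
  proof -
    have "c $ inv_into UNIV \<theta> v = 0" if "v \<in> B" for v
      using vmod.independentD[OF B(1) fin(1) order_refl, of "\<lambda>v. c $ inv_into UNIV \<theta> v" v]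
        \<open>lincomb \<theta> c = 0\<close> that unfolding cb by simp
    then have "c $ i = 0" for i
      using \<theta> by (metis UNIV_I bij_betwE bij_betw_inv_into_left)
    then show ?thesis by (simp add: vec_eq_iff)
  qed
  ultimately show ?thesis by (rule that)
qed

text \<open>Modulo the maximal ideal of the origin the family \<open>x\<close> is linearly independent, by the hypothesis on its
relations, and the family \<open>y\<close> still generates.\<close>

lemma minimal_generators_card_le:
  fixes x :: "'a \<Rightarrow> ('k::field, 'n::finite) mpoly ^ 'm::finite" and y :: "'b \<Rightarrow> ('k, 'n) mpoly ^ 'm"
  assumes fin: "finite I" "finite J"
    and xy: "\<And>i. i \<in> I \<Longrightarrow> \<exists>u. x i = (\<Sum>j\<in>J. u j *s y j)"
    and yx: "\<And>j. j \<in> J \<Longrightarrow> \<exists>t. y j = (\<Sum>i\<in>I. t i *s x i)"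
    and rel: "\<And>r i. (\<Sum>i\<in>I. r i *s x i) = 0 \<Longrightarrow> i \<in> I \<Longrightarrow> const_term (r i) = 0"
  shows "card I \<le> card J"
proof (rule ccontr)
  assume "\<not> card I \<le> card J"
  then have less: "card J < card I" by simp
  obtain u where u: "\<And>i. i \<in> I \<Longrightarrow> x i = (\<Sum>j\<in>J. u i j *s y j)" using xy by metis
  obtain t where t: "\<And>j. j \<in> J \<Longrightarrow> y j = (\<Sum>i\<in>I. t j i *s x i)" using yx by metis
  obtain c where c: "\<exists>i\<in>I. c i \<noteq> 0" "\<forall>j\<in>J. (\<Sum>i\<in>I. c i * const_term (u i j)) = 0"
    using underdetermined_system[of J I "\<lambda>i j. const_term (u i j)", OF _ fin(2,1) less] by auto
  define e where "e j = (\<Sum>i\<in>I. const_poly (c i) * u i j)" for j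
  have e: "const_term (e j) = 0" if "j \<in> J" for j
    using c(2) that by (simp add: e_def const_term_sum)
  have "(\<Sum>i\<in>I. const_poly (c i) *s x i) = (\<Sum>i\<in>I. \<Sum>j\<in>J. (const_poly (c i) * u i j) *s y j)"
    by (simp add: u vmod.scale_sum_right)
  also have "\<dots> = (\<Sum>j\<in>J. e j *s y j)"
    unfolding e_def by (subst sum.swap) (simp add: vmod.scale_sum_left)
  also have "\<dots> = (\<Sum>j\<in>J. \<Sum>i\<in>I. (e j * t j i) *s x i)"
    by (simp add: t vmod.scale_sum_right)
  also have "\<dots> = (\<Sum>i\<in>I. (\<Sum>j\<in>J. e j * t j i) *s x i)"
    by (subst sum.swap) (simp add: vmod.scale_sum_left)
  finally have "(\<Sum>i\<in>I. (const_poly (c i) - (\<Sum>j\<in>J. e j * t j i)) *s x i) = 0"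
    by (simp add: vmod.scale_left_diff_distrib sum_subtractf)
  then have "const_term (const_poly (c i) - (\<Sum>j\<in>J. e j * t j i)) = 0" if "i \<in> I" for i
    using rel[of "\<lambda>i. const_poly (c i) - (\<Sum>j\<in>J. e j * t j i)" i] that by simp
  then have "c i = 0" if "i \<in> I" for i
    using that e by (simp add: const_term_sum)
  then show False using c(1) by blast
qed

definition exponent_degree :: "('n::finite \<Rightarrow>\<^sub>0 nat) \<Rightarrow> nat" where
  "exponent_degree m = (\<Sum>i\<in>UNIV. lookup m i)"

lemma exponent_degree_add: "exponent_degree (a + b) = exponent_degree a + exponent_degree b"
  by (simp add: exponent_degree_def lookup_add sum.distrib)

definition homog_component :: "nat \<Rightarrow> ('k::comm_ring_1, 'n::finite) mpoly \<Rightarrow> ('k, 'n) mpoly" where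
  "homog_component d f = Poly_Mapping.mapp (\<lambda>m c. if exponent_degree m = d then c else 0) f"

lemma lookup_hcomp:
  "lookup (homog_component d f) m = (if exponent_degree m = d then lookup f m else 0)"
  by (auto simp: homog_component_def lookup_mapp when_def in_keys_iff)

lemma homog_component_add: "homog_component d (f + g) = homog_component d f + homog_component d g"
  by (rule poly_mapping_eqI) (auto simp: lookup_hcomp lookup_add)

lemma homog_component_0 [simp]: "homog_component d 0 = 0"
  by (rule poly_mapping_eqI) (auto simp: lookup_hcomp)

lemma homog_component_sum: "homog_component d (sum F I) = (\<Sum>i\<in>I. homog_component d (F i))"
  by (induction I rule: infinite_finite_induct) (auto simp: homog_component_add)

lemma homog_component_single:
  "homog_component d (single m c) = (if exponent_degree m = d then single m c else 0)"
  by (rule poly_mapping_eqI) (auto simp: lookup_hcomp lookup_single when_def)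

lemma homog_component_in_homog: "homog_component d f \<in> homog d"
  by (auto simp: homog_def in_keys_iff lookup_hcomp exponent_degree_def split: if_splits)

lemma homog_component_degree_0:
  fixes f :: "('k::comm_ring_1, 'n::finite) mpoly"
  shows "homog_component 0 f = const_poly (const_term f)"
proof -
  have "exponent_degree m = 0 \<longleftrightarrow> m = 0" for m :: "'n \<Rightarrow>\<^sub>0 nat"
    by (auto simp: exponent_degree_def poly_mapping_eq_iff fun_eq_iff)
  then show ?thesis
    by (intro poly_mapping_eqI) (auto simp: lookup_hcomp const_poly_def const_term_def lookup_single when_def)
qed

lemma homog_component_mult_single:
  "homog_component d (f * single m c) =
    (if exponent_degree m \<le> d then homog_component (d - exponent_degree m) f * single m c else 0)"
  by (induction f rule: mpoly_induct)
    (auto simp: mult_single homog_component_single exponent_degree_add homog_component_add distrib_right)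

lemma homog_component_mult_homog:
  assumes "g \<in> homog e"
  shows "homog_component d (f * g) = (if e \<le> d then homog_component (d - e) f * g else 0)"
proof -
  have g: "g = (\<Sum>m\<in>keys g. single m (lookup g m))"
    by (rule poly_mapping_eqI) (auto simp: lookup_sum lookup_single when_def in_keys_iff)
  have deg: "exponent_degree m = e" if "m \<in> keys g" for m
    using assms that by (auto simp: homog_def exponent_degree_def)
  have "homog_component d (f * g) = (\<Sum>m\<in>keys g. homog_component d (f * single m (lookup g m)))"
    by (subst g) (simp add: sum_distrib_left homog_component_sum)
  also have "\<dots> = (\<Sum>m\<in>keys g. if e \<le> d then homog_component (d - e) f * single m (lookup g m) else 0)"
    by (rule sum.cong) (auto simp: homog_component_mult_single deg)
  also have "\<dots> = (if e \<le> d then homog_component (d - e) f * g else 0)"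
    by (subst (3) g) (simp add: sum_distrib_left)
  finally show ?thesis .
qed

definition der_component :: "nat \<Rightarrow> ('k::field, 'n::finite) der \<Rightarrow> ('k, 'n) der" where
  "der_component d \<theta> = (\<chi> i. homog_component d (\<theta> $ i))"

lemma der_component_sum: "der_component d (sum F I) = (\<Sum>i\<in>I. der_component d (F i))"
  by (simp add: der_component_def vec_eq_iff homog_component_sum)

lemma der_component_smult_homog:
  assumes "der_homog e \<theta>"
  shows "der_component d (f *s \<theta>) = (if e \<le> d then homog_component (d - e) f else 0) *s \<theta>"
proof -
  have "homog_component d (f * \<theta> $ i) = (if e \<le> d then homog_component (d - e) f * \<theta> $ i else 0)" for i
    using assms by (intro homog_component_mult_homog) (simp add: der_homog_def)
  then show ?thesis by (simp add: der_component_def vec_eq_iff)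
qed

lemma der_homog_der_component: "der_homog d (der_component d \<theta>)"
  by (simp add: der_homog_def der_component_def homog_component_in_homog)

lemma sum_der_component:
  obtains K where "finite K" "\<theta> = (\<Sum>d\<in>K. der_component d \<theta>)"
proof -
  let ?K = "\<Union>i. exponent_degree ` keys (\<theta> $ i)"
  have "(\<Sum>d\<in>?K. homog_component d (\<theta> $ i)) = \<theta> $ i" for i
  proof (rule poly_mapping_eqI)
    fix m
    show "lookup (\<Sum>d\<in>?K. homog_component d (\<theta> $ i)) m = lookup (\<theta> $ i) m"
    proof (cases "m \<in> keys (\<theta> $ i)")
      case True
      then have "exponent_degree m \<in> ?K" by blast
      then show ?thesis by (simp add: lookup_sum lookup_hcomp)
    next
      case False
      then show ?thesis by (simp add: lookup_sum lookup_hcomp in_keys_iff)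
    qed
  qed
  then have "\<theta> = (\<Sum>d\<in>?K. der_component d \<theta>)"
    by (simp add: der_component_def vec_eq_iff)
  then show ?thesis using that[of ?K] by simp
qed

text \<open>The homogeneous components of a finite generating set form a finite homogeneous generating
set; one of its generating subsets with the fewest elements is minimal.\<close>

lemma exists_min_homog_gens:
  fixes M :: "('k::field, 'n::finite) der set"
  assumes Y: "finite Y" "vmod.span Y = M" and graded: "\<And>\<theta> d. \<theta> \<in> M \<Longrightarrow> der_component d \<theta> \<in> M"
  shows "\<exists>G. min_homog_gens M G"
proof -
  have "\<exists>K. finite K \<and> \<theta> = (\<Sum>d\<in>K. der_component d \<theta>)" for \<theta> :: "('k, 'n) der"
    using sum_der_component[of \<theta>] by metis
  then obtain K where K: "\<And>\<theta> :: ('k, 'n) der. finite (K \<theta>)" "\<And>\<theta> :: ('k, 'n) der. \<theta> = (\<Sum>d\<in>K \<theta>. der_component d \<theta>)"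
    by metis
  define Y' where "Y' = (\<Union>\<theta>\<in>Y. (\<lambda>d. der_component d \<theta>) ` K \<theta>)"
  have fin: "finite Y'" using Y(1) K(1) by (auto simp: Y'_def)
  have "Y \<subseteq> vmod.span Y'"
  proof
    fix \<theta> assume \<theta>: "\<theta> \<in> Y"
    have "(\<Sum>d\<in>K \<theta>. der_component d \<theta>) \<in> vmod.span Y'"
      using \<theta> by (intro vmod.span_sum vmod.span_base) (auto simp: Y'_def)
    then show "\<theta> \<in> vmod.span Y'" using K(2)[of \<theta>] by simp
  qed
  moreover have "Y' \<subseteq> vmod.span Y"
    using graded Y(2) vmod.span_superset[of Y] by (auto simp: Y'_def)
  ultimately have span: "vmod.span Y' = M" using Y(2) vmod.span_eq by blast
  obtain G where G: "G \<subseteq> Y' \<and> vmod.span G = M"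
    "\<And>G'. G' \<subseteq> Y' \<and> vmod.span G' = M \<Longrightarrow> card G \<le> card G'"
    using ex_has_least_nat[of "\<lambda>G. G \<subseteq> Y' \<and> vmod.span G = M" Y' card] span by auto
  have "finite G" using G(1) fin finite_subset by blast
  moreover have "vmod.span G' \<noteq> M" if "G' \<subset> G" for G'
    using G(2)[of G'] that G(1) psubset_card_mono[OF \<open>finite G\<close> that] by auto
  moreover have "\<exists>d. der_homog d \<theta>" if "\<theta> \<in> G" for \<theta>
  proof -
    obtain d \<eta> where "\<theta> = der_component d \<eta>" using \<open>\<theta> \<in> G\<close> G(1) by (auto simp: Y'_def)
    then show ?thesis using der_homog_der_component by blast
  qed
  ultimately show ?thesis using G(1) unfolding min_homog_gens_def by blast
qed

text \<open>Graded Nakayama: a relation in which \<open>g0\<close> has a coefficient with nonzero constant term has a component in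
the degree of \<open>g0\<close> that expresses \<open>g0\<close> by the other generators.\<close>

lemma min_homog_gens_relation:
  fixes M :: "('k::field, 'n::finite) der set"
  assumes G: "min_homog_gens M G" and rel: "(\<Sum>g\<in>G. r g *s g) = 0" and g0: "g0 \<in> G"
  shows "const_term (r g0) = 0"
proof (rule ccontr)
  assume c: "const_term (r g0) \<noteq> 0"
  have fin: "finite G" using G by (simp add: min_homog_gens_def)
  have "\<forall>\<theta>\<in>G. \<exists>d. der_homog d \<theta>" using G by (simp add: min_homog_gens_def)
  then obtain dg where dg: "\<And>\<theta>. \<theta> \<in> G \<Longrightarrow> der_homog (dg \<theta>) \<theta>" by metis
  let ?d = "dg g0"
  define r' where "r' g = (if dg g \<le> ?d then homog_component (?d - dg g) (r g) else 0)" for g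
  have "(\<Sum>g\<in>G. r' g *s g) = der_component ?d (\<Sum>g\<in>G. r g *s g)"
    unfolding der_component_sum by (rule sum.cong) (auto simp: r'_def der_component_smult_homog[OF dg])
  also have "\<dots> = 0" unfolding rel by (simp add: der_component_def vec_eq_iff)
  finally have "r' g0 *s g0 + (\<Sum>g\<in>G - {g0}. r' g *s g) = 0"
    using fin g0 by (simp add: sum.remove)
  moreover have "r' g0 = const_poly (const_term (r g0))" by (simp add: r'_def homog_component_degree_0)
  ultimately have "const_poly (const_term (r g0)) *s g0 = - (\<Sum>g\<in>G - {g0}. r' g *s g)"
    by (simp add: eq_neg_iff_add_eq_0)
  also have "\<dots> \<in> vmod.span (G - {g0})"
    by (intro vmod.span_neg vmod.span_sum vmod.span_scale vmod.span_base) auto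
  finally have "const_poly (1 / const_term (r g0)) *s (const_poly (const_term (r g0)) *s g0) \<in> vmod.span (G - {g0})"
    by (rule vmod.span_scale)
  then have "g0 \<in> vmod.span (G - {g0})" using c by (simp flip: const_poly_mult)
  then have "G \<subseteq> vmod.span (G - {g0})" using vmod.span_base[of _ "G - {g0}"] by blast
  moreover have "G - {g0} \<subseteq> vmod.span G" using vmod.span_base[of _ G] by blast
  ultimately have "vmod.span (G - {g0}) = vmod.span G" using vmod.span_eq by blast
  then show False using G g0 by (auto simp: min_homog_gens_def)
qed

lemma finite_range_comb_span:
  "range (lincomb g) = vmod.span (range g)" for g :: "'i::finite \<Rightarrow> 'r::comm_ring_1 ^ 'm"
proof
  show "range (lincomb g) \<subseteq> vmod.span (range g)"
    using vmod.comb_in[OF vmod.subspace_span, of g "range g"] vmod.span_base[of _ "range g"] by blast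
  have "vmod.subspace (range (lincomb g))"
  proof (rule vmod.subspaceI)
    show "0 \<in> range (lincomb g)" using vmod.comb_0[of g] by (metis rangeI)
  qed (auto simp flip: vmod.comb_add vmod.comb_scale)
  then show "vmod.span (range g) \<subseteq> range (lincomb g)"
    using vmod.comb_axis[of g] by (intro vmod.span_minimal) (auto, metis rangeI)
qed

lemma generator_count:
  fixes g :: "'i::finite \<Rightarrow> ('k::field, 'n::finite) der"
  assumes gens: "M = range (lincomb g)" and G: "min_homog_gens M G"
  shows "card G \<le> CARD('i)"
    and "(\<And>a i. lincomb g a = 0 \<Longrightarrow> const_term (a $ i) = 0) \<Longrightarrow> CARD('i) \<le> card G"
proof -
  have fin: "finite G" and span: "vmod.span G = M" using G by (auto simp: min_homog_gens_def)
  have 1: "\<exists>u. x = (\<Sum>j\<in>UNIV. u j *s g j)" if "x \<in> G" for x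
  proof -
    have "x \<in> M" using that span vmod.span_base by blast
    then obtain a where "x = lincomb g a" using gens by auto
    then show ?thesis unfolding comb_def by blast
  qed
  have 2: "\<exists>t. g j = (\<Sum>x\<in>G. t x *s x)" for j
  proof -
    have "g j \<in> vmod.span G" using span gens vmod.comb_axis[of g j] by (metis rangeI)
    then show ?thesis unfolding vmod.span_finite[OF fin] by auto
  qed
  show "card G \<le> CARD('i)"
    using minimal_generators_card_le[OF fin finite_class.finite_UNIV 1 2] min_homog_gens_relation[OF G] by simp
  assume *: "\<And>a i. lincomb g a = 0 \<Longrightarrow> const_term (a $ i) = 0"
  have "const_term (r i) = 0" if "(\<Sum>j\<in>UNIV. r j *s g j) = 0" for r i
    using *[of "\<chi> j. r j" i] that by (simp add: comb_def)
  then show "CARD('i) \<le> card G"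
    using minimal_generators_card_le[OF finite_class.finite_UNIV fin 2 1] by simp
qed

section \<open>Modules with two or three extra generators\<close>

lemma sum_UNIV_Plus:
  fixes f :: "'a::finite + 'b::finite \<Rightarrow> 'c::comm_monoid_add"
  shows "sum f UNIV = (\<Sum>i\<in>UNIV. f (Inl i)) + (\<Sum>j\<in>UNIV. f (Inr j))"
  by (subst UNIV_Plus_UNIV[symmetric], subst sum.Plus) auto

lemma sum_UNIV_bool_option:
  fixes f :: "bool option \<Rightarrow> 'c::comm_monoid_add"
  shows "sum f UNIV = f None + f (Some True) + f (Some False)"
  by (simp add: UNIV_option_conv UNIV_bool ac_simps)

lemma sum_UNIV_bool_prod:
  fixes f :: "bool \<times> bool \<Rightarrow> 'c::comm_monoid_add"
  shows "sum f UNIV = f (True, True) + f (True, False) + f (False, True) + f (False, False)"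
proof -
  have U: "(UNIV :: (bool \<times> bool) set) = {(True, True), (True, False), (False, True), (False, False)}"
    by auto
  show ?thesis unfolding U by (simp add: ac_simps)
qed

lemma vec_dvdI:
  fixes v :: "'r::comm_ring_1 ^ 'm"
  assumes "\<And>i. x dvd v $ i"
  obtains a where "v = x *s a"
proof -
  have "\<forall>i. \<exists>z. v $ i = x * z" using assms by (auto simp: dvd_def)
  from choice[OF this] obtain z where "\<And>i. v $ i = x * z i" by blast
  then have "v = x *s (\<chi> i. z i)" by (simp add: vec_eq_iff)
  then show ?thesis by (rule that)
qed

text \<open>A pair \<open>(f, g)\<close> with \<open>f u = g v\<close> modulo \<open>(x, y)\<close> is what an element of the intersection determines, up to multiples of
\<open>x\<close> in \<open>f\<close> and of \<open>y\<close> in \<open>g\<close>. Elements with the same pair differ by a vector divisible by \<open>x\<close> and by \<open>y\<close>. So the elements \<open>e j\<close>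
generate the intersection over \<open>x y S\<^sup>n\<close> as soon as their pairs \<open>(F j, G j)\<close> generate all pairs.\<close>

lemma intersection_generators:
  fixes x y :: "'r::comm_ring_1" and u v :: "'r ^ 'n" and e :: "'j::finite \<Rightarrow> 'r ^ 'n"
  assumes y_x: "\<And>f. y dvd x * f \<Longrightarrow> y dvd f"
    and A: "\<And>j. \<exists>a. e j = F j *s u + x *s a" and B: "\<And>j. \<exists>b. e j = G j *s v + y *s b"
    and Z: "\<And>f g. (\<And>i. f * u $ i - g * v $ i \<in> ideal {x, y}) \<Longrightarrow>
      \<exists>m. x dvd f - (\<Sum>j\<in>UNIV. m j * F j) \<and> y dvd g - (\<Sum>j\<in>UNIV. m j * G j)"
  shows "(\<exists>f a. c = f *s u + x *s a) \<and> (\<exists>g b. c = g *s v + y *s b) \<longleftrightarrow>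
    (\<exists>a m. c = (x * y) *s a + lincomb e m)"
proof -
  obtain A B where A: "\<And>j. e j = F j *s u + x *s A j" and B: "\<And>j. e j = G j *s v + y *s B j"
    using A B by metis
  have eA: "lincomb e m = (\<Sum>j\<in>UNIV. m $ j * F j) *s u + x *s lincomb A m" for m
    by (simp add: comb_def A vmod.scale_right_distrib sum.distrib vmod.scale_sum_left
        vmod.scale_sum_right mult.commute)
  have eB: "lincomb e m = (\<Sum>j\<in>UNIV. m $ j * G j) *s v + y *s lincomb B m" for m
    by (simp add: comb_def B vmod.scale_right_distrib sum.distrib vmod.scale_sum_left
        vmod.scale_sum_right mult.commute)
  show ?thesis
  proof
    assume "(\<exists>f a. c = f *s u + x *s a) \<and> (\<exists>g b. c = g *s v + y *s b)"
    then obtain f a g b where c: "c = f *s u + x *s a" "c = g *s v + y *s b" by blast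
    have "f * u $ i - g * v $ i = x * (- a $ i) + y * b $ i" for i
      using arg_cong[OF trans[OF c(1)[symmetric] c(2)], of "\<lambda>c. c $ i"] by (simp add: algebra_simps)
    then have "f * u $ i - g * v $ i \<in> ideal {x, y}" for i unfolding in_ideal_2 by blast
    then obtain m where "x dvd f - (\<Sum>j\<in>UNIV. m j * F j)" "y dvd g - (\<Sum>j\<in>UNIV. m j * G j)"
      using Z by blast
    then obtain s t where "f - (\<Sum>j\<in>UNIV. m j * F j) = x * s" "g - (\<Sum>j\<in>UNIV. m j * G j) = y * t"
      by (auto elim!: dvdE)
    then have fg: "f = x * s + (\<Sum>j\<in>UNIV. m j * F j)" "g = y * t + (\<Sum>j\<in>UNIV. m j * G j)"
      by (simp_all add: diff_eq_eq)
    define n where "n = (\<chi> j. m j)"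
    define z where "z = s *s u + a - lincomb A n"
    have c1: "c = x *s z + lincomb e n"
      by (simp add: c(1) eA z_def n_def fg vec_eq_iff algebra_simps)
    have c2: "c = y *s (t *s v + b - lincomb B n) + lincomb e n"
      by (simp add: c(2) eB n_def fg vec_eq_iff algebra_simps)
    have "y dvd z $ i" for i
    proof (rule y_x)
      have "x *s z = y *s (t *s v + b - lincomb B n)" using c1 c2 by (metis add_right_cancel)
      from arg_cong[OF this, of "\<lambda>c. c $ i"] show "y dvd x * z $ i" by simp
    qed
    then obtain z' where "z = y *s z'" by (rule vec_dvdI)
    then have "c = (x * y) *s z' + lincomb e n" using c1 by simp
    then show "\<exists>a m. c = (x * y) *s a + lincomb e m" by blast
  next
    assume "\<exists>a m. c = (x * y) *s a + lincomb e m"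
    then obtain a m where c: "c = (x * y) *s a + lincomb e m" by blast
    have "c = (\<Sum>j\<in>UNIV. m $ j * F j) *s u + x *s (y *s a + lincomb A m)"
      by (simp add: c eA vec_eq_iff algebra_simps)
    moreover have "c = (\<Sum>j\<in>UNIV. m $ j * G j) *s v + y *s (x *s a + lincomb B m)"
      by (simp add: c eB vec_eq_iff algebra_simps)
    ultimately show "(\<exists>f a. c = f *s u + x *s a) \<and> (\<exists>g b. c = g *s v + y *s b)" by blast
  qed
qed

text \<open>Division by \<open>d\<close> carries the generators \<open>d S\<^sup>n\<close> and \<open>e j\<close> of the coordinate module back to generators of \<open>D\<close>; the
basis \<open>\<theta>\<close> corresponds to \<open>d\<close> times the unit vectors.\<close>

lemma extra_generators:
  fixes \<theta> :: "'n::finite \<Rightarrow> ('k::field, 'n) der" and e :: "'j::finite \<Rightarrow> ('k, 'n) mpoly ^ 'n"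
  assumes inj: "\<And>c. lincomb \<theta> c = 0 \<Longrightarrow> c = 0" and d: "d \<noteq> 0"
    and D: "\<And>\<psi>. \<psi> \<in> D \<longleftrightarrow> (\<exists>c. lincomb \<theta> c = d *s \<psi>)"
    and N: "\<And>c. (\<exists>\<psi>. lincomb \<theta> c = d *s \<psi>) \<longleftrightarrow> (\<exists>a m. c = d *s a + lincomb e m)"
  obtains g :: "'n + 'j \<Rightarrow> ('k, 'n) der" where "D = range (lincomb g)"
    "\<And>c. lincomb g c = 0 \<longleftrightarrow> d *s (\<chi> i. c $ Inl i) + lincomb e (\<chi> j. c $ Inr j) = 0"
proof -
  have "\<exists>\<psi>. lincomb \<theta> (e j) = d *s \<psi>" for j
    unfolding N by (intro exI[of _ 0] exI[of _ "axis j 1"]) (simp add: vmod.comb_axis)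
  then obtain \<phi> where \<phi>: "\<And>j. lincomb \<theta> (e j) = d *s \<phi> j" by metis
  define g where "g = case_sum \<theta> \<phi>"
  have g: "lincomb g c = lincomb \<theta> (\<chi> i. c $ Inl i) + lincomb \<phi> (\<chi> j. c $ Inr j)" for c
    by (simp add: comb_def g_def sum_UNIV_Plus)
  define E where "E c = d *s (\<chi> i. c $ Inl i) + lincomb e (\<chi> j. c $ Inr j)" for c
  have E: "lincomb \<theta> (E c) = d *s lincomb g c" for c
  proof -
    have "lincomb \<theta> (lincomb e m) = lincomb (\<lambda>j. lincomb \<theta> (e j)) m" for m
      by (rule mod_hom_on_comb[OF module_vector_scalar_mult module_vector_scalar_mult vmod.subspace_UNIV
            vmod.comb_hom[OF vmod.subspace_UNIV]]) auto
    moreover have "lincomb (\<lambda>j. d *s \<phi> j) m = d *s lincomb \<phi> m" for m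
      by (simp add: comb_def vmod.scale_sum_right mult.commute)
    ultimately show ?thesis
      by (simp add: E_def g vmod.comb_add vmod.comb_scale \<phi> vmod.scale_right_distrib)
  qed
  have "\<psi> \<in> range (lincomb g)" if \<psi>: "\<psi> \<in> D" for \<psi>
  proof -
    obtain c where c: "lincomb \<theta> c = d *s \<psi>" using \<psi> D by blast
    then obtain a m where "c = d *s a + lincomb e m" using N by blast
    then have "c = E (\<chi> i. case i of Inl i \<Rightarrow> a $ i | Inr j \<Rightarrow> m $ j)" by (simp add: E_def)
    then have "d *s \<psi> = d *s lincomb g (\<chi> i. case i of Inl i \<Rightarrow> a $ i | Inr j \<Rightarrow> m $ j)" using c E by metis
    then have "\<psi> = lincomb g (\<chi> i. case i of Inl i \<Rightarrow> a $ i | Inr j \<Rightarrow> m $ j)"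
      using d smult_vec_cancel by blast
    then show ?thesis by blast
  qed
  moreover have "lincomb g c \<in> D" for c using D E by blast
  ultimately have "D = range (lincomb g)" by blast
  moreover have "lincomb g c = 0 \<longleftrightarrow> E c = 0" for c
    using inj[of "E c"] E[of c] d smult_vec_eq_0[of d "lincomb g c"] by (auto simp: vmod.comb_0)
  ultimately show ?thesis using that unfolding E_def by blast
qed

text \<open>Since \<open>y w = h (y U) + x y V\<close> and \<open>x (y U) = x y U\<close>, the generators \<open>y U\<close> and \<open>w\<close> each satisfy one relation over
\<open>x y S\<^sup>n\<close>. The hypotheses on \<open>U\<close> and \<open>w\<close> say that the coefficient of \<open>w\<close> in any relation is a multiple of \<open>y\<close>,
and that a relation without \<open>w\<close> has a multiple of \<open>x\<close> as coefficient of \<open>y U\<close>. So these two relations form a basis.\<close>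

lemma deletion_two_extra_generators:
  fixes \<theta> :: "'n::finite \<Rightarrow> ('k::field, 'n) der" and x y h :: "('k, 'n) mpoly"
  assumes inj: "\<And>c. lincomb \<theta> c = 0 \<Longrightarrow> c = 0" and x: "x \<noteq> 0" and y: "y \<noteq> 0"
    and D: "\<And>\<psi>. \<psi> \<in> D \<longleftrightarrow> (\<exists>c. lincomb \<theta> c = (x * y) *s \<psi>)"
    and N: "\<And>c. (\<exists>\<psi>. lincomb \<theta> c = (x * y) *s \<psi>) \<longleftrightarrow>
      (\<exists>a m. c = (x * y) *s a + lincomb (\<lambda>b. if b then y *s U else w) m)"
    and w: "w = h *s U + x *s V"
    and U: "\<And>l a. l *s U = x *s a \<Longrightarrow> x dvd l"
    and wy: "\<And>m a. m *s w = y *s a \<Longrightarrow> y dvd m"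
  obtains g :: "'n + bool \<Rightarrow> ('k, 'n) der"
  where "D = range (lincomb g)" "proj_dim (*s) D \<le> 1"
proof -
  have xy: "x * y \<noteq> 0" using x y mpoly_no_zero_divisors by blast
  have e: "lincomb (\<lambda>b. if b then y *s U else w) m = (m $ True * y) *s U + m $ False *s w" for m
    by (simp add: comb_def UNIV_bool add.commute)
  define E where "E a = (x * y) *s (\<chi> i. a $ Inl i) + (a $ Inr True * y) *s U + a $ Inr False *s w"
    for a :: "('k, 'n) mpoly ^ ('n + bool)"
  obtain g :: "'n + bool \<Rightarrow> ('k, 'n) der" where gen: "D = range (lincomb g)"
    and gE: "\<And>a. lincomb g a = 0 \<longleftrightarrow> E a = 0"
    using extra_generators[OF inj xy D N] by (auto simp: e E_def add.assoc)
  define K where "K b = (if b then (\<chi> j. case j of Inl i \<Rightarrow> - V $ i | Inr True \<Rightarrow> - h | Inr False \<Rightarrow> y)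
    else (\<chi> j. case j of Inl i \<Rightarrow> - U $ i | Inr True \<Rightarrow> x | Inr False \<Rightarrow> 0))" for b
  have comb_K: "lincomb K t = t $ True *s K True + t $ False *s K False" for t
    by (simp add: comb_def UNIV_bool)
  have K: "lincomb K t $ Inl i = - (t $ True * V $ i + t $ False * U $ i)"
    "lincomb K t $ Inr True = - (t $ True * h) + t $ False * x"
    "lincomb K t $ Inr False = t $ True * y" for t i
    by (simp_all add: comb_K K_def)
  have rel: "lincomb g a = 0 \<longleftrightarrow> (\<exists>t. a = lincomb K t)" for a
  proof
    assume "lincomb g a = 0"
    then have "E a = 0" using gE by simp
    define l m where "l = a $ Inr True" and "m = a $ Inr False"
    have e: "x * y * a $ Inl i + l * y * U $ i + m * w $ i = 0" for i
      using arg_cong[OF \<open>E a = 0\<close>, of "\<lambda>c. c $ i"] by (simp add: E_def l_def m_def)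
    have "m *s w = y *s (\<chi> i. - (x * a $ Inl i + l * U $ i))"
      using e by (simp add: vec_eq_iff algebra_simps eq_neg_iff_add_eq_0)
    then obtain m' where m': "m = y * m'" using wy by (meson dvdE)
    have e2: "x * a $ Inl i + l * U $ i + m' * w $ i = 0" for i
    proof -
      have "y * (x * a $ Inl i + l * U $ i + m' * w $ i) = y * 0"
        using e[of i] by (simp add: m' algebra_simps)
      then show ?thesis using y mpoly_mult_cancel by blast
    qed
    have "(l + m' * h) *s U = x *s (\<chi> i. - (a $ Inl i + m' * V $ i))"
      using e2 by (simp add: vec_eq_iff w algebra_simps eq_neg_iff_add_eq_0)
    then obtain k where k: "l + m' * h = x * k" using U by (meson dvdE)
    have "a $ Inl i + m' * V $ i + k * U $ i = 0" for i
    proof -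
      have "x * (a $ Inl i + m' * V $ i + k * U $ i) = x * a $ Inl i + x * m' * V $ i + (x * k) * U $ i"
        by (simp add: algebra_simps)
      also have "\<dots> = x * a $ Inl i + x * m' * V $ i + (l + m' * h) * U $ i"
        by (simp only: k)
      also have "\<dots> = x * 0" using e2[of i] by (simp add: w algebra_simps)
      finally show ?thesis using x mpoly_mult_cancel by blast
    qed
    then have "a $ Inl i = - (m' * V $ i + k * U $ i)" for i
      by (simp only: eq_neg_iff_add_eq_0 add.assoc)
    moreover have "l = - (m' * h) + k * x" using k by (simp add: algebra_simps eq_diff_eq)
    ultimately have "a $ Inl i = lincomb K (\<chi> b. if b then m' else k) $ Inl i"
      "a $ Inr b = lincomb K (\<chi> b. if b then m' else k) $ Inr b" for i b
      using l_def m_def m' by (cases b; simp add: K mult.commute)+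
    then have "a $ j = lincomb K (\<chi> b. if b then m' else k) $ j" for j
      by (cases j) auto
    then have "a = lincomb K (\<chi> b. if b then m' else k)" unfolding vec_eq_iff by blast
    then show "\<exists>t. a = lincomb K t" by blast
  next
    assume "\<exists>t. a = lincomb K t"
    then obtain t where a: "a = lincomb K t" by blast
    show "lincomb g a = 0"
      unfolding gE by (simp add: E_def a K vec_eq_iff w algebra_simps)
  qed
  have free: "t = 0" if t: "lincomb K t = 0" for t
  proof -
    have "t $ True * y = 0" using K(3)[of t] t by simp
    then have T: "t $ True = 0" using y mpoly_no_zero_divisors by blast
    have "t $ False * x = 0" using K(2)[of t] t T by simp
    then have "t $ False = 0" using x mpoly_no_zero_divisors by blast
    then have "t $ b = 0" for b using T by (cases b) auto
    then show ?thesis by (simp add: vec_eq_iff)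
  qed
  have "proj_dim (*s) D \<le> 1"
    by (rule proj_dim_le_1I[OF module_vector_scalar_mult gen rel free])
  then show ?thesis using that gen by blast
qed

text \<open>Every relation has \<open>n = x t + y s\<close> as coefficient of \<open>w\<close> because \<open>q\<close> is regular modulo \<open>(x, y)\<close>; reducing modulo \<open>x\<close>
and modulo \<open>y\<close> then determines the coefficients of \<open>y u\<close> and \<open>x v\<close> up to multiples \<open>x k\<close> and \<open>y k'\<close>.
So \<open>(s, t, k, k')\<close> parametrizes the relations, with kernel generated by \<open>(x, -y, q, -p)\<close>.\<close>

lemma deletion_three_extra_generators:
  fixes \<theta> :: "'n::finite \<Rightarrow> ('k::field, 'n) der" and x y p q :: "('k, 'n) mpoly"
  assumes inj: "\<And>c. lincomb \<theta> c = 0 \<Longrightarrow> c = 0" and x: "x \<noteq> 0" and y: "y \<noteq> 0"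
    and D: "\<And>\<psi>. \<psi> \<in> D \<longleftrightarrow> (\<exists>c. lincomb \<theta> c = (x * y) *s \<psi>)" and subD: "vmod.subspace D"
    and N: "\<And>c. (\<exists>\<psi>. lincomb \<theta> c = (x * y) *s \<psi>) \<longleftrightarrow>
      (\<exists>a m. c = (x * y) *s a + lincomb
        (\<lambda>j. case j of Some True \<Rightarrow> y *s u | Some False \<Rightarrow> x *s v | None \<Rightarrow> w) m)"
    and w1: "w = q *s u + x *s a" and w2: "w = p *s v + y *s b"
    and u: "\<And>l a. l *s u = x *s a \<Longrightarrow> x dvd l"
    and v: "\<And>m a. m *s v = y *s a \<Longrightarrow> y dvd m"
    and xy_coprime: "\<And>f. x dvd y * f \<Longrightarrow> x dvd f" "\<And>f. y dvd x * f \<Longrightarrow> y dvd f"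
    and q: "\<And>f. f * q \<in> ideal {x, y} \<Longrightarrow> f \<in> ideal {x, y}"
    and const_term: "const_term x = 0" "const_term y = 0" "const_term p = 0" "const_term q = 0"
      "\<And>i. const_term (u $ i) = 0" "\<And>i. const_term (v $ i) = 0" "\<And>i. const_term (a $ i) = 0" "\<And>i. const_term (b $ i) = 0"
  obtains g :: "'n + bool option \<Rightarrow> ('k, 'n) der"
  where "D = range (lincomb g)" "\<And>a i. lincomb g a = 0 \<Longrightarrow> const_term (a $ i) = 0" "\<not> proj_dim (*s) D \<le> 1"
proof -
  have xy: "x * y \<noteq> 0" using x y mpoly_no_zero_divisors by blast
  have e: "lincomb (\<lambda>j. case j of Some True \<Rightarrow> y *s u | Some False \<Rightarrow> x *s v | None \<Rightarrow> w) m
    = (m $ Some True * y) *s u + (m $ Some False * x) *s v + m $ None *s w" for m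
    by (simp add: comb_def sum_UNIV_bool_option ac_simps)
  define E where "E a = (x * y) *s (\<chi> i. a $ Inl i) + (a $ Inr (Some True) * y) *s u
    + (a $ Inr (Some False) * x) *s v + a $ Inr None *s w"
    for a :: "('k, 'n) mpoly ^ ('n + bool option)"
  obtain g :: "'n + bool option \<Rightarrow> ('k, 'n) der" where gen: "D = range (lincomb g)"
    and gE: "\<And>a. lincomb g a = 0 \<longleftrightarrow> E a = 0"
    using extra_generators[OF inj xy D N] by (auto simp: e E_def add.assoc)
  define K where "K j = (case j of
      (True, True) \<Rightarrow> (\<chi> j. case j of Inl i \<Rightarrow> - a $ i | Inr (Some True) \<Rightarrow> - q | Inr (Some False) \<Rightarrow> 0 | Inr None \<Rightarrow> y)
    | (True, False) \<Rightarrow> (\<chi> j. case j of Inl i \<Rightarrow> - b $ i | Inr (Some True) \<Rightarrow> 0 | Inr (Some False) \<Rightarrow> - p | Inr None \<Rightarrow> x)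
    | (False, True) \<Rightarrow> (\<chi> j. case j of Inl i \<Rightarrow> - u $ i | Inr (Some True) \<Rightarrow> x | Inr (Some False) \<Rightarrow> 0 | Inr None \<Rightarrow> 0)
    | (False, False) \<Rightarrow> (\<chi> j. case j of Inl i \<Rightarrow> - v $ i | Inr (Some True) \<Rightarrow> 0 | Inr (Some False) \<Rightarrow> y | Inr None \<Rightarrow> 0))"
    for j :: "bool \<times> bool"
  have comb_K: "lincomb K t = t $ (True, True) *s K (True, True) + t $ (True, False) *s K (True, False)
    + t $ (False, True) *s K (False, True) + t $ (False, False) *s K (False, False)" for t
    by (simp add: comb_def sum_UNIV_bool_prod)
  have K: "lincomb K t $ Inl i = - (t $ (True, True) * a $ i + t $ (True, False) * b $ i
      + t $ (False, True) * u $ i + t $ (False, False) * v $ i)"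
    "lincomb K t $ Inr (Some True) = - (t $ (True, True) * q) + t $ (False, True) * x"
    "lincomb K t $ Inr (Some False) = - (t $ (True, False) * p) + t $ (False, False) * y"
    "lincomb K t $ Inr None = t $ (True, True) * y + t $ (True, False) * x" for t i
    by (simp_all add: comb_K K_def)
  have rel: "lincomb g c = 0 \<longleftrightarrow> (\<exists>t. c = lincomb K t)" for c
  proof
    assume "lincomb g c = 0"
    then have "E c = 0" using gE by simp
    define l m n where "l = c $ Inr (Some True)" and "m = c $ Inr (Some False)" and "n = c $ Inr None"
    have e: "x * y * c $ Inl i + l * y * u $ i + m * x * v $ i + n * w $ i = 0" for i
      using arg_cong[OF \<open>E c = 0\<close>, of "\<lambda>c. c $ i"] by (simp add: E_def l_def m_def n_def)
    have "(l * y + n * q) *s u = x *s (\<chi> i. - (y * c $ Inl i + m * v $ i + n * a $ i))"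
      using e by (simp add: vec_eq_iff w1 algebra_simps eq_neg_iff_add_eq_0)
    then obtain m1 where m1: "l * y + n * q = x * m1" using u by (meson dvdE)
    have "n * q = x * m1 + y * (- l)" using m1 by (simp add: algebra_simps eq_diff_eq)
    then have "n * q \<in> ideal {x, y}" unfolding in_ideal_2 by blast
    then have "n \<in> ideal {x, y}" by (rule q)
    then obtain t s where n: "n = x * t + y * s" unfolding in_ideal_2 by blast
    have "y * (l + q * s) = x * (m1 - t * q)"
      using m1 by (simp add: n algebra_simps eq_diff_eq)
    then have "x dvd l + q * s" using xy_coprime(1) by (metis dvd_triv_left)
    then obtain k where "l + q * s = x * k" by (rule dvdE)
    then have l: "l = x * k - q * s" by (simp add: eq_diff_eq)
    have "(m * x + n * p) *s v = y *s (\<chi> i. - (x * c $ Inl i + l * u $ i + n * b $ i))"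
      using e by (simp add: vec_eq_iff w2 algebra_simps eq_neg_iff_add_eq_0)
    then obtain m2 where m2: "m * x + n * p = y * m2" using v by (meson dvdE)
    have "x * (m + t * p) = y * (m2 - s * p)"
      using m2 by (simp add: n algebra_simps eq_diff_eq)
    then have "y dvd m + t * p" using xy_coprime(2) by (metis dvd_triv_left)
    then obtain k' where "m + t * p = y * k'" by (rule dvdE)
    then have m: "m = y * k' - t * p" by (simp add: eq_diff_eq)
    have "c $ Inl i = - (s * a $ i + t * b $ i + k * u $ i + k' * v $ i)" for i
    proof -
      have "n * w $ i = x * t * (p * v $ i + y * b $ i) + y * s * (q * u $ i + x * a $ i)"
      proof -
        have "n * w $ i = x * t * w $ i + y * s * w $ i" by (simp add: n algebra_simps)
        moreover have "w $ i = p * v $ i + y * b $ i" by (simp add: w2)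
        moreover have "w $ i = q * u $ i + x * a $ i" by (simp add: w1)
        ultimately show ?thesis by metis
      qed
      then have "(x * y) * (c $ Inl i + (s * a $ i + t * b $ i + k * u $ i + k' * v $ i)) = (x * y) * 0"
        using e[of i] by (simp add: l m algebra_simps)
      then have "c $ Inl i + (s * a $ i + t * b $ i + k * u $ i + k' * v $ i) = 0"
        using xy mpoly_mult_cancel by blast
      then show ?thesis by (simp only: eq_neg_iff_add_eq_0)
    qed
    then have "c $ Inl i = lincomb K (\<chi> j. case j of (True, True) \<Rightarrow> s | (True, False) \<Rightarrow> t
      | (False, True) \<Rightarrow> k | (False, False) \<Rightarrow> k') $ Inl i" for i
      by (simp add: K)
    moreover have "c $ Inr j = lincomb K (\<chi> j. case j of (True, True) \<Rightarrow> s | (True, False) \<Rightarrow> t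
      | (False, True) \<Rightarrow> k | (False, False) \<Rightarrow> k') $ Inr j" for j
    proof -
      consider "j = Some True" | "j = Some False" | "j = None" by (cases j) auto
      then show ?thesis
        by cases (auto simp: K l m n algebra_simps simp flip: l_def m_def n_def)
    qed
    ultimately have "c $ j = lincomb K (\<chi> j. case j of (True, True) \<Rightarrow> s | (True, False) \<Rightarrow> t
      | (False, True) \<Rightarrow> k | (False, False) \<Rightarrow> k') $ j" for j
      by (cases j) auto
    then have "c = lincomb K (\<chi> j. case j of (True, True) \<Rightarrow> s | (True, False) \<Rightarrow> t
      | (False, True) \<Rightarrow> k | (False, False) \<Rightarrow> k')"
      unfolding vec_eq_iff by blast
    then show "\<exists>t. c = lincomb K t" by blast
  next
    assume "\<exists>t. c = lincomb K t"
    then obtain t where c: "c = lincomb K t" by blast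
    have "E c $ i = 0" for i
    proof -
      have "t $ (True, True) * y * w $ i = t $ (True, True) * y * (q * u $ i + x * a $ i)" by (simp add: w1)
      moreover have "t $ (True, False) * x * w $ i = t $ (True, False) * x * (p * v $ i + y * b $ i)" by (simp add: w2)
      ultimately show ?thesis
        by (simp add: E_def c K algebra_simps)
    qed
    then show "lincomb g c = 0" unfolding gE by (simp add: vec_eq_iff)
  qed
  have minimal: "const_term (c $ j) = 0" if gc: "lincomb g c = 0" for c j
  proof -
    obtain t where c: "c = lincomb K t" using gc rel by blast
    have "const_term (c $ Inr j) = 0" for j
    proof -
      consider "j = Some True" | "j = Some False" | "j = None" by (cases j) auto
      then show ?thesis by cases (auto simp: c K const_term)
    qed
    moreover have "const_term (c $ Inl i) = 0" for i by (simp add: c K const_term)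
    ultimately show ?thesis by (cases j) auto
  qed
  define z where "z = (\<chi> j. case j of (True, True) \<Rightarrow> x | (True, False) \<Rightarrow> - y
      | (False, True) \<Rightarrow> q | (False, False) \<Rightarrow> - p)"
  have z: "z $ (True, True) = x" "z $ (True, False) = - y" "z $ (False, True) = q" "z $ (False, False) = - p"
    by (simp_all add: z_def)
  have zK: "lincomb K z = 0"
  proof -
    have "lincomb K z $ Inl i = 0" for i
    proof -
      have "q * u $ i + x * a $ i = p * v $ i + y * b $ i"
        using arg_cong[OF trans[OF w1[symmetric] w2], of "\<lambda>c. c $ i"] by simp
      then show ?thesis by (simp add: K z algebra_simps)
    qed
    moreover have "lincomb K z $ Inr j = 0" for j
    proof -
      consider "j = Some True" | "j = Some False" | "j = None" by (cases j) auto
      then show ?thesis by cases (auto simp: K z algebra_simps)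
    qed
    ultimately have "lincomb K z $ j = 0" for j by (cases j) auto
    then show ?thesis by (simp add: vec_eq_iff)
  qed
  have rel2: "lincomb K t = 0 \<longleftrightarrow> (\<exists>r. t = r *s z)" for t
  proof
    assume t: "lincomb K t = 0"
    have e: "t $ (True, True) * y + t $ (True, False) * x = 0"
      "- (t $ (True, True) * q) + t $ (False, True) * x = 0"
      "- (t $ (True, False) * p) + t $ (False, False) * y = 0"
      using K(2-4)[of t] t by auto
    have "y * t $ (True, True) = x * (- t $ (True, False))"
      using e(1) by (simp add: algebra_simps eq_neg_iff_add_eq_0)
    then obtain r where r: "t $ (True, True) = x * r" using xy_coprime(1) by (metis dvdE dvd_triv_left)
    have "x * t $ (True, False) = x * (- y * r)"
      using e(1) by (simp add: r algebra_simps eq_neg_iff_add_eq_0)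
    then have r2: "t $ (True, False) = - y * r" using x mpoly_mult_cancel by blast
    have "x * t $ (False, True) = x * (r * q)" using e(2) by (simp add: r algebra_simps)
    then have r3: "t $ (False, True) = r * q" using x mpoly_mult_cancel by blast
    have "y * t $ (False, False) = y * (- r * p)"
      using e(3) by (simp add: r2 algebra_simps eq_neg_iff_add_eq_0)
    then have r4: "t $ (False, False) = - r * p" using y mpoly_mult_cancel by blast
    have "t $ (i, j) = (r *s z) $ (i, j)" for i j
      by (cases i; cases j) (simp_all add: z r r2 r3 r4 mult.commute)
    then show "\<exists>r. t = r *s z" by (auto simp: vec_eq_iff)
  next
    assume "\<exists>r. t = r *s z"
    then show "lincomb K t = 0" using zK by (auto simp: vmod.comb_scale)
  qed
  have zreg: "r = 0" if "r *s z = 0" for r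
  proof -
    have "z \<noteq> 0" using x z(1) by auto
    then show ?thesis using that smult_vec_eq_0 by blast
  qed
  have "\<not> proj_dim (*s) D \<le> 1"
  proof
    assume pd: "proj_dim (*s) D \<le> 1"
    have "\<exists>h. (\<Sum>j\<in>UNIV. h j * z $ j) = 1"
    proof (rule proj_dim_le_1_imp_second_syzygy_unimodular[OF module_vector_scalar_mult subD pd _ _ rel rel2 zreg])
      show "g i \<in> D" for i unfolding gen using vmod.comb_axis[of g i] by (metis rangeI)
      show "\<exists>a. m = lincomb g a" if "m \<in> D" for m using that gen by blast
    qed
    then obtain h where h: "(\<Sum>j\<in>UNIV. h j * z $ j) = 1" by blast
    have "const_term (\<Sum>j\<in>UNIV. h j * z $ j) = 0"
      by (simp add: sum_UNIV_bool_prod z const_term)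
    then show False unfolding h by simp
  qed
  then show ?thesis using that gen minimal by blast
qed

section \<open>Logarithmic derivations and the deletion of one hyperplane\<close>

lemma der_apply_add: "der_apply (\<theta> + \<eta>) f = der_apply \<theta> f + der_apply \<eta> f"
  and der_apply_smult: "der_apply (c *s \<theta>) f = c * der_apply \<theta> f"
  by (simp_all add: der_apply_def distrib_right sum.distrib sum_distrib_left mult.assoc)

lemma der_apply_diff: "der_apply (\<theta> - \<eta>) f = der_apply \<theta> f - der_apply \<eta> f"
  by (simp add: der_apply_def left_diff_distrib sum_subtractf)

lemma der_apply_lin_comb:
  "der_apply \<theta> (lin (s *s a + t *s b)) = const_poly s * der_apply \<theta> (lin a) + const_poly t * der_apply \<theta> (lin b)"
  by (simp add: der_apply_lin const_poly_add const_poly_mult distrib_left sum.distrib sum_distrib_left ac_simps)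

definition const_der :: "'k::field ^ 'n::finite \<Rightarrow> ('k, 'n) der" where
  "const_der w = (\<chi> i. const_poly (w $ i))"

lemma const_poly_sum: "const_poly (sum f I) = (\<Sum>i\<in>I. const_poly (f i))"
  by (induction I rule: infinite_finite_induct) (auto simp: const_poly_add)

lemma der_apply_const_der: "der_apply (const_der w) (lin a) = const_poly (dot a w)"
  by (simp add: der_apply_lin const_der_def const_poly_sum const_poly_mult mult.commute)

lemma dual_vector:
  fixes a b :: "'k::field ^ 'n::finite"
  assumes a: "a \<noteq> 0" and ab: "\<And>c. b \<noteq> c *s a"
  obtains w where "dot a w = s" "dot b w = t"
proof -
  obtain i where i: "a $ i \<noteq> 0" using a by (auto simp: vec_eq_iff)
  obtain j where j: "b $ j \<noteq> ((b $ i / a $ i) *s a) $ j" using ab[of "b $ i / a $ i"] by (auto simp: vec_eq_iff)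
  define D where "D = a $ i * b $ j - a $ j * b $ i"
  have D: "D \<noteq> 0" using i j by (simp add: D_def field_simps)
  define w where "w = (\<chi> k. (if k = i then (s * b $ j - t * a $ j) / D else 0) + (if k = j then (t * a $ i - s * b $ i) / D else 0))"
  have sum: "(\<Sum>k\<in>UNIV. c $ k * w $ k) = (c $ i * (s * b $ j - t * a $ j) + c $ j * (t * a $ i - s * b $ i)) / D" for c
  proof -
    have "(\<Sum>k\<in>UNIV. c $ k * w $ k) = (\<Sum>k\<in>UNIV. (if k = i then c $ k * ((s * b $ j - t * a $ j) / D) else 0)
      + (if k = j then c $ k * ((t * a $ i - s * b $ i) / D) else 0))"
      by (rule sum.cong) (auto simp: w_def distrib_left)
    then show ?thesis by (simp add: sum.distrib add_divide_distrib)
  qed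
  have "a $ i * (s * b $ j - t * a $ j) + a $ j * (t * a $ i - s * b $ i) = s * D"
    "b $ i * (s * b $ j - t * a $ j) + b $ j * (t * a $ i - s * b $ i) = t * D"
    by (simp_all add: D_def algebra_simps)
  then show ?thesis using that[of w] D by (simp add: sum)
qed

lemma dual_vector_single:
  fixes a :: "'k::field ^ 'n::finite"
  assumes a: "a \<noteq> 0"
  obtains w where "dot a w = 1"
proof -
  obtain j where j: "a $ j \<noteq> 0" using a by (auto simp: vec_eq_iff)
  have "(\<Sum>k\<in>UNIV. a $ k * (\<chi> k. if k = j then 1 / a $ j else 0) $ k) = (\<Sum>k\<in>UNIV. if k = j then 1 else 0)"
    by (rule sum.cong) (auto simp: j)
  also have "\<dots> = 1" by simp
  finally show ?thesis by (rule that)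
qed

text \<open>Normal vectors of pairwise distinct hyperplanes.\<close>

definition noncollinear :: "('k::field ^ 'n::finite) set \<Rightarrow> bool" where
  "noncollinear W \<longleftrightarrow> 0 \<notin> W \<and> (\<forall>a\<in>W. \<forall>b\<in>W. a \<noteq> b \<longrightarrow> (\<forall>c. b \<noteq> c *s a))"

definition log_der_of :: "('k::field ^ 'n::finite) set \<Rightarrow> ('k, 'n) der set" where
  "log_der_of W = {\<theta>. \<forall>a\<in>W. lin a dvd der_apply \<theta> (lin a)}"

lemma log_der_of_subspace: "vmod.subspace (log_der_of W)"
  by (rule vmod.subspaceI) (auto simp: log_der_of_def der_apply_add der_apply_smult der_apply_def[of 0])

lemma prime_ideal_lin1: "prime_ideal (ideal {lin a} :: ('k::field, 'n::finite) mpoly set)"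
  using prime_ideal_lin[of "{a}"] by simp

lemma prime_ideal_lin2: "prime_ideal (ideal {lin a, lin b} :: ('k::field, 'n::finite) mpoly set)"
  using prime_ideal_lin[of "{a, b}"] by simp

lemma prime_ideal_lin3: "prime_ideal (ideal {lin a, lin b, lin c} :: ('k::field, 'n::finite) mpoly set)"
  using prime_ideal_lin[of "{a, b, c}"] by simp

lemma lin_prime_dvd: "lin a dvd f * g \<Longrightarrow> lin a dvd f \<or> lin a dvd g" for f g :: "('k::field, 'n::finite) mpoly"
  using prime_idealD(1)[OF prime_ideal_lin1[of a], of f g] by (simp add: in_ideal_1)

lemma lin_dvd_lin:
  assumes "lin a dvd lin b"
  obtains c where "b = c *s a"
proof -
  obtain k where "lin b = lin a * k" using assms by (rule dvdE)
  from arg_cong[OF this, of linear_coeffs] have "b = const_term k *s a" by simp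
  then show ?thesis by (rule that)
qed

lemma lin_in_ideal2:
  assumes "lin l \<in> ideal {lin a, lin b}"
  obtains s t where "l = s *s a + t *s b"
proof -
  obtain k m where "lin l = lin a * k + lin b * m" using assms unfolding in_ideal_2 by blast
  from arg_cong[OF this, of linear_coeffs] have "l = const_term k *s a + const_term m *s b" by simp
  then show ?thesis by (rule that)
qed

lemma noncollinear_not_dvd:
  assumes "noncollinear W" "a \<in> W" "b \<in> W" "a \<noteq> b"
  shows "\<not> lin a dvd lin b"
  using assms unfolding noncollinear_def by (metis lin_dvd_lin)

lemma noncollinear_subset: "noncollinear W \<Longrightarrow> V \<subseteq> W \<Longrightarrow> noncollinear V"
  unfolding noncollinear_def by blast

lemma prod_lin_not_dvd:
  assumes "finite V" "\<And>b. b \<in> V \<Longrightarrow> \<not> lin a dvd lin b"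
  shows "\<not> lin a dvd (\<Prod>b\<in>V. lin b :: ('k::field, 'n::finite) mpoly)"
  using assms
proof (induction V rule: finite_induct)
  case empty
  show ?case using prime_idealD(2)[OF prime_ideal_lin1[of a]] by (simp add: in_ideal_1)
next
  case (insert b V)
  then have "\<not> lin a dvd lin b" "\<not> lin a dvd (\<Prod>b\<in>V. lin b :: ('k, 'n) mpoly)" by simp_all
  then show ?case using insert.hyps lin_prime_dvd[of a "lin b" "\<Prod>b\<in>V. lin b"] by simp metis
qed

lemma prod_lin_dvd:
  fixes G :: "('k::field, 'n::finite) mpoly"
  assumes "finite V" "noncollinear V" "\<And>b. b \<in> V \<Longrightarrow> lin b dvd G"
  shows "(\<Prod>b\<in>V. lin b) dvd G"
  using assms
proof (induction V rule: finite_induct)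
  case (insert b V)
  have "(\<Prod>b\<in>V. lin b) dvd G" using insert noncollinear_subset[of "insert b V" V] by auto
  then obtain k where k: "G = (\<Prod>b\<in>V. lin b) * k" by (rule dvdE)
  have "\<not> lin b dvd (\<Prod>b\<in>V. lin b)"
    using insert noncollinear_not_dvd[of "insert b V" b] by (intro prod_lin_not_dvd) auto
  moreover have "lin b dvd (\<Prod>b\<in>V. lin b) * k" using insert.prems k by auto
  ultimately have "lin b dvd k" using lin_prime_dvd by blast
  then show ?case using insert k by (simp add: mult.commute mult_dvd_mono)
qed simp

lemma log_der_of_smult:
  assumes "lin a *s \<psi> \<in> log_der_of W" "noncollinear W" "a \<in> W"
  shows "\<psi> \<in> log_der_of (W - {a})"
  unfolding log_der_of_def
proof (rule CollectI, rule ballI)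
  fix b assume "b \<in> W - {a}"
  then have b: "b \<in> W" "b \<noteq> a" by auto
  have "lin b dvd lin a * der_apply \<psi> (lin b)"
    using assms(1) b by (auto simp: log_der_of_def der_apply_smult)
  then show "lin b dvd der_apply \<psi> (lin b)"
    using lin_prime_dvd noncollinear_not_dvd[OF assms(2) b(1) assms(3) b(2)] by blast
qed

lemma smult_log_der_of:
  assumes "\<psi> \<in> log_der_of (W - {a})"
  shows "lin a *s \<psi> \<in> log_der_of W"
proof -
  have "lin b dvd der_apply (lin a *s \<psi>) (lin b)" if "b \<in> W" for b
    using assms that by (cases "b = a") (auto simp: der_apply_smult log_der_of_def)
  then show ?thesis by (simp add: log_der_of_def)
qed

lemma log_der_of_insert:
  assumes "\<psi> \<in> log_der_of (W - {a})" "lin a dvd der_apply \<psi> (lin a)"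
  shows "\<psi> \<in> log_der_of W"
  using assms unfolding log_der_of_def by blast

lemma prod_smult_log_der_of: "finite W \<Longrightarrow> (\<Prod>b\<in>W. lin b) *s \<psi> \<in> log_der_of W"
  by (auto simp: log_der_of_def der_apply_smult intro: dvd_mult2 dvd_prodI)

text \<open>The module contains \<open>Q \<partial>\<^sub>i\<close> for the product \<open>Q\<close> of all forms, so it has full rank.\<close>

lemma log_der_of_basis:
  fixes W :: "('k::field ^ 'n::finite) set"
  assumes "finite W" "noncollinear W" "free_mod (*s) (log_der_of W)"
  obtains \<theta> :: "'n \<Rightarrow> ('k, 'n) der"
  where "log_der_of W = range (lincomb \<theta>)" "\<And>c. lincomb \<theta> c = 0 \<Longrightarrow> c = 0"
proof -
  have "(\<Prod>b\<in>V. lin b) \<noteq> (0 :: ('k, 'n) mpoly)" if "finite V" "0 \<notin> V" for V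
    using that
  proof (induction V rule: finite_induct)
    case (insert b V)
    then show ?case using mpoly_no_zero_divisors[of "lin b" "\<Prod>b\<in>V. lin b"] by auto
  qed simp
  then have "(\<Prod>b\<in>W. lin b) \<noteq> (0 :: ('k, 'n) mpoly)" using assms by (simp add: noncollinear_def)
  then show ?thesis
    using free_full_rank_basis[OF assms(3)] prod_smult_log_der_of[OF assms(1)] that by blast
qed

lemma prod_list_map_remove1:
  "b \<in> set vs \<Longrightarrow> prod_list (map f vs) = f b * prod_list (map f (remove1 b vs))"
  for f :: "'a \<Rightarrow> 'b::comm_monoid_mult"
  by (induction vs) (auto simp: ac_simps)

text \<open>A derivation \<open>\<psi>\<close> of the deletion is determined modulo \<open>D(\<A>)\<close> by the residue of \<open>\<psi>(x)\<close> modulo \<open>x\<close>, where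
\<open>x\<close> is the deleted form. Among the derivations for which this residue is a product of linear forms (such as
\<open>Q \<partial>\<close> with \<open>\<partial> x = 1\<close>) choose \<open>\<phi>\<close> with the fewest factors. The derivation \<open>\<psi>(x) \<phi> - \<phi>(x) \<psi>\<close> lies in \<open>D(\<A>)\<close>.
In coordinates this says that the product divides \<open>\<psi>(x) u\<close> modulo \<open>x\<close>, where \<open>u\<close> represents \<open>x \<phi>\<close>, and
no factor divides \<open>u\<close>, since it could be divided out of \<open>\<phi>\<close>. Hence the product divides \<open>\<psi>(x)\<close>.\<close>

lemma single_deletion_generator:
  fixes W :: "('k::field ^ 'n::finite) set"
  assumes fin: "finite W" and W: "noncollinear W" and a: "a \<in> W"
    and \<theta>: "log_der_of W = range (lincomb \<theta>)" "\<And>c. lincomb \<theta> c = 0 \<Longrightarrow> c = 0"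
  obtains \<phi> where "\<phi> \<in> log_der_of (W - {a})" "\<not> lin a dvd der_apply \<phi> (lin a)"
    "\<And>\<psi>. \<psi> \<in> log_der_of (W - {a}) \<Longrightarrow> \<exists>f c. \<psi> = f *s \<phi> + lincomb \<theta> c"
proof -
  let ?x = "lin a" and ?D = "log_der_of (W - {a})"
  note subD = log_der_of_subspace[of "W - {a}"]
  have a0: "a \<noteq> 0" using W a by (auto simp: noncollinear_def)
  have DW: "\<psi> \<in> ?D" if "\<psi> \<in> log_der_of W" for \<psi> using that by (auto simp: log_der_of_def)
  define Q where "Q n \<longleftrightarrow> (\<exists>\<phi> vs. \<phi> \<in> ?D \<and> set vs \<subseteq> W - {a} \<and>
    ?x dvd der_apply \<phi> ?x - prod_list (map lin vs) \<and> length vs = n)" for n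
  have "\<exists>n. Q n"
  proof -
    obtain w where w: "dot a w = 1" using dual_vector_single[OF a0] by blast
    obtain vs where vs: "set vs = W - {a}" "distinct vs" using finite_distinct_list fin by (metis finite_Diff)
    let ?\<phi> = "(\<Prod>b\<in>W - {a}. lin b) *s const_der w"
    have "?\<phi> \<in> ?D" using prod_smult_log_der_of fin by blast
    moreover have "der_apply ?\<phi> ?x - prod_list (map lin vs) = 0"
      using prod.distinct_set_conv_list[OF vs(2), of lin] vs(1) w by (simp add: der_apply_smult der_apply_const_der)
    ultimately show ?thesis unfolding Q_def using vs(1) by (metis dvd_0_right order_refl)
  qed
  then obtain n where "Q n" and min: "\<And>m. m < n \<Longrightarrow> \<not> Q m" using exists_least_iff[of Q] by blast
  then obtain \<phi> vs where \<phi>: "\<phi> \<in> ?D" and vs: "set vs \<subseteq> W - {a}" "length vs = n"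
    and \<phi>x: "?x dvd der_apply \<phi> ?x - prod_list (map lin vs)" unfolding Q_def by blast
  let ?L = "map lin vs :: ('k, 'n) mpoly list"
  have lL: "l \<notin> ideal {?x}" "prime_ideal (ideal {l, ?x})" if "l \<in> set ?L" for l
    using that vs noncollinear_not_dvd[OF W a] prime_ideal_lin2 by (auto simp: in_ideal_1)
  have not_dvd: "\<not> ?x dvd der_apply \<phi> ?x"
  proof
    assume "?x dvd der_apply \<phi> ?x"
    then have "?x dvd prod_list ?L" using \<phi>x by (metis dvd_diff_right_iff)
    then show False using prod_list_notin_prime[OF prime_ideal_lin1[of a], of ?L] lL(1) by (simp add: in_ideal_1)
  qed
  obtain u where u: "lincomb \<theta> u = ?x *s \<phi>"
    using smult_log_der_of[OF \<phi>] \<theta>(1) by (metis imageE)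
  have u_not: "\<exists>i. u $ i \<notin> ideal {l, ?x}" if l: "l \<in> set ?L" for l
  proof (rule ccontr)
    assume "\<not> (\<exists>i. u $ i \<notin> ideal {l, ?x})"
    then have "\<forall>i. \<exists>k m. u $ i = l * k + ?x * m" by (simp add: in_ideal_2)
    from choice[OF this] obtain k where "\<forall>i. \<exists>m. u $ i = l * k i + ?x * m" by blast
    from choice[OF this] obtain m where "\<And>i. u $ i = l * k i + ?x * m i" by blast
    then have ukm: "u = l *s (\<chi> i. k i) + ?x *s (\<chi> i. m i)" by (simp add: vec_eq_iff)
    let ?k = "lincomb \<theta> (\<chi> i. k i)" and ?m = "lincomb \<theta> (\<chi> i. m i)"
    have e: "?x *s \<phi> = l *s ?k + ?x *s ?m"
      using u unfolding ukm by (simp add: vmod.comb_add vmod.comb_scale)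
    have "?x dvd ?k $ i" for i
    proof -
      have "l * ?k $ i = ?x * (\<phi> $ i - ?m $ i)"
        using arg_cong[OF e, of "\<lambda>v. v $ i"] by (simp add: algebra_simps)
      then have "?x dvd l * ?k $ i" by simp
      then show ?thesis using lin_prime_dvd lL(1)[OF l] by (auto simp: in_ideal_1)
    qed
    then have "\<forall>i. \<exists>z. ?k $ i = ?x * z" by (auto simp: dvd_def)
    from choice[OF this] obtain z where "\<And>i. ?k $ i = ?x * z i" by blast
    then have z: "?k = ?x *s (\<chi> i. z i)" by (simp add: vec_eq_iff)
    let ?\<phi> = "\<chi> i. z i"
    have "?x *s ?\<phi> \<in> log_der_of W" using \<theta>(1) z by (metis rangeI)
    then have \<phi>': "?\<phi> \<in> ?D" using log_der_of_smult W a by blast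
    have "?x *s \<phi> = ?x *s (l *s ?\<phi> + ?m)"
      unfolding e z by (simp add: vmod.scale_right_distrib mult.commute)
    then have \<phi>eq: "\<phi> = l *s ?\<phi> + ?m" using smult_vec_cancel a0 by (metis lin_eq_0_iff)
    obtain b where b: "b \<in> set vs" "l = lin b" using l by auto
    have "?x dvd der_apply ?m ?x" using \<theta>(1) a by (force simp: log_der_of_def)
    then have "?x dvd (der_apply \<phi> ?x - prod_list ?L) - der_apply ?m ?x" using \<phi>x by (rule dvd_diff[rotated])
    moreover have "(der_apply \<phi> ?x - prod_list ?L) - der_apply ?m ?x
      = l * (der_apply ?\<phi> ?x - prod_list (map lin (remove1 b vs)))"
      unfolding prod_list_map_remove1[OF b(1), of lin] b(2)[symmetric]
      by (subst \<phi>eq) (simp add: der_apply_add der_apply_smult algebra_simps)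
    ultimately have "?x dvd der_apply ?\<phi> ?x - prod_list (map lin (remove1 b vs))"
      using lin_prime_dvd lL(1)[OF l] by (metis in_ideal_1)
    moreover have "set (remove1 b vs) \<subseteq> W - {a}" using vs(1) set_remove1_subset by fast
    ultimately have "Q (length (remove1 b vs))" unfolding Q_def using \<phi>' by blast
    moreover have "length (remove1 b vs) < n" using b(1) vs(2) by (metis length_remove1 One_nat_def diff_less length_pos_if_in_set zero_less_one)
    ultimately show False using min by blast
  qed
  have gen: "\<exists>f c. \<psi> = f *s \<phi> + lincomb \<theta> c" if \<psi>: "\<psi> \<in> ?D" for \<psi>
  proof -
    let ?t = "der_apply \<psi> ?x"
    obtain c where c: "lincomb \<theta> c = ?x *s \<psi>" using smult_log_der_of[OF \<psi>] \<theta>(1) by (metis imageE)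
    have "?t *s \<phi> - prod_list ?L *s \<psi> \<in> log_der_of W"
    proof (rule log_der_of_insert)
      show "?t *s \<phi> - prod_list ?L *s \<psi> \<in> ?D"
        using vmod.subspace_diff[OF subD] vmod.subspace_scale[OF subD] \<phi> \<psi> by blast
      have "der_apply (?t *s \<phi> - prod_list ?L *s \<psi>) ?x = ?t * (der_apply \<phi> ?x - prod_list ?L)"
        by (simp add: der_apply_diff der_apply_smult algebra_simps)
      then show "?x dvd der_apply (?t *s \<phi> - prod_list ?L *s \<psi>) ?x" using \<phi>x by simp
    qed
    then obtain z where z: "?t *s \<phi> - prod_list ?L *s \<psi> = lincomb \<theta> z" using \<theta>(1) by blast
    have "lincomb \<theta> (?t *s u - prod_list ?L *s c - ?x *s z) = 0"
      unfolding vmod.comb_diff vmod.comb_scale u c z[symmetric]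
      by (simp add: vmod.scale_right_diff_distrib mult.commute)
    then have "?t *s u - prod_list ?L *s c - ?x *s z = 0" by (rule \<theta>(2))
    then have "?t * u $ i - prod_list ?L * c $ i = ?x * z $ i" for i
      by (auto simp: vec_eq_iff)
    then have "?t * u $ i \<in> ideal (insert (prod_list ?L) {?x})" for i
      unfolding in_ideal_insert[of _ _ "{lin a}"] in_ideal_1 by (metis dvd_triv_left)
    then have "?t \<in> ideal (insert (prod_list ?L) {?x})"
      using cancel_prime_product[OF prime_ideal_lin1 lL(2,1) u_not] by blast
    then obtain k where k: "?x dvd ?t - prod_list ?L * k" unfolding in_ideal_insert[of _ _ "{lin a}"] in_ideal_1 by blast
    have "\<psi> - k *s \<phi> \<in> log_der_of W"
    proof (rule log_der_of_insert)
      show "\<psi> - k *s \<phi> \<in> ?D"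
        using vmod.subspace_diff[OF subD] vmod.subspace_scale[OF subD] \<phi> \<psi> by blast
      have "der_apply (\<psi> - k *s \<phi>) ?x = (?t - prod_list ?L * k) - k * (der_apply \<phi> ?x - prod_list ?L)"
        by (simp add: der_apply_diff der_apply_smult algebra_simps)
      then show "?x dvd der_apply (\<psi> - k *s \<phi>) ?x" using \<phi>x k by simp
    qed
    then obtain c' where "\<psi> - k *s \<phi> = lincomb \<theta> c'" using \<theta>(1) by blast
    then have "\<psi> = k *s \<phi> + lincomb \<theta> c'" by (simp add: diff_eq_eq add.commute)
    then show ?thesis by blast
  qed
  show ?thesis using that[OF \<phi> not_dvd gen] .
qed

section \<open>Deleting a second hyperplane\<close>

lemma vec_in_ideal2:
  fixes v :: "'r::comm_ring_1 ^ 'm"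
  assumes "\<And>i. v $ i \<in> ideal {x, y}"
  obtains a b where "v = x *s a + y *s b"
proof -
  have "\<forall>i. \<exists>a b. v $ i = x * a + y * b" using assms by (simp add: in_ideal_2)
  from choice[OF this] obtain a where "\<forall>i. \<exists>b. v $ i = x * a i + y * b" by blast
  from choice[OF this] obtain b where "\<And>i. v $ i = x * a i + y * b i" by blast
  then have "v = x *s (\<chi> i. a i) + y *s (\<chi> i. b i)" by (simp add: vec_eq_iff)
  then show ?thesis by (rule that)
qed

lemma noncollinearD:
  assumes "noncollinear W" "a \<in> W"
  shows "a \<noteq> 0" "b \<in> W \<Longrightarrow> a \<noteq> b \<Longrightarrow> b \<noteq> c *s a"
  using assms by (auto simp: noncollinear_def)

text \<open>Write \<open>\<phi>(y) = y s\<^sub>0\<close>. For a form \<open>b = s x + t y\<close> in \<open>BX\<close> the condition on \<open>\<phi>(b)\<close> says that \<open>b\<close> divides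
\<open>\<phi>(x) - x s\<^sub>0\<close>. This difference does not involve \<open>b\<close>, so all these forms divide it together.\<close>

lemma value_at_deleted_form:
  fixes W :: "('k::field ^ 'n::finite) set"
  assumes fin: "finite W" and W: "noncollinear W" and a: "a1 \<in> W" "a2 \<in> W" "a1 \<noteq> a2"
    and \<phi>: "\<phi> \<in> log_der_of (W - {a1})"
    and BX: "BX = {b \<in> W - {a1, a2}. lin b \<in> ideal {lin a1, lin a2}}"
  obtains k where "lin a1 dvd der_apply \<phi> (lin a1) - (\<Prod>b\<in>BX. lin b) * k"
proof -
  let ?x = "lin a1" and ?y = "lin a2"
  have "?y dvd der_apply \<phi> ?y" using \<phi> a by (auto simp: log_der_of_def)
  then obtain s0 where s0: "der_apply \<phi> ?y = ?y * s0" by (rule dvdE)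
  let ?G = "der_apply \<phi> ?x - ?x * s0"
  have "lin b dvd ?G" if b: "b \<in> BX" for b
  proof -
    have bW: "b \<in> W" "b \<noteq> a1" "b \<noteq> a2" and "lin b \<in> ideal {?x, ?y}" using b BX by auto
    then obtain s t where st: "b = s *s a1 + t *s a2" by (metis lin_in_ideal2)
    have "s \<noteq> 0"
    proof
      assume "s = 0"
      then have "b = t *s a2" using st by simp
      then show False using noncollinearD(2)[OF W a(2) bW(1) bW(3)[symmetric]] by blast
    qed
    have linb: "lin b = const_poly s * ?x + const_poly t * ?y" by (simp add: st lin_add lin_scale)
    have "lin b dvd der_apply \<phi> (lin b)" using \<phi> bW by (auto simp: log_der_of_def)
    moreover have "der_apply \<phi> (lin b) = const_poly s * der_apply \<phi> ?x + const_poly t * (?y * s0)"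
      unfolding st der_apply_lin_comb s0 ..
    moreover have "\<dots> = const_poly s * ?G + lin b * s0" by (simp add: linb algebra_simps)
    ultimately have "lin b dvd const_poly s * ?G" by (simp add: dvd_add_left_iff)
    then have "lin b dvd const_poly (1 / s) * (const_poly s * ?G)" by (rule dvd_mult)
    then show ?thesis using \<open>s \<noteq> 0\<close> by (simp add: mult.assoc[symmetric] flip: const_poly_mult)
  qed
  moreover have "finite BX" "noncollinear BX"
    using fin noncollinear_subset[OF W, of BX] by (auto simp: BX)
  ultimately have "(\<Prod>b\<in>BX. lin b) dvd ?G" using prod_lin_dvd by blast
  then obtain k where "?G = (\<Prod>b\<in>BX. lin b) * k" by (rule dvdE)
  then have "der_apply \<phi> ?x - (\<Prod>b\<in>BX. lin b) * k = ?x * s0" by (simp add: algebra_simps)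
  then show ?thesis using that by (metis dvd_triv_left)
qed

lemma double_deletion_coordinates:
  fixes W :: "('k::field ^ 'n::finite) set" and \<theta> :: "'n \<Rightarrow> ('k, 'n) der"
  assumes W: "noncollinear W" and a: "a1 \<in> W" "a2 \<in> W" "a1 \<noteq> a2"
  shows "\<psi> \<in> log_der_of (W - {a1, a2}) \<longleftrightarrow> (lin a1 * lin a2) *s \<psi> \<in> log_der_of W"
proof
  assume "\<psi> \<in> log_der_of (W - {a1, a2})"
  then have "\<psi> \<in> log_der_of ((W - {a1}) - {a2})" by (simp add: Diff_insert[symmetric] insert_commute)
  then have "lin a1 *s (lin a2 *s \<psi>) \<in> log_der_of W" by (intro smult_log_der_of)
  then show "(lin a1 * lin a2) *s \<psi> \<in> log_der_of W" by simp
next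
  assume "(lin a1 * lin a2) *s \<psi> \<in> log_der_of W"
  then have "lin a1 *s (lin a2 *s \<psi>) \<in> log_der_of W" by simp
  then have "lin a2 *s \<psi> \<in> log_der_of (W - {a1})" using log_der_of_smult W a by blast
  then have "\<psi> \<in> log_der_of ((W - {a1}) - {a2})"
    by (rule log_der_of_smult) (use a noncollinear_subset[OF W] in auto)
  then show "\<psi> \<in> log_der_of (W - {a1, a2})" by (simp add: Diff_insert[symmetric] insert_commute)
qed

text \<open>Evaluate the equation for \<open>y \<eta>\<close> at \<open>x\<close>, modulo \<open>x\<close>: up to a constant the left-hand side is the product of all
forms of the double deletion, and the right-hand side is \<open>F \<phi>(x)\<close>, where \<open>\<phi>(x)\<close> contains the factors
from \<open>BX\<close>. Cancelling these leaves the forms outside the ideal.\<close>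

lemma deleted_value_factor:
  fixes W :: "('k::field ^ 'n::finite) set" and \<theta> :: "'n \<Rightarrow> ('k, 'n) der"
  assumes fin: "finite W" and W: "noncollinear W" and a: "a1 \<in> W" "a2 \<in> W" "a1 \<noteq> a2"
    and \<theta>: "log_der_of W = range (lincomb \<theta>)"
    and \<phi>: "\<phi> \<in> log_der_of (W - {a1})"
    and e: "lin a2 *s \<eta> = F *s \<phi> + lincomb \<theta> c"
    and \<eta>: "der_apply \<eta> (lin a1) = const_poly \<tau> * (\<Prod>b\<in>W - {a1, a2, l}. lin b)"
    and l: "l \<in> W - {a1, a2}" "lin a1 dvd const_poly \<tau> * lin a2 - const_poly \<epsilon> * lin l"
    and lX: "lin l \<in> ideal {lin a1, lin a2}" and \<epsilon>: "\<epsilon> \<noteq> 0"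
    and BX: "BX = {b \<in> W - {a1, a2}. lin b \<in> ideal {lin a1, lin a2}}"
  obtains r where "F * r - (\<Prod>b\<in>W - {a1, a2} - BX. lin b) \<in> ideal {lin a1, lin a2}"
proof -
  let ?x = "lin a1" and ?y = "lin a2" and ?R = "\<Prod>b\<in>W - {a1, a2} - BX. lin b :: ('k, 'n) mpoly"
  let ?QX = "\<Prod>b\<in>BX. lin b :: ('k, 'n) mpoly"
  obtain k where k: "?x dvd der_apply \<phi> ?x - ?QX * k"
    using value_at_deleted_form[OF fin W a \<phi> BX] by blast
  have "lincomb \<theta> c \<in> log_der_of W" using \<theta> by blast
  then have c: "?x dvd der_apply (lincomb \<theta> c) ?x" using a by (auto simp: log_der_of_def)
  have "(\<Prod>b\<in>W - {a1, a2}. lin b) = lin l * (\<Prod>b\<in>W - {a1, a2, l}. lin b :: ('k, 'n) mpoly)"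
    using prod.remove[of "W - {a1, a2}" l lin] fin l(1) by (simp add: Diff_insert[symmetric] insert_commute)
  moreover have "(\<Prod>b\<in>W - {a1, a2}. lin b) = ?R * ?QX"
    using prod.subset_diff[of BX "W - {a1, a2}" lin] fin BX by auto
  ultimately have RQ: "lin l * (\<Prod>b\<in>W - {a1, a2, l}. lin b) = ?R * ?QX" by simp
  have "der_apply (lin a2 *s \<eta>) ?x = F * der_apply \<phi> ?x + der_apply (lincomb \<theta> c) ?x"
    unfolding e by (simp add: der_apply_add der_apply_smult)
  then have v: "?y * (const_poly \<tau> * (\<Prod>b\<in>W - {a1, a2, l}. lin b)) = F * der_apply \<phi> ?x + der_apply (lincomb \<theta> c) ?x"
    by (simp add: der_apply_smult \<eta>)
  have "?QX * (F * k - const_poly \<epsilon> * ?R)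
    = (const_poly \<tau> * ?y - const_poly \<epsilon> * lin l) * (\<Prod>b\<in>W - {a1, a2, l}. lin b) - F * (der_apply \<phi> ?x - ?QX * k)
      - der_apply (lincomb \<theta> c) ?x"
  proof -
    have "const_poly \<epsilon> * (lin l * (\<Prod>b\<in>W - {a1, a2, l}. lin b)) = const_poly \<epsilon> * (?R * ?QX)" by (simp only: RQ)
    then show ?thesis using v by (simp add: algebra_simps)
  qed
  also have "?x dvd \<dots>"
    by (intro dvd_diff c dvd_mult[OF k] dvd_mult2[OF l(2)])
  finally have "?x dvd ?QX * (F * k - const_poly \<epsilon> * ?R)" .
  moreover have "\<not> ?x dvd ?QX"
    using fin noncollinear_not_dvd[OF W a(1)] by (intro prod_lin_not_dvd) (auto simp: BX)
  ultimately have "?x dvd F * k - const_poly \<epsilon> * ?R" using lin_prime_dvd by blast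
  then have "?x dvd const_poly (1 / \<epsilon>) * (F * k - const_poly \<epsilon> * ?R)" by (rule dvd_mult)
  also have "const_poly (1 / \<epsilon>) * (F * k - const_poly \<epsilon> * ?R) = F * (const_poly (1 / \<epsilon>) * k) - const_poly (1 / \<epsilon> * \<epsilon>) * ?R"
    unfolding const_poly_mult by (simp add: algebra_simps)
  also have "\<dots> = F * (const_poly (1 / \<epsilon>) * k) - ?R" using \<epsilon> by simp
  finally obtain z where "F * (const_poly (1 / \<epsilon>) * k) - ?R = ?x * z" by (rule dvdE)
  then have "F * (const_poly (1 / \<epsilon>) * k) - ?R = ?x * z + ?y * 0" by simp
  then have "F * (const_poly (1 / \<epsilon>) * k) - ?R \<in> ideal {?x, ?y}" unfolding in_ideal_2 by blast
  then show ?thesis by (rule that)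
qed

text \<open>The given relation forces \<open>\<phi>1(x)\<close> into the ideal \<open>I = (x, y)\<close>. As \<open>\<phi>1(x)\<close> divides the product of the forms of
the double deletion modulo \<open>x\<close>, one of them, \<open>l\<close>, lies in \<open>I\<close>. The product of the other forms times a constant
derivation that kills \<open>l\<close> is a logarithmic derivation \<open>\<eta>\<close>, and the coordinates of \<open>x y \<eta>\<close> give the relation.\<close>

lemma syzygy_dividing_linear_forms:
  fixes W :: "('k::field ^ 'n::finite) set" and \<theta> :: "'n \<Rightarrow> ('k, 'n) der"
  assumes fin: "finite W" and W: "noncollinear W" and a: "a1 \<in> W" "a2 \<in> W" "a1 \<noteq> a2"
    and \<theta>: "log_der_of W = range (lincomb \<theta>)" "\<And>c. lincomb \<theta> c = 0 \<Longrightarrow> c = 0"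
    and \<phi>1: "\<phi>1 \<in> log_der_of (W - {a1})"
      "\<And>\<psi>. \<psi> \<in> log_der_of (W - {a1}) \<Longrightarrow> \<exists>f c. \<psi> = f *s \<phi>1 + lincomb \<theta> c"
    and \<phi>2: "\<phi>2 \<in> log_der_of (W - {a2})"
      "\<And>\<psi>. \<psi> \<in> log_der_of (W - {a2}) \<Longrightarrow> \<exists>f c. \<psi> = f *s \<phi>2 + lincomb \<theta> c"
    and u: "lincomb \<theta> u = lin a1 *s \<phi>1" and v: "lincomb \<theta> v = lin a2 *s \<phi>2"
    and syz: "\<And>i. f * u $ i - g * v $ i \<in> ideal {lin a1, lin a2}"
    and f: "f \<notin> ideal {lin a1, lin a2}"
  obtains F G vs r r' where "\<And>i. F * u $ i - G * v $ i \<in> ideal {lin a1, lin a2}"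
    "\<And>b. b \<in> set vs \<Longrightarrow> lin b \<notin> ideal {lin a1, lin a2}"
    "F * r - prod_list (map lin vs) \<in> ideal {lin a1, lin a2}"
    "G * r' - prod_list (map lin vs) \<in> ideal {lin a1, lin a2}"
proof -
  let ?x = "lin a1 :: ('k, 'n) mpoly" and ?y = "lin a2 :: ('k, 'n) mpoly"
  let ?I = "ideal {?x, ?y}"
  note I = prime_idealD[OF prime_ideal_lin2[of a1 a2]]
  have a10: "a1 \<noteq> 0" and a12: "\<And>c. a2 \<noteq> c *s a1" and a21: "\<And>c. a1 \<noteq> c *s a2"
    using noncollinearD[OF W] a by auto
  have xI: "?x * z \<in> ?I" and yI: "?y * z \<in> ?I" for z
    by (rule ideal_mult_right, rule rmod.span_base, simp)+
  have dvdI: "z \<in> ?I" if "?x dvd z" for z using that xI by (auto simp: dvd_def)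
  define BX where "BX = {b \<in> W - {a1, a2}. lin b \<in> ?I}"
  \<comment> \<open>The relation comes from some \<open>\<psi>\<close> in the double deletion with \<open>y \<psi> = f \<phi>1\<close> modulo \<open>D(\<A>)\<close>; evaluate at \<open>x\<close>.\<close>
  have val: "der_apply \<phi>1 ?x \<in> ?I"
  proof -
    obtain \<alpha> \<beta> where ab: "f *s u - g *s v = ?x *s \<alpha> + ?y *s \<beta>"
      using vec_in_ideal2[of "f *s u - g *s v" ?x ?y] syz by auto
    define c where "c = f *s u - ?x *s \<alpha>"
    have c2: "c = g *s v + ?y *s \<beta>" using ab by (simp add: c_def algebra_simps)
    have e1: "lincomb \<theta> c = ?x *s (f *s \<phi>1 - lincomb \<theta> \<alpha>)"
      unfolding c_def vmod.comb_diff vmod.comb_scale u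
      by (simp add: vmod.scale_right_diff_distrib mult.commute)
    have e2: "lincomb \<theta> c = ?y *s (g *s \<phi>2 + lincomb \<theta> \<beta>)"
      unfolding c2 vmod.comb_add vmod.comb_scale v
      by (simp add: vmod.scale_right_distrib mult.commute)
    have "?y dvd (f *s \<phi>1 - lincomb \<theta> \<alpha>) $ i" for i
    proof -
      have "?x * (f *s \<phi>1 - lincomb \<theta> \<alpha>) $ i = ?y * (g *s \<phi>2 + lincomb \<theta> \<beta>) $ i"
        using arg_cong[OF trans[OF e1[symmetric] e2], of "\<lambda>v. v $ i"] by simp
      then have "?y dvd ?x * (f *s \<phi>1 - lincomb \<theta> \<alpha>) $ i" by simp
      then show ?thesis using lin_prime_dvd noncollinear_not_dvd[OF W a(2,1)] a(3) by blast
    qed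
    then obtain \<psi> where \<psi>: "f *s \<phi>1 - lincomb \<theta> \<alpha> = ?y *s \<psi>" using vec_dvdI by blast
    have "lincomb \<theta> c = (?x * ?y) *s \<psi>" using e1 \<psi> by simp
    have "lincomb \<theta> \<alpha> \<in> log_der_of W" using \<theta> by blast
    then have "?x dvd der_apply (lincomb \<theta> \<alpha>) ?x" using a by (auto simp: log_der_of_def)
    then have "der_apply (lincomb \<theta> \<alpha>) ?x \<in> ?I" by (rule dvdI)
    moreover have "f * der_apply \<phi>1 ?x = ?y * der_apply \<psi> ?x + der_apply (lincomb \<theta> \<alpha>) ?x"
      using arg_cong[OF \<psi>, of "\<lambda>\<eta>. der_apply \<eta> ?x"]
      by (simp add: der_apply_diff der_apply_smult algebra_simps)
    ultimately have "f * der_apply \<phi>1 ?x \<in> ?I" using yI I(4) by metis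
    then show ?thesis using I(1) f by blast
  qed
  have "\<exists>l \<in> W - {a1, a2}. lin l \<in> ?I"
  proof (rule ccontr)
    assume none: "\<not> ?thesis"
    obtain w where w: "dot a1 w = 1" "dot a2 w = 0"
      using dual_vector[OF a10 a12] by blast
    let ?Q = "\<Prod>b\<in>W - {a1, a2}. lin b :: ('k, 'n) mpoly"
    have "?Q *s const_der w \<in> log_der_of (W - {a1})"
    proof -
      have "lin b dvd der_apply (?Q *s const_der w) (lin b)" if "b \<in> W - {a1}" for b
      proof (cases "b = a2")
        case True
        then show ?thesis using w by (simp add: der_apply_smult der_apply_const_der)
      next
        case False
        then have "lin b dvd ?Q" using that fin by (intro dvd_prodI) auto
        then show ?thesis by (simp add: der_apply_smult)
      qed
      then show ?thesis by (simp add: log_der_of_def)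
    qed
    then obtain t c where tc: "?Q *s const_der w = t *s \<phi>1 + lincomb \<theta> c" using \<phi>1(2) by blast
    have "lincomb \<theta> c \<in> log_der_of W" using \<theta> by blast
    then have "?x dvd der_apply (lincomb \<theta> c) ?x" using a by (auto simp: log_der_of_def)
    then have "der_apply (lincomb \<theta> c) ?x \<in> ?I" by (rule dvdI)
    moreover have "?Q = t * der_apply \<phi>1 ?x + der_apply (lincomb \<theta> c) ?x"
      using arg_cong[OF tc, of "\<lambda>\<eta>. der_apply \<eta> ?x"] w
      by (simp add: der_apply_add der_apply_smult der_apply_const_der)
    ultimately have "?Q \<in> ?I" using val I(4,7) by metis
    moreover obtain vs where "set vs = W - {a1, a2}" "distinct vs"
      using finite_distinct_list fin by (metis finite_Diff)
    moreover from this have "?Q = prod_list (map lin vs)"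
      using prod.distinct_set_conv_list[of vs lin] by simp
    ultimately show False
      using prod_list_notin_prime[OF prime_ideal_lin2[of a1 a2], of "map lin vs"] none by auto
  qed
  then obtain l where l: "l \<in> W - {a1, a2}" "lin l \<in> ?I" by blast
  then obtain s t where st: "l = s *s a1 + t *s a2" by (metis lin_in_ideal2)
  have linl: "lin l = const_poly s * ?x + const_poly t * ?y" by (simp add: st lin_add lin_scale)
  \<comment> \<open>The values \<open>t\<close> and \<open>-s\<close> make the constant derivation vanish on \<open>l = s x + t y\<close>.\<close>
  obtain w where w: "dot a1 w = t" "dot a2 w = - s"
    using dual_vector[OF a10 a12] by blast
  have lw: "dot l w = 0"
  proof -
    have "dot l w = s * dot a1 w + t * dot a2 w"
      by (simp add: st distrib_right sum.distrib sum_distrib_left mult.assoc)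
    then show ?thesis by (simp add: w)
  qed
  let ?Q = "\<Prod>b\<in>W - {a1, a2, l}. lin b :: ('k, 'n) mpoly"
  define \<eta> where "\<eta> = ?Q *s const_der w"
  have \<eta>: "\<eta> \<in> log_der_of (W - {a1, a2})"
  proof -
    have "lin b dvd der_apply \<eta> (lin b)" if "b \<in> W - {a1, a2}" for b
    proof (cases "b = l")
      case True
      then show ?thesis using lw by (simp add: \<eta>_def der_apply_smult der_apply_const_der)
    next
      case False
      then have "lin b dvd ?Q" using that fin by (intro dvd_prodI) auto
      then show ?thesis by (simp add: \<eta>_def der_apply_smult)
    qed
    then show ?thesis by (simp add: log_der_of_def)
  qed
  have \<eta>x: "der_apply \<eta> ?x = const_poly t * ?Q" "der_apply \<eta> ?y = const_poly (- s) * ?Q"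
    by (simp_all add: \<eta>_def der_apply_smult der_apply_const_der w mult.commute)
  have "W - {a1, a2} = W - {a1} - {a2}" "W - {a1, a2} = W - {a2} - {a1}" by auto
  then have "?y *s \<eta> \<in> log_der_of (W - {a1})" "?x *s \<eta> \<in> log_der_of (W - {a2})"
    using \<eta> smult_log_der_of by metis+
  then obtain F c G c' where F: "?y *s \<eta> = F *s \<phi>1 + lincomb \<theta> c" and G: "?x *s \<eta> = G *s \<phi>2 + lincomb \<theta> c'"
    using \<phi>1(2) \<phi>2(2) by metis
  have "lincomb \<theta> (F *s u + ?x *s c - (G *s v + ?y *s c')) = 0"
  proof -
    have "lincomb \<theta> (F *s u + ?x *s c) = ?x *s (F *s \<phi>1 + lincomb \<theta> c)"
      by (simp add: vmod.comb_add vmod.comb_scale u vmod.scale_right_distrib mult.commute)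
    moreover have "lincomb \<theta> (G *s v + ?y *s c') = ?y *s (G *s \<phi>2 + lincomb \<theta> c')"
      by (simp add: vmod.comb_add vmod.comb_scale v vmod.scale_right_distrib mult.commute)
    ultimately show ?thesis
      unfolding vmod.comb_diff F[symmetric] G[symmetric] by (simp add: mult.commute)
  qed
  then have "F *s u + ?x *s c - (G *s v + ?y *s c') = 0" by (rule \<theta>(2))
  then have "F * u $ i - G * v $ i = ?x * (- c $ i) + ?y * c' $ i" for i
    by (auto simp: vec_eq_iff algebra_simps eq_diff_eq)
  then have syzFG: "F * u $ i - G * v $ i \<in> ?I" for i unfolding in_ideal_2 by blast
  have swap: "{?y, ?x} = {?x, ?y}" "W - {a2, a1} = W - {a1, a2}" "W - {a2, a1, l} = W - {a1, a2, l}" by auto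
  obtain r where r: "F * r - (\<Prod>b\<in>W - {a1, a2} - BX. lin b) \<in> ?I"
  proof (rule deleted_value_factor[OF fin W a \<theta>(1) \<phi>1(1) F \<eta>x(1) l(1) _ l(2) _ BX_def])
    show "?x dvd const_poly t * ?y - const_poly 1 * lin l" by (simp add: linl)
  qed auto
  obtain r' where r': "G * r' - (\<Prod>b\<in>W - {a1, a2} - BX. lin b) \<in> ?I"
  proof (rule deleted_value_factor[OF fin W a(2,1) a(3)[symmetric] \<theta>(1) \<phi>2(1) G, of "- s" l "- 1" BX, unfolded swap])
    show "?y dvd const_poly (- s) * ?x - const_poly (- 1) * lin l" by (simp add: linl const_poly_minus)
  qed (use \<eta>x(2) l BX_def in auto)
  obtain vs where vs: "set vs = W - {a1, a2} - BX" "distinct vs"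
    using finite_distinct_list fin by (metis finite_Diff)
  then have "(\<Prod>b\<in>W - {a1, a2} - BX. lin b) = (prod_list (map lin vs) :: ('k, 'n) mpoly)"
    using prod.distinct_set_conv_list[of vs lin] by simp
  moreover have "lin b \<notin> ?I" if "b \<in> set vs" for b using that vs by (auto simp: BX_def)
  ultimately show ?thesis using that[OF syzFG _ , of vs r r'] r r' by simp
qed

section \<open>Classification of double deletions\<close>

text \<open>Consider the relations \<open>(f, g)\<close> for which \<open>f\<close> divides a product of primes from \<open>\<Lambda>\<close> modulo \<open>T\<close>, and take the one with the
shortest product, \<open>q s = \<Prod>M\<close>. By minimality no prime of \<open>M\<close> divides \<open>s\<close>. So each of them divides \<open>q\<close>, and none divides \<open>p\<close>,
since otherwise it could be divided out of the pair. For another relation \<open>(f, g)\<close> one has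
\<open>f p = q g\<close>, hence \<open>\<Prod>M\<close> divides \<open>f (s p)\<close>, hence \<open>f\<close>; so \<open>q\<close> divides \<open>f\<close>, and the same multiple works for \<open>g\<close>. The
relation \<open>(F, G)\<close> is a multiple of \<open>(q, p)\<close>, so \<open>p\<close> divides a product of primes as well.\<close>

lemma generating_syzygy:
  fixes u v :: "'i \<Rightarrow> 'r::comm_ring_1"
  assumes P: "prime_ideal (ideal T)"
    and \<Lambda>: "\<And>l. l \<in> \<Lambda> \<Longrightarrow> prime_ideal (ideal (insert l T))" "\<And>l. l \<in> \<Lambda> \<Longrightarrow> l \<notin> ideal T"
    and u: "u j \<notin> ideal T" and v: "v k \<notin> ideal T"
    and FG: "\<And>i. F * u i - G * v i \<in> ideal T"
    and F: "F * r - prod_list L \<in> ideal T" "set L \<subseteq> \<Lambda>"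
    and G: "G * r' - prod_list L \<in> ideal T"
  obtains q p where "\<And>i. q * u i - p * v i \<in> ideal T" "q \<notin> ideal T"
    "\<And>f g. (\<And>i. f * u i - g * v i \<in> ideal T) \<Longrightarrow>
      \<exists>s. f - s * q \<in> ideal T \<and> g - s * p \<in> ideal T"
    "(\<exists>e. q * e - 1 \<in> ideal T) \<or> (\<exists>l\<in>\<Lambda>. q \<in> ideal (insert l T))"
    "(\<exists>e. p * e - 1 \<in> ideal T) \<or> (\<exists>l\<in>\<Lambda>. p \<in> ideal (insert l T))"
proof -
  let ?P = "ideal T"
  note I = prime_idealD[OF P]
  define Q where "Q n \<longleftrightarrow> (\<exists>f g r M. (\<forall>i. f * u i - g * v i \<in> ?P) \<and> f * r - prod_list M \<in> ?P \<and>
    set M \<subseteq> \<Lambda> \<and> length M = n)" for n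
  have "Q (length L)" unfolding Q_def using FG F by blast
  then obtain n where "Q n" and min: "\<And>m. m < n \<Longrightarrow> \<not> Q m" using exists_least_iff[of Q] by blast
  then obtain q p s M where qp: "\<And>i. q * u i - p * v i \<in> ?P" and qs: "q * s - prod_list M \<in> ?P"
    and M: "set M \<subseteq> \<Lambda>" "length M = n" unfolding Q_def by blast
  have Mprime: "prime_ideal (ideal (insert l T))" "l \<notin> ?P" if "l \<in> set M" for l
    using that M \<Lambda> by auto
  have "prod_list M \<notin> ?P" using prod_list_notin_prime[OF P] Mprime(2) by blast
  then have q: "q \<notin> ?P" using qs I(5)[of "q * s" "q * s - prod_list M"] I(8) by auto
  have remove: "prod_list M = l * prod_list (remove1 l M)" "length (remove1 l M) < n"
    "set (remove1 l M) \<subseteq> \<Lambda>" if "l \<in> set M" for l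
    using that prod_list_map_remove1[of l M "\<lambda>x. x"] M set_remove1_subset[of l M]
    by (auto simp: length_remove1 intro: diff_less length_pos_if_in_set)
  have s_not: "s \<notin> ideal (insert l T)" if l: "l \<in> set M" for l
  proof
    assume "s \<in> ideal (insert l T)"
    then obtain s' where s': "s - l * s' \<in> ?P" unfolding in_ideal_insert by blast
    have "l * (q * s' - prod_list (remove1 l M)) = (q * s - prod_list M) - q * (s - l * s')"
      unfolding remove(1)[OF l] by (simp add: algebra_simps)
    then have "l * (q * s' - prod_list (remove1 l M)) \<in> ?P" using I(5)[OF qs I(7)[OF s', of q]] by simp
    then have "q * s' - prod_list (remove1 l M) \<in> ?P" using I(1) Mprime(2)[OF l] by blast
    then have "Q (length (remove1 l M))" unfolding Q_def using qp remove(3)[OF l] by blast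
    then show False using min remove(2)[OF l] by blast
  qed
  have p_not: "p \<notin> ideal (insert l T)" if l: "l \<in> set M" for l
  proof
    assume "p \<in> ideal (insert l T)"
    then obtain p' where p': "p - l * p' \<in> ?P" unfolding in_ideal_insert by blast
    have "q * s - l * prod_list (remove1 l M) \<in> ?P" using qs remove(1)[OF l] by simp
    then have "q * s \<in> ideal (insert l T)" unfolding in_ideal_insert by blast
    then have "q \<in> ideal (insert l T)" using prime_idealD(1)[OF Mprime(1)[OF l]] s_not[OF l] by blast
    then obtain q' where q': "q - l * q' \<in> ?P" unfolding in_ideal_insert by blast
    have "q' * u i - p' * v i \<in> ?P" for i
    proof -
      have "l * (q' * u i - p' * v i) = (q * u i - p * v i) - (q - l * q') * u i + (p - l * p') * v i"
        by (simp add: algebra_simps)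
      then have "l * (q' * u i - p' * v i) \<in> ?P" using qp q' p' I(4,5,8) by simp
      then show ?thesis using I(1) Mprime(2)[OF l] by blast
    qed
    moreover have "q' * s - prod_list (remove1 l M) \<in> ?P"
    proof -
      have "l * (q' * s - prod_list (remove1 l M)) = (q * s - prod_list M) - (q - l * q') * s"
        unfolding remove(1)[OF l] by (simp add: algebra_simps)
      then have "l * (q' * s - prod_list (remove1 l M)) \<in> ?P" using qs q' I(5,8) by simp
      then show ?thesis using I(1) Mprime(2)[OF l] by blast
    qed
    ultimately have "Q (length (remove1 l M))" unfolding Q_def using remove(3)[OF l] by blast
    then show False using min remove(2)[OF l] by blast
  qed
  have gen: "\<exists>s. f - s * q \<in> ?P \<and> g - s * p \<in> ?P" if fg: "\<And>i. f * u i - g * v i \<in> ?P" for f g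
  proof -
    have "(f * p - q * g) * v k = q * (f * u k - g * v k) - f * (q * u k - p * v k)"
      by (simp add: algebra_simps)
    then have "(f * p - q * g) * v k \<in> ?P" using fg qp I(5,7) by simp
    then have fp: "f * p - q * g \<in> ?P" using I(1) v by blast
    have "f * (s * p) - prod_list M * g = s * (f * p - q * g) + g * (q * s - prod_list M)"
      by (simp add: algebra_simps)
    then have "f * (s * p) - prod_list M * g \<in> ?P" using fp qs I(4,7) by simp
    then have fsp: "f * (s * p) \<in> ideal (insert (prod_list M) T)" unfolding in_ideal_insert by blast
    have "f \<in> ideal (insert (prod_list M) T)"
    proof (rule cancel_prime_product[where w = "\<lambda>_ :: unit. s * p"])
      show "\<exists>i::unit. s * p \<notin> ideal (insert l T)" if "l \<in> set M" for l
        using prime_idealD(1)[OF Mprime(1)[OF that]] s_not[OF that] p_not[OF that] by blast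
    qed (use P Mprime fsp in auto)
    then obtain t where t: "f - prod_list M * t \<in> ?P" unfolding in_ideal_insert by blast
    have "f - s * t * q = (f - prod_list M * t) - t * (q * s - prod_list M)" by (simp add: algebra_simps)
    also have "\<dots> \<in> ?P" by (rule I(5)[OF t I(7)[OF qs]])
    finally have f: "f - s * t * q \<in> ?P" .
    have "q * (g - s * t * p) = (f - s * t * q) * p - (f * p - q * g)" by (simp add: algebra_simps)
    then have "q * (g - s * t * p) \<in> ?P" using f fp I(5,8) by simp
    then have "g - s * t * p \<in> ?P" using I(1) q by blast
    then show ?thesis using f by blast
  qed
  have unit_or: "(\<exists>e. z * e - 1 \<in> ?P) \<or> (\<exists>l\<in>\<Lambda>. z \<in> ideal (insert l T))"
    if "z * c - prod_list K \<in> ?P" "set K \<subseteq> \<Lambda>" for z c K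
    using divisor_of_prime_product[OF P, of K z c] that \<Lambda> by blast
  obtain t where t: "F - t * q \<in> ?P" "G - t * p \<in> ?P" using gen[OF FG] by blast
  have "p * (t * r') - prod_list L = (G * r' - prod_list L) - (G - t * p) * r'" by (simp add: algebra_simps)
  also have "\<dots> \<in> ?P" by (rule I(5)[OF G I(8)[OF t(2)]])
  finally have "p * (t * r') - prod_list L \<in> ?P" .
  then show ?thesis using that[OF qp q gen] unit_or[OF qs M(1)] unit_or[OF _ F(2)] by blast
qed

text \<open>If \<open>v = h u\<close> modulo \<open>(x, y)\<close>, then \<open>v\<close> may be changed by a multiple of \<open>y\<close> into \<open>w = h u + x V\<close>, which lies in both
submodules and together with \<open>y u\<close> generates their intersection over \<open>x y S\<^sup>n\<close>.\<close>

lemma deletion_dependent_residues: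
  fixes \<theta> :: "'n::finite \<Rightarrow> ('k::field, 'n) der" and x y h :: "('k, 'n) mpoly"
  assumes inj: "\<And>c. lincomb \<theta> c = 0 \<Longrightarrow> c = 0" and x: "x \<noteq> 0" and y: "y \<noteq> 0"
    and D: "\<And>\<psi>. \<psi> \<in> D \<longleftrightarrow> (\<exists>c. lincomb \<theta> c = (x * y) *s \<psi>)"
    and N: "\<And>c. (\<exists>\<psi>. lincomb \<theta> c = (x * y) *s \<psi>) \<longleftrightarrow>
      (\<exists>f a. c = f *s u + x *s a) \<and> (\<exists>g b. c = g *s v + y *s b)"
    and xy: "\<And>f. y dvd x * f \<Longrightarrow> y dvd f"
    and u: "\<And>l a. l *s u = x *s a \<Longrightarrow> x dvd l" and v: "\<And>m a. m *s v = y *s a \<Longrightarrow> y dvd m"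
    and uI: "\<And>f. (\<And>i. f * u $ i \<in> ideal {x, y}) \<Longrightarrow> f \<in> ideal {x, y}"
    and vu: "v = h *s u + x *s V + y *s d"
  shows "\<exists>g :: 'n + bool \<Rightarrow> ('k, 'n) der. D = range (lincomb g) \<and> proj_dim (*s) D \<le> 1"
proof -
  define w where "w = h *s u + x *s V"
  have vw: "v = w + y *s d" by (simp add: vu w_def)
  have N': "(\<exists>\<psi>. lincomb \<theta> c = (x * y) *s \<psi>) \<longleftrightarrow>
    (\<exists>a m. c = (x * y) *s a + lincomb (\<lambda>b. if b then y *s u else w) m)" for c
    unfolding N
  proof (rule intersection_generators[OF xy, where F = "\<lambda>b. if b then y else h" and G = "\<lambda>b. if b then 0 else 1"])
    show "\<exists>a. (if b then y *s u else w) = (if b then y else h) *s u + x *s a" for b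
      by (rule exI[of _ "if b then 0 else V"]) (simp add: w_def)
    show "\<exists>a. (if b then y *s u else w) = (if b then 0 else 1) *s v + y *s a" for b
      by (rule exI[of _ "if b then u else - d"]) (simp add: vw)
    fix f g assume fg: "\<And>i. f * u $ i - g * v $ i \<in> ideal {x, y}"
    have "(f - g * h) * u $ i \<in> ideal {x, y}" for i
    proof -
      obtain s t where "f * u $ i - g * v $ i = x * s + y * t" using fg[of i] unfolding in_ideal_2 by blast
      then have "(f - g * h) * u $ i = x * (s + g * V $ i) + y * (t + g * d $ i)"
        by (simp add: vu algebra_simps)
      then show ?thesis unfolding in_ideal_2 by blast
    qed
    then have "f - g * h \<in> ideal {x, y}" by (rule uI)
    then obtain s t where "f - g * h = x * s + y * t" unfolding in_ideal_2 by blast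
    then have "f - (y * t + g * h) = x * s" by (simp add: algebra_simps)
    then show "\<exists>m. x dvd f - (\<Sum>b\<in>UNIV. m b * (if b then y else h)) \<and>
        y dvd g - (\<Sum>b\<in>UNIV. m b * (if b then 0 else 1))"
      by (intro exI[of _ "\<lambda>b. if b then t else g"]) (simp add: UNIV_bool ac_simps)
  qed
  have wy: "y dvd m" if mw: "m *s w = y *s a" for m a
  proof (rule v)
    show "m *s v = y *s (a + m *s d)"
      unfolding vw vmod.scale_right_distrib mw by (simp add: mult.commute)
  qed
  obtain g :: "'n + bool \<Rightarrow> ('k, 'n) der" where "D = range (lincomb g)" "proj_dim (*s) D \<le> 1"
    by (rule deletion_two_extra_generators[OF inj x y D N' w_def u wy])
  then show ?thesis by blast
qed

text \<open>The five cases are: both residues of \<open>u\<close> and \<open>v\<close> modulo \<open>I\<close> vanish, one of them is a multiple of the other (twice, by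
symmetry), they are independent, and they satisfy a relation but neither is a multiple of the
other. Only the last one needs three extra generators.\<close>

lemma double_deletion_dichotomy:
  fixes W :: "('k::field ^ 'n::finite) set"
  assumes fin: "finite W" and W: "noncollinear W" and a: "a1 \<in> W" "a2 \<in> W" "a1 \<noteq> a2"
    and free: "free_mod (*s) (log_der_of W)"
    and D_def: "D = log_der_of (W - {a1, a2})"
  shows "(\<exists>g :: 'n + bool \<Rightarrow> ('k, 'n) der. D = range (lincomb g) \<and> proj_dim (*s) D \<le> 1) \<or>
    (\<exists>g :: 'n + bool option \<Rightarrow> ('k, 'n) der. D = range (lincomb g) \<and>
      (\<forall>c i. lincomb g c = 0 \<longrightarrow> const_term (c $ i) = 0) \<and> \<not> proj_dim (*s) D \<le> 1)"
    (is "?two \<or> ?three")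
proof -
  let ?x = "lin a1 :: ('k, 'n) mpoly" and ?y = "lin a2 :: ('k, 'n) mpoly"
  let ?I = "ideal {?x, ?y}"
  note I = prime_idealD[OF prime_ideal_lin2[of a1 a2]]
  have x0: "?x \<noteq> 0" and y0: "?y \<noteq> 0" using noncollinearD(1)[OF W] a by auto
  have x_y: "?x dvd ?y * f \<Longrightarrow> ?x dvd f" and y_x: "?y dvd ?x * f \<Longrightarrow> ?y dvd f" for f
    using lin_prime_dvd noncollinear_not_dvd[OF W a] noncollinear_not_dvd[OF W a(2,1)] a(3) by blast+
  have xI: "?x * z \<in> ?I" and yI: "?y * z \<in> ?I" for z
    by (rule ideal_mult_right, rule rmod.span_base, simp)+
  obtain \<theta> :: "'n \<Rightarrow> ('k, 'n) der" where \<theta>: "log_der_of W = range (lincomb \<theta>)"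
    and inj: "\<And>c. lincomb \<theta> c = 0 \<Longrightarrow> c = 0"
    using log_der_of_basis[OF fin W free] by blast
  obtain \<phi>1 where \<phi>1: "\<phi>1 \<in> log_der_of (W - {a1})" "\<not> ?x dvd der_apply \<phi>1 ?x"
    "\<And>\<psi>. \<psi> \<in> log_der_of (W - {a1}) \<Longrightarrow> \<exists>f c. \<psi> = f *s \<phi>1 + lincomb \<theta> c"
    using single_deletion_generator[OF fin W a(1) \<theta> inj] by blast
  obtain \<phi>2 where \<phi>2: "\<phi>2 \<in> log_der_of (W - {a2})" "\<not> ?y dvd der_apply \<phi>2 ?y"
    "\<And>\<psi>. \<psi> \<in> log_der_of (W - {a2}) \<Longrightarrow> \<exists>f c. \<psi> = f *s \<phi>2 + lincomb \<theta> c"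
    using single_deletion_generator[OF fin W a(2) \<theta> inj] by blast
  obtain u where u: "lincomb \<theta> u = ?x *s \<phi>1" using smult_log_der_of[OF \<phi>1(1)] \<theta> by (metis imageE)
  obtain v where v: "lincomb \<theta> v = ?y *s \<phi>2" using smult_log_der_of[OF \<phi>2(1)] \<theta> by (metis imageE)
  have regular: "lin b dvd l" if "b \<in> W" "lincomb \<theta> t = lin b *s \<phi>" "\<not> lin b dvd der_apply \<phi> (lin b)"
    "l *s t = lin b *s c" for b t \<phi> l c
  proof -
    have "lin b \<noteq> (0 :: ('k, 'n) mpoly)" using noncollinearD(1)[OF W that(1)] by simp
    moreover have "lin b *s (l *s \<phi>) = lin b *s lincomb \<theta> c"
      using arg_cong[OF that(4), of "lincomb \<theta>"] by (simp add: vmod.comb_scale that(2) mult.commute)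
    ultimately have "l *s \<phi> = lincomb \<theta> c" by (metis smult_vec_cancel)
    then have "l *s \<phi> \<in> log_der_of W" using \<theta> by simp
    then have "lin b dvd l * der_apply \<phi> (lin b)" using that(1) by (auto simp: log_der_of_def der_apply_smult)
    then show ?thesis using lin_prime_dvd that(3) by blast
  qed
  have u_reg: "?x dvd l" if "l *s u = ?x *s c" for l c using regular[OF a(1) u \<phi>1(2) that] .
  have v_reg: "?y dvd l" if "l *s v = ?y *s c" for l c using regular[OF a(2) v \<phi>2(2) that] .
  have D: "\<psi> \<in> D \<longleftrightarrow> (\<exists>c. lincomb \<theta> c = (?x * ?y) *s \<psi>)" for \<psi>
    unfolding D_def double_deletion_coordinates[OF W a] \<theta> by (auto simp: image_iff) metis
  have D12: "W - {a1} - {a2} = W - {a1, a2}"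
    "W - {a2} - {a1} = W - {a1, a2}" by auto
  have N: "(\<exists>\<psi>. lincomb \<theta> c = (?x * ?y) *s \<psi>) \<longleftrightarrow>
      (\<exists>f a. c = f *s u + ?x *s a) \<and> (\<exists>g b. c = g *s v + ?y *s b)" for c
  proof
    assume "\<exists>\<psi>. lincomb \<theta> c = (?x * ?y) *s \<psi>"
    then obtain \<psi> where \<psi>: "lincomb \<theta> c = (?x * ?y) *s \<psi>" by blast
    then have "\<psi> \<in> log_der_of (W - {a1, a2})" using D D_def by blast
    then have "?y *s \<psi> \<in> log_der_of (W - {a1})" "?x *s \<psi> \<in> log_der_of (W - {a2})"
      using smult_log_der_of D12 by metis+
    then obtain f a g b where fa: "?y *s \<psi> = f *s \<phi>1 + lincomb \<theta> a" and gb: "?x *s \<psi> = g *s \<phi>2 + lincomb \<theta> b"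
      using \<phi>1(3) \<phi>2(3) by metis
    have "lincomb \<theta> (c - (f *s u + ?x *s a)) = ?x *s (?y *s \<psi>) - ?x *s (f *s \<phi>1 + lincomb \<theta> a)"
      by (simp add: vmod.comb_diff vmod.comb_add vmod.comb_scale \<psi> u vmod.scale_right_distrib mult.commute)
    then have "lincomb \<theta> (c - (f *s u + ?x *s a)) = 0" unfolding fa by simp
    then have "c - (f *s u + ?x *s a) = 0" by (rule inj)
    then have c1: "c = f *s u + ?x *s a" by simp
    have "lincomb \<theta> (c - (g *s v + ?y *s b)) = ?y *s (?x *s \<psi>) - ?y *s (g *s \<phi>2 + lincomb \<theta> b)"
      by (simp add: vmod.comb_diff vmod.comb_add vmod.comb_scale \<psi> v vmod.scale_right_distrib mult.commute)
    then have "lincomb \<theta> (c - (g *s v + ?y *s b)) = 0" unfolding gb by simp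
    then have "c - (g *s v + ?y *s b) = 0" by (rule inj)
    then have "c = g *s v + ?y *s b" by simp
    then show "(\<exists>f a. c = f *s u + ?x *s a) \<and> (\<exists>g b. c = g *s v + ?y *s b)" using c1 by blast
  next
    assume "(\<exists>f a. c = f *s u + ?x *s a) \<and> (\<exists>g b. c = g *s v + ?y *s b)"
    then obtain f a g b where c: "c = f *s u + ?x *s a" "c = g *s v + ?y *s b" by blast
    have c1: "lincomb \<theta> c = ?x *s (f *s \<phi>1 + lincomb \<theta> a)"
      by (simp add: c(1) vmod.comb_add vmod.comb_scale u vmod.scale_right_distrib mult.commute)
    have c2: "lincomb \<theta> c = ?y *s (g *s \<phi>2 + lincomb \<theta> b)"
      by (simp add: c(2) vmod.comb_add vmod.comb_scale v vmod.scale_right_distrib mult.commute)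
    have "?y dvd (f *s \<phi>1 + lincomb \<theta> a) $ i" for i
    proof (rule y_x)
      have "?x * (f *s \<phi>1 + lincomb \<theta> a) $ i = ?y * (g *s \<phi>2 + lincomb \<theta> b) $ i"
        using arg_cong[OF trans[OF c1[symmetric] c2], of "\<lambda>v. v $ i"] by simp
      then show "?y dvd ?x * (f *s \<phi>1 + lincomb \<theta> a) $ i" by simp
    qed
    then obtain \<psi> where "f *s \<phi>1 + lincomb \<theta> a = ?y *s \<psi>" using vec_dvdI by blast
    then have "lincomb \<theta> c = (?x * ?y) *s \<psi>" using c1 by simp
    then show "\<exists>\<psi>. lincomb \<theta> c = (?x * ?y) *s \<psi>" by blast
  qed
  have faithful: "f \<in> ?I" if "t $ j \<notin> ?I" "\<And>i. f * t $ i \<in> ?I" for f j and t :: "('k, 'n) mpoly ^ 'n"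
    using I(1) that by blast
  have swap: "{?y, ?x} = {?x, ?y}" by auto
  have D': "\<psi> \<in> D \<longleftrightarrow> (\<exists>c. lincomb \<theta> c = (?y * ?x) *s \<psi>)" for \<psi>
    using D by (simp add: mult.commute)
  have N': "(\<exists>\<psi>. lincomb \<theta> c = (?y * ?x) *s \<psi>) \<longleftrightarrow>
      (\<exists>g b. c = g *s v + ?y *s b) \<and> (\<exists>f a. c = f *s u + ?x *s a)" for c
    using N[of c] by (auto simp: mult.commute)
  \<comment> \<open>If both residues vanish, \<open>u\<close> may be replaced by a multiple of \<open>y\<close> and \<open>v\<close> by a multiple of \<open>x\<close>.\<close>
  have case_zero: ?two if zero: "\<And>i. u $ i \<in> ?I" "\<And>i. v $ i \<in> ?I"
  proof -
    obtain c U where uU: "u = ?x *s c + ?y *s U" by (rule vec_in_ideal2[OF zero(1)])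
    obtain V d where vV: "v = ?x *s V + ?y *s d" by (rule vec_in_ideal2[OF zero(2)])
    define w where "w = 0 *s U + ?x *s V"
    have w: "w = ?x *s V" by (simp add: w_def)
    have N2: "(\<exists>\<psi>. lincomb \<theta> e = (?x * ?y) *s \<psi>) \<longleftrightarrow>
      (\<exists>a m. e = (?x * ?y) *s a + lincomb (\<lambda>b. if b then ?y *s U else w) m)" for e
      unfolding N
    proof (rule intersection_generators[OF y_x, where F = "\<lambda>b. if b then 1 else 0" and G = "\<lambda>b. if b then 0 else 1"])
      show "\<exists>a. (if b then ?y *s U else w) = (if b then 1 else 0) *s u + ?x *s a" for b
        by (rule exI[of _ "if b then - c else V"]) (simp add: w uU)
      show "\<exists>a. (if b then ?y *s U else w) = (if b then 0 else 1) *s v + ?y *s a" for b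
        by (rule exI[of _ "if b then U else - d"]) (simp add: w vV)
      show "\<exists>m. ?x dvd f - (\<Sum>b\<in>UNIV. m b * (if b then 1 else 0)) \<and>
        ?y dvd g - (\<Sum>b\<in>UNIV. m b * (if b then 0 else 1))" for f g
        by (rule exI[of _ "\<lambda>b. if b then f else g"]) (simp add: UNIV_bool)
    qed
    have U: "?x dvd l" if lU: "l *s U = ?x *s z" for l z
    proof (rule u_reg)
      have "l *s u = (l * ?x) *s c + ?y *s (l *s U)" by (simp add: uU vmod.scale_right_distrib mult.commute)
      then show "l *s u = ?x *s (l *s c + ?y *s z)"
        unfolding lU by (simp add: vmod.scale_right_distrib mult.commute)
    qed
    have wy: "?y dvd m" if mw: "m *s w = ?y *s z" for m z
    proof (rule v_reg)
      have "m *s v = m *s w + (m * ?y) *s d" by (simp add: vV w vmod.scale_right_distrib)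
      then show "m *s v = ?y *s (z + m *s d)"
        unfolding mw by (simp add: vmod.scale_right_distrib mult.commute)
    qed
    obtain g :: "'n + bool \<Rightarrow> ('k, 'n) der" where "D = range (lincomb g)" "proj_dim (*s) D \<le> 1"
      by (rule deletion_two_extra_generators[OF inj x0 y0 D N2 w_def U wy])
    then show ?thesis by blast
  qed
  have case_vu: ?two if "u $ j \<notin> ?I" "\<And>i. v $ i - h * u $ i \<in> ?I" for h j
  proof -
    have "(v - h *s u) $ i \<in> ?I" for i using that(2) by simp
    then obtain V d where "v - h *s u = ?x *s V + ?y *s d" using vec_in_ideal2 by blast
    then have vu: "v = h *s u + ?x *s V + ?y *s d" by (simp add: diff_eq_eq ac_simps)
    show ?thesis
      by (rule deletion_dependent_residues[OF inj x0 y0 D N y_x u_reg v_reg faithful[OF that(1)] vu])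
  qed
  have case_uv: ?two if "v $ j \<notin> ?I" "\<And>i. u $ i - h * v $ i \<in> ?I" for h j
  proof -
    have "(u - h *s v) $ i \<in> ?I" for i using that(2) by simp
    then obtain d V where "u - h *s v = ?x *s d + ?y *s V" using vec_in_ideal2 by blast
    then have uv: "u = h *s v + ?y *s V + ?x *s d" by (simp add: diff_eq_eq ac_simps)
    show ?thesis
      by (rule deletion_dependent_residues[OF inj y0 x0 D' N' x_y v_reg u_reg faithful[OF that(1), folded swap] uv])
        (simp_all only: swap)
  qed
  show ?thesis
  proof (cases "(\<forall>i. u $ i \<in> ?I) \<or> (\<forall>i. v $ i \<in> ?I)")
    case True
    show ?thesis
    proof (cases "\<forall>i. u $ i \<in> ?I")
      case uI: True
      show ?thesis
      proof (cases "\<forall>i. v $ i \<in> ?I")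
        case True
        then show ?thesis using case_zero uI by blast
      next
        case False
        then show ?thesis using case_uv[of _ 0] uI by auto
      qed
    next
      case False
      then show ?thesis using case_vu[of _ 0] True by auto
    qed
  next
    case False
    then obtain j k where j: "u $ j \<notin> ?I" and k: "v $ k \<notin> ?I" by blast
    show ?thesis
    proof (cases "\<forall>f g. (\<forall>i. f * u $ i - g * v $ i \<in> ?I) \<longrightarrow> f \<in> ?I \<and> g \<in> ?I")
      case indep: True
      define w where "w = 0 *s u + ?x *s v"
      have w: "w = ?x *s v" by (simp add: w_def)
      have N2: "(\<exists>\<psi>. lincomb \<theta> c = (?x * ?y) *s \<psi>) \<longleftrightarrow>
        (\<exists>a m. c = (?x * ?y) *s a + lincomb (\<lambda>b. if b then ?y *s u else w) m)" for c
        unfolding N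
      proof (rule intersection_generators[OF y_x, where F = "\<lambda>b. if b then ?y else 0" and G = "\<lambda>b. if b then 0 else ?x"])
        show "\<exists>a. (if b then ?y *s u else w) = (if b then ?y else 0) *s u + ?x *s a" for b
          by (rule exI[of _ "if b then 0 else v"]) (simp add: w)
        show "\<exists>a. (if b then ?y *s u else w) = (if b then 0 else ?x) *s v + ?y *s a" for b
          by (rule exI[of _ "if b then u else 0"]) (simp add: w)
        fix f g assume "\<And>i. f * u $ i - g * v $ i \<in> ?I"
        then have "f \<in> ?I" "g \<in> ?I" using indep by blast+
        then obtain s t s' t' where "f = ?x * s + ?y * t" "g = ?x * s' + ?y * t'" unfolding in_ideal_2 by blast
        then show "\<exists>m. ?x dvd f - (\<Sum>b\<in>UNIV. m b * (if b then ?y else 0)) \<and>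
          ?y dvd g - (\<Sum>b\<in>UNIV. m b * (if b then 0 else ?x))"
          by (intro exI[of _ "\<lambda>b. if b then t else s'"]) (simp add: UNIV_bool mult.commute)
      qed
      have wy: "?y dvd m" if mw: "m *s w = ?y *s z" for m z
      proof -
        have "(?x * m) *s v = ?y *s z" using mw by (simp add: w mult.commute)
        then show ?thesis using v_reg y_x by blast
      qed
      obtain g :: "'n + bool \<Rightarrow> ('k, 'n) der" where "D = range (lincomb g)" "proj_dim (*s) D \<le> 1"
        by (rule deletion_two_extra_generators[OF inj x0 y0 D N2 w_def u_reg wy])
      then show ?thesis by blast
    next
      case False
      then obtain f g where fg: "\<And>i. f * u $ i - g * v $ i \<in> ?I" and fg': "f \<notin> ?I \<or> g \<notin> ?I" by blast
      have fI: "f \<notin> ?I"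
      proof
        assume f: "f \<in> ?I"
        have "g * v $ k = f * u $ k - (f * u $ k - g * v $ k)" by simp
        then have "g * v $ k \<in> ?I" using fg I(5) I(8)[OF f] by metis
        then show False using I(1) k fg' f by blast
      qed
      obtain F G r r' vs where FG: "\<And>i. F * u $ i - G * v $ i \<in> ?I"
        and vs: "\<And>b. b \<in> set vs \<Longrightarrow> lin b \<notin> ?I"
        and F: "F * r - prod_list (map lin vs) \<in> ?I" and G: "G * r' - prod_list (map lin vs) \<in> ?I"
      proof (rule syzygy_dividing_linear_forms[OF fin W a \<theta> inj \<phi>1(1,3) \<phi>2(1,3) u v fg fI])
        fix F G r r' and vs :: "('k ^ 'n) list"
        assume "\<And>i. F * u $ i - G * v $ i \<in> ?I" "\<And>b. b \<in> set vs \<Longrightarrow> lin b \<notin> ?I"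
          "F * r - prod_list (map lin vs) \<in> ?I" "G * r' - prod_list (map lin vs) \<in> ?I"
        then show thesis by (rule that)
      qed
      define \<Lambda> where "\<Lambda> = lin ` set vs"
      have \<Lambda>: "prime_ideal (ideal {l, ?x, ?y})" "l \<notin> ?I" if "l \<in> \<Lambda>" for l
        using that vs prime_ideal_lin3 by (auto simp: \<Lambda>_def)
      obtain q p where qp: "\<And>i. q * u $ i - p * v $ i \<in> ?I" and q: "q \<notin> ?I"
        and gen: "\<And>f g. (\<And>i. f * u $ i - g * v $ i \<in> ?I) \<Longrightarrow> \<exists>s. f - s * q \<in> ?I \<and> g - s * p \<in> ?I"
        and q1: "(\<exists>e. q * e - 1 \<in> ?I) \<or> (\<exists>l\<in>\<Lambda>. q \<in> ideal {l, ?x, ?y})"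
        and p1: "(\<exists>e. p * e - 1 \<in> ?I) \<or> (\<exists>l\<in>\<Lambda>. p \<in> ideal {l, ?x, ?y})"
      proof (rule generating_syzygy[where u = "\<lambda>i. u $ i" and v = "\<lambda>i. v $ i" and T = "{?x, ?y}",
            OF prime_ideal_lin2 \<Lambda> j k FG F _ G])
        show "set (map lin vs) \<subseteq> \<Lambda>" by (simp add: \<Lambda>_def)
        fix q p
        assume "\<And>i. q * u $ i - p * v $ i \<in> ?I" "q \<notin> ?I"
          "\<And>f g. (\<And>i. f * u $ i - g * v $ i \<in> ?I) \<Longrightarrow> \<exists>s. f - s * q \<in> ?I \<and> g - s * p \<in> ?I"
          "(\<exists>e. q * e - 1 \<in> ?I) \<or> (\<exists>l\<in>\<Lambda>. q \<in> ideal {l, ?x, ?y})"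
          "(\<exists>e. p * e - 1 \<in> ?I) \<or> (\<exists>l\<in>\<Lambda>. p \<in> ideal {l, ?x, ?y})"
        then show thesis by (rule that)
      qed
      show ?thesis
      proof (cases "(\<exists>e. q * e - 1 \<in> ?I) \<or> (\<exists>e. p * e - 1 \<in> ?I)")
        case True
        then show ?thesis
        proof
          assume "\<exists>e. q * e - 1 \<in> ?I"
          then obtain e where e: "q * e - 1 \<in> ?I" by blast
          have "u $ i - (e * p) * v $ i \<in> ?I" for i
          proof -
            have "u $ i - (e * p) * v $ i = e * (q * u $ i - p * v $ i) - (q * e - 1) * u $ i" by (simp add: algebra_simps)
            then show ?thesis using qp e I(5,7,8) by simp
          qed
          then show ?thesis using case_uv k by blast
        next
          assume "\<exists>e. p * e - 1 \<in> ?I"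
          then obtain e where e: "p * e - 1 \<in> ?I" by blast
          have "v $ i - (e * q) * u $ i \<in> ?I" for i
          proof -
            have "v $ i - (e * q) * u $ i = - (e * (q * u $ i - p * v $ i)) - (p * e - 1) * v $ i" by (simp add: algebra_simps)
            then show ?thesis using qp e I(5,6,7,8) by simp
          qed
          then show ?thesis using case_vu j by blast
        qed
      next
        case False
        have ctI: "const_term z = 0" if "z \<in> ?I" for z using that unfolding in_ideal_2 by auto
        have const_term\<Lambda>: "const_term z = 0" if "l \<in> \<Lambda>" "z \<in> ideal {l, ?x, ?y}" for l z
        proof -
          obtain m where "z - l * m \<in> ?I" using \<open>z \<in> _\<close> in_ideal_insert[of z l "{?x, ?y}"] by blast
          then have "const_term (z - l * m) = 0" by (rule ctI)
          then show ?thesis using that(1) by (auto simp: \<Lambda>_def)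
        qed
        have ctqp: "const_term q = 0" "const_term p = 0" using q1 p1 False const_term\<Lambda> by blast+
        \<comment> \<open>\<open>(v\<^sub>i, u\<^sub>i)\<close> is a relation between the proportional vectors \<open>u\<close> and \<open>v\<close>, hence a multiple of \<open>(q, p)\<close>.\<close>
        have ctuv: "const_term (u $ i) = 0 \<and> const_term (v $ i) = 0" for i
        proof -
          have "v $ i * u $ m - u $ i * v $ m \<in> ?I" for m
          proof -
            have "q * (v $ i * u $ m - u $ i * v $ m)
              = v $ i * (q * u $ m - p * v $ m) - v $ m * (q * u $ i - p * v $ i)" by (simp add: algebra_simps)
            then have "q * (v $ i * u $ m - u $ i * v $ m) \<in> ?I" using qp I(5,7) by simp
            then show ?thesis using I(1) q by blast
          qed
          then obtain s where s: "v $ i - s * q \<in> ?I" "u $ i - s * p \<in> ?I" using gen by blast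
          then show ?thesis using ctI[OF s(1)] ctI[OF s(2)] ctqp by simp
        qed
        have "(q *s u - p *s v) $ i \<in> ?I" for i using qp by simp
        then obtain a0 b where ab0: "q *s u - p *s v = ?x *s a0 + ?y *s b" using vec_in_ideal2 by blast
        define a' where "a' = - a0"
        define w where "w = q *s u + ?x *s a'"
        have w2: "w = p *s v + ?y *s b"
        proof -
          have "q *s u = p *s v + ?x *s a0 + ?y *s b" using ab0 by (simp add: diff_eq_eq ac_simps)
          then show ?thesis by (simp add: w_def a'_def)
        qed
        \<comment> \<open>Compare linear parts of the two expressions for \<open>w\<close>: the products \<open>q u\<close> and \<open>p v\<close> have none,
          and \<open>a1\<close>, \<open>a2\<close> are linearly independent.\<close>
        have ctab: "const_term (a' $ i) = 0 \<and> const_term (b $ i) = 0" for i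
        proof -
          have "linear_coeffs (w $ i) = const_term (a' $ i) *s a1" by (simp add: w_def ctqp ctuv)
          moreover have "linear_coeffs (w $ i) = const_term (b $ i) *s a2" by (simp add: w2 ctqp ctuv)
          ultimately have e: "const_term (a' $ i) *s a1 = const_term (b $ i) *s a2" by simp
          have "const_term (b $ i) = 0"
          proof (rule ccontr)
            assume nz: "const_term (b $ i) \<noteq> 0"
            have "a2 = (const_term (a' $ i) / const_term (b $ i)) *s a1"
              using arg_cong[OF e, of "\<lambda>c. (1 / const_term (b $ i)) *s c"] nz by simp
            then show False using noncollinearD(2)[OF W a] by blast
          qed
          moreover from this have "const_term (a' $ i) = 0"
            using e noncollinearD(1)[OF W a(1)] by (auto simp: vec_eq_iff)
          ultimately show ?thesis by blast
        qed
        have N3: "(\<exists>\<psi>. lincomb \<theta> c = (?x * ?y) *s \<psi>) \<longleftrightarrow>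
          (\<exists>a m. c = (?x * ?y) *s a + lincomb (\<lambda>j. (case j of Some True \<Rightarrow> ?y *s u | Some False \<Rightarrow> ?x *s v | None \<Rightarrow> w)) m)" for c
          unfolding N
        proof (rule intersection_generators[OF y_x, where F = "\<lambda>j. (case j of Some True \<Rightarrow> ?y | Some False \<Rightarrow> 0 | None \<Rightarrow> q)" and G = "\<lambda>j. (case j of Some True \<Rightarrow> 0 | Some False \<Rightarrow> ?x | None \<Rightarrow> p)"])
          fix j :: "bool option"
          show "\<exists>a. (case j of Some True \<Rightarrow> ?y *s u | Some False \<Rightarrow> ?x *s v | None \<Rightarrow> w) = (case j of Some True \<Rightarrow> ?y | Some False \<Rightarrow> 0 | None \<Rightarrow> q) *s u + ?x *s a"
            by (rule exI[of _ "case j of Some True \<Rightarrow> 0 | Some False \<Rightarrow> v | None \<Rightarrow> a'"])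
              (simp add: w_def split: option.split bool.split)
          show "\<exists>a. (case j of Some True \<Rightarrow> ?y *s u | Some False \<Rightarrow> ?x *s v | None \<Rightarrow> w) = (case j of Some True \<Rightarrow> 0 | Some False \<Rightarrow> ?x | None \<Rightarrow> p) *s v + ?y *s a"
            by (rule exI[of _ "case j of Some True \<Rightarrow> u | Some False \<Rightarrow> 0 | None \<Rightarrow> b"])
              (simp add: w2 split: option.split bool.split)
        next
          fix f g assume "\<And>i. f * u $ i - g * v $ i \<in> ?I"
          then obtain s where "f - s * q \<in> ?I" "g - s * p \<in> ?I" using gen by blast
          then obtain s1 t1 s2 t2 where "f - s * q = ?x * s1 + ?y * t1" "g - s * p = ?x * s2 + ?y * t2"
            unfolding in_ideal_2 by blast
          then have "f - (s * q + t1 * ?y) = ?x * s1" "g - (s * p + s2 * ?x) = ?y * t2"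
            by (simp_all add: algebra_simps)
          then show "\<exists>m. ?x dvd f - (\<Sum>j\<in>UNIV. m j * (case j of Some True \<Rightarrow> ?y | Some False \<Rightarrow> 0 | None \<Rightarrow> q)) \<and> ?y dvd g - (\<Sum>j\<in>UNIV. m j * (case j of Some True \<Rightarrow> 0 | Some False \<Rightarrow> ?x | None \<Rightarrow> p))"
            by (intro exI[of _ "\<lambda>j. case j of Some True \<Rightarrow> t1 | Some False \<Rightarrow> s2 | None \<Rightarrow> s"])
              (simp add: sum_UNIV_bool_option)
        qed
        have subD: "vmod.subspace D" unfolding D_def by (rule log_der_of_subspace)
        have qreg: "f \<in> ?I" if "f * q \<in> ?I" for f using I(1) q that by blast
        obtain g :: "'n + bool option \<Rightarrow> ('k, 'n) der" where
          "D = range (lincomb g)" "\<And>c i. lincomb g c = 0 \<Longrightarrow> const_term (c $ i) = 0" "\<not> proj_dim (*s) D \<le> 1"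
          by (rule deletion_three_extra_generators[OF inj x0 y0 D subD N3 w_def w2 u_reg v_reg x_y y_x qreg])
            (use ctqp ctuv ctab in auto)
        then show ?thesis by blast
      qed
    qed
  qed
qed

lemma hyperplane_subset_imp_collinear:
  fixes a b :: "'k::field ^ 'n::finite"
  assumes "a \<noteq> 0" "\<And>v. dot a v = 0 \<Longrightarrow> dot b v = 0"
  shows "\<exists>c. b = c *s a"
proof (rule ccontr)
  assume "\<nexists>c. b = c *s a"
  then obtain w where "dot a w = 0" "dot b w = 1"
    using dual_vector[OF assms(1), of b 0 1] by blast
  then show False using assms(2)[of w] by simp
qed

lemma defines_hyperplane_iff:
  "defines_hyperplane \<alpha> H \<longleftrightarrow> (\<exists>a. \<alpha> = lin a \<and> a \<noteq> 0 \<and> H = {v. dot a v = 0})"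
  unfolding defines_hyperplane_def homog_1_iff by (auto simp: mpoly_eval_lin)

text \<open>Forms with the same kernel are proportional, so the condition for one form of each hyperplane
implies it for all of them.\<close>

lemma arrangement_normals:
  fixes A :: "('k::field ^ 'n::finite) set set"
  assumes "arrangement A"
  obtains \<nu> where "inj_on \<nu> A" "noncollinear (\<nu> ` A)" "\<And>C. C \<subseteq> A \<Longrightarrow> log_der C = log_der_of (\<nu> ` C)"
proof -
  let ?hyp = "\<lambda>a :: 'k ^ 'n. {v. dot a v = 0}"
  have "\<exists>a. a \<noteq> 0 \<and> H = ?hyp a" if "H \<in> A" for H
    using assms that unfolding arrangement_def defines_hyperplane_iff by blast
  then obtain \<nu> where \<nu>: "\<And>H. H \<in> A \<Longrightarrow> \<nu> H \<noteq> 0" "\<And>H. H \<in> A \<Longrightarrow> H = ?hyp (\<nu> H)" by metis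
  have inj: "inj_on \<nu> A" by (rule inj_onI) (metis \<nu>(2))
  have "noncollinear (\<nu> ` A)"
    unfolding noncollinear_def
  proof (intro conjI ballI impI allI)
    show "0 \<notin> \<nu> ` A" using \<nu>(1) by force
    fix a b c assume ab: "a \<in> \<nu> ` A" "b \<in> \<nu> ` A" "a \<noteq> b"
    then obtain H H' where H: "H \<in> A" "a = \<nu> H" "H' \<in> A" "b = \<nu> H'" by blast
    show "b \<noteq> c *s a"
    proof
      assume e: "b = c *s a"
      have c: "c \<noteq> 0" using e \<nu>(1) H by auto
      have "dot b v = c * dot a v" for v
        by (simp add: e sum_distrib_left mult.assoc)
      then have "?hyp b = ?hyp a" using c by simp
      then have "H' = H" using \<nu>(2)[OF H(1)] \<nu>(2)[OF H(3)] H(2,4) by simp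
      then show False using H ab(3) by simp
    qed
  qed
  moreover have "log_der C = log_der_of (\<nu> ` C)" if C: "C \<subseteq> A" for C
  proof (intro set_eqI iffI)
    fix \<theta> assume \<theta>: "\<theta> \<in> log_der C"
    have "lin (\<nu> H) dvd der_apply \<theta> (lin (\<nu> H))" if H: "H \<in> C" for H
    proof -
      have "defines_hyperplane (lin (\<nu> H)) H" unfolding defines_hyperplane_iff using \<nu> H C by blast
      then show ?thesis using \<theta> H unfolding log_der_def by blast
    qed
    then show "\<theta> \<in> log_der_of (\<nu> ` C)" by (auto simp: log_der_of_def)
  next
    fix \<theta> assume \<theta>: "\<theta> \<in> log_der_of (\<nu> ` C)"
    have "\<alpha> dvd der_apply \<theta> \<alpha>" if H: "H \<in> C" and \<alpha>: "defines_hyperplane \<alpha> H" for H \<alpha>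
    proof -
      obtain a where a: "\<alpha> = lin a" "a \<noteq> 0" "H = ?hyp a" using \<alpha> unfolding defines_hyperplane_iff by blast
      have "?hyp (\<nu> H) = ?hyp a" using \<nu>(2)[of H] a(3) H C by blast
      then obtain c where c: "a = c *s \<nu> H"
        using hyperplane_subset_imp_collinear[of "\<nu> H" a] \<nu>(1)[of H] H C by blast
      have "lin (\<nu> H) dvd der_apply \<theta> (lin (\<nu> H))" using \<theta> H by (auto simp: log_der_of_def)
      moreover have "der_apply \<theta> (lin a) = const_poly c * der_apply \<theta> (lin (\<nu> H))"
        using der_apply_lin_comb[of \<theta> c "\<nu> H" 0 0] c by simp
      ultimately show ?thesis by (simp add: a(1) c lin_scale mult_dvd_mono)
    qed
    then show "\<theta> \<in> log_der C" by (auto simp: log_der_def)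
  qed
  ultimately show ?thesis using that inj by blast
qed

lemma log_der_of_graded:
  fixes W :: "('k::field ^ 'n::finite) set"
  assumes "\<theta> \<in> log_der_of W"
  shows "der_component d \<theta> \<in> log_der_of W"
proof -
  have "lin a dvd der_apply (der_component d \<theta>) (lin a)" if "a \<in> W" for a
  proof -
    have "(const_poly c :: ('k, 'n) mpoly) \<in> homog 0" for c
      by (auto simp: homog_def const_poly_def split: if_splits)
    then have "homog_component d (f * const_poly c) = homog_component d f * const_poly c" for f :: "('k, 'n) mpoly" and c
      using homog_component_mult_homog[of "const_poly c" 0 d f] by simp
    then have e: "der_apply (der_component d \<theta>) (lin a) = homog_component d (der_apply \<theta> (lin a))"
      by (simp add: der_apply_lin der_component_def homog_component_sum)
    obtain k where "der_apply \<theta> (lin a) = lin a * k" using assms \<open>a \<in> W\<close> by (auto simp: log_der_of_def elim: dvdE)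
    then have "der_apply (der_component d \<theta>) (lin a) = homog_component d (k * lin a)" by (simp add: e mult.commute)
    moreover have "lin a \<in> homog 1" using homog_1_iff by blast
    ultimately show ?thesis using homog_component_mult_homog[of "lin a" 1 d k] by simp
  qed
  then show ?thesis by (simp add: log_der_of_def)
qed

theorem theorem1p7:
  fixes B :: "('k::field ^ 'n::finite) set set"
  assumes "NT_free_2 B"
  shows "proj_dim (*s) (log_der B) \<le> 1 \<longleftrightarrow> size (deriv_degree_seq B) \<le> CARD('n) + 2"
proof -
  obtain A H1 H2 where A: "free_arrangement A" "H1 \<in> A" "H2 \<in> A" "H1 \<noteq> H2" and B: "B = A - {H1, H2}"
    using assms unfolding NT_free_2_def by blast
  have "arrangement A" and free: "free_mod (*s) (log_der A)" using A(1) by (auto simp: free_arrangement_def)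
  then obtain \<nu> where inj: "inj_on \<nu> A" and nc: "noncollinear (\<nu> ` A)"
    and ld: "\<And>C. C \<subseteq> A \<Longrightarrow> log_der C = log_der_of (\<nu> ` C)"
    using arrangement_normals by blast
  have "\<nu> ` B = \<nu> ` A - {\<nu> H1, \<nu> H2}"
    using inj_on_image_set_diff[OF inj, of A "{H1, H2}"] A by (auto simp: B)
  then have D: "log_der B = log_der_of (\<nu> ` A - {\<nu> H1, \<nu> H2})" using ld[of B] B by auto
  have fin: "finite (\<nu> ` A)" using \<open>arrangement A\<close> by (simp add: arrangement_def)
  have freeW: "free_mod (*s) (log_der_of (\<nu> ` A))" using free ld[of A] by simp
  have ne: "\<nu> H1 \<noteq> \<nu> H2" using inj A by (auto simp: inj_on_def)
  have graded: "der_component d \<theta> \<in> log_der B" if "\<theta> \<in> log_der B" for \<theta> d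
    using log_der_of_graded that unfolding D by blast
  let ?G = "SOME G. min_homog_gens (log_der B) G"
  have size: "size (deriv_degree_seq B) = card ?G"
    by (simp add: deriv_degree_seq_def)
  have G: "min_homog_gens (log_der B) ?G" if "log_der B = range (lincomb g)" for g :: "'i::finite \<Rightarrow> ('k, 'n) der"
  proof (rule someI_ex, rule exists_min_homog_gens)
    show "vmod.span (range g) = log_der B" using that finite_range_comb_span by metis
  qed (auto intro: graded)
  consider (two) g :: "'n + bool \<Rightarrow> ('k, 'n) der" where "log_der B = range (lincomb g)" "proj_dim (*s) (log_der B) \<le> 1"
    | (three) g :: "'n + bool option \<Rightarrow> ('k, 'n) der" where "log_der B = range (lincomb g)"
      "\<And>c i. lincomb g c = 0 \<Longrightarrow> const_term (c $ i) = 0" "\<not> proj_dim (*s) (log_der B) \<le> 1"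
    using double_deletion_dichotomy[OF fin nc _ _ ne freeW D] A by blast
  then show ?thesis
  proof cases
    case two
    have "card ?G \<le> CARD('n + bool)" using generator_count(1)[OF two(1) G[OF two(1)]] .
    then show ?thesis using two(2) by (simp add: size)
  next
    case three
    have "CARD('n + bool option) \<le> card ?G" using generator_count(2)[OF three(1) G[OF three(1)]] three(2) by blast
    then show ?thesis using three(3) by (simp add: size)
  qed
qed

end
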